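(* Almost complex blow-ups at a point are unique in the following sense. Let $(X_1,J_1)$ and $(X_2,J_2)$ be $2n$-dimensional almost complex manifolds, let $f:(X_1,J_1)\to(X_2,J_2)$ be a pseudobiholomorphism with $f(p_1)=p_2$, and suppose that $X_1$ and $X_2$ have almost complex blow-ups $\pi_1:\tilde{X}_1\to X_1$ and $\pi_2:\tilde{X}_2\to X_2$ at $p_1$ and $p_2$ respectively. Then there exists a pseudobiholomorphism $\tilde{f}:\tilde{X}_1\to\tilde{X}_2$ such that $\pi_2\circ\tilde{f}=f\circ\pi_1$ and, identifying the exceptional divisors with the projectivized tangent spaces, $\tilde{f}([e])=[df_{p_1}(e)]$ for all $[e]\in\mathbb{P}T_{p_1}X_1$.
   Context: An almost complex structure on a smooth $2n$-manifold $M$ is a smooth $J\in\mathrm{End}(TM)$ with $J^2=-\mathrm{id}$ (not assumed integrable). A smooth map $f:(M,J)\to(M',J')$ is pseudoholomorphic if $J'\circ df=df\circ J$; a pseudobiholomorphism is a pseudoholomorphic diffeomorphism. Almost complex blow-up. Let $(M,J)$ be $2n$-dimensional, $x\in M$, and let $(\mathcal{U},\phi)$ be a smooth local chart at $x$ with $0\in\mathcal{U}\subset\mathbb{C}^n$, $\phi:\mathcal{U}\to\phi(\mathcal{U})\subset M$, $\phi(0)=x$. Let $\mathcal{B}=\{((z_1,\ldots,z_n),[v_1:\ldots:v_n])\in\mathcal{U}\times\mathbb{P}^{n-1}(\mathbb{C}) : z_iv_j-z_jv_i=0,\ i,j=1,\ldots,n\}$. Let $\tilde{M}_x$ be the smooth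 manifold $((M\setminus\{x\})\cup\mathcal{B})/\sim$, where $\phi(z)\sim(z,[z])$ for $z\neq 0$, and let $\pi:\tilde{M}_x\to M$ be $\pi(z,[v])=\phi(z)$ on $\mathcal{B}$ and $\pi(y)=y$ for $y\in M\setminus\{x\}$. An almost complex blow-up of $M$ at $x$ with respect to $(\mathcal{U},\phi)$ is a smooth almost complex structure $\tilde{J}$ on $\tilde{M}_x$ such that $\pi$ is $(\tilde{J},J)$-pseudoholomorphic. An almost complex blow-up of $(M,J)$ at $x$ is one with respect to some smooth local chart at $x$. The exceptional divisor is $E=\pi^{-1}(x)=\{0\}\times\mathbb{P}^{n-1}(\mathbb{C})$; it is identified with the projectivized tangent space $\mathbb{P}T_xM$ (the space of $J$-complex lines in $T_xM$) by $[v]\mapsto[d\phi_0(v)]$. *)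

theory Defs
  imports "HOL-Analysis.Analysis"
begin

section \<open>Smooth maps between open subsets of Euclidean spaces\<close>

primrec ck_on :: "nat \<Rightarrow> 'a::euclidean_space set \<Rightarrow> ('a \<Rightarrow> 'b::real_normed_vector) \<Rightarrow> bool"
  where
    "ck_on 0 S f \<longleftrightarrow> continuous_on S f"
  | "ck_on (Suc k) S f \<longleftrightarrow> (\<forall>x\<in>S. f differentiable (at x)) \<and>
       (\<forall>v. ck_on k S (\<lambda>x. frechet_derivative f (at x) v))"

text \<open>Only used for open \<open>S\<close>. Differentiability is over the reals, also when the vector
  spaces involved happen to be complex.\<close>
definition smooth_on :: "'a::euclidean_space set \<Rightarrow> ('a \<Rightarrow> 'b::real_normed_vector) \<Rightarrow> bool"
  where "smooth_on S f \<longleftrightarrow> (\<forall>k. ck_on k S f)"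


section \<open>Smooth manifolds of dimension $2n$\<close>

text \<open>A chart is written as a local parametrization: a pair \<open>(U, \<phi>)\<close> with \<open>U\<close> an open subset
  of \<open>complex ^ 'n\<close>, used here as a real vector space of dimension \<open>2 * CARD('n)\<close>, and
  \<open>\<phi>\<close> an injection of \<open>U\<close> into the manifold. The values of \<open>\<phi>\<close> outside \<open>U\<close> are irrelevant.
  A manifold is given by an atlas, which determines its points and its topology.\<close>

type_synonym ('a, 'n) chart = "(complex ^ 'n) set \<times> (complex ^ 'n \<Rightarrow> 'a)"

type_synonym ('a, 'n) atlas = "('a, 'n) chart set"

definition coord :: "('a, 'n::finite) chart \<Rightarrow> 'a \<Rightarrow> complex ^ 'n"
  where "coord c = the_inv_into (fst c) (snd c)"

definition cdom :: "('a, 'n::finite) chart \<Rightarrow> 'a set"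
  where "cdom c = snd c ` fst c"

definition points :: "('a, 'n::finite) atlas \<Rightarrow> 'a set"
  where "points A = (\<Union>c\<in>A. cdom c)"

definition mtop :: "('a, 'n::finite) atlas \<Rightarrow> 'a topology"
  where "mtop A = topology (\<lambda>W. W \<subseteq> points A \<and> (\<forall>c\<in>A. open (fst c \<inter> snd c -` W)))"

text \<open>The transition map from \<open>c\<close> to \<open>d\<close> is \<open>coord d \<circ> snd c\<close> on \<open>fst c \<inter> snd c -` cdom d\<close>.\<close>
definition smooth_transition :: "('a, 'n::finite) chart \<Rightarrow> ('a, 'n) chart \<Rightarrow> bool"
  where "smooth_transition c d \<longleftrightarrow>
    open (fst c \<inter> snd c -` cdom d) \<and>
    smooth_on (fst c \<inter> snd c -` cdom d) (coord d \<circ> snd c)"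

text \<open>The charts of the maximal atlas containing \<open>A\<close>.\<close>
definition smooth_chart :: "('a, 'n::finite) atlas \<Rightarrow> ('a, 'n) chart \<Rightarrow> bool"
  where "smooth_chart A c \<longleftrightarrow>
    open (fst c) \<and> inj_on (snd c) (fst c) \<and> cdom c \<subseteq> points A \<and>
    (\<forall>d\<in>A. smooth_transition c d \<and> smooth_transition d c)"

definition smooth_manifold :: "('a, 'n::finite) atlas \<Rightarrow> bool"
  where "smooth_manifold A \<longleftrightarrow>
    (\<forall>c\<in>A. smooth_chart A c) \<and>
    Hausdorff_space (mtop A) \<and>
    second_countable (mtop A)"

lemma openin_mtop:
  fixes A :: "('a, 'n::finite) atlas"
  assumes "\<And>c. c \<in> A \<Longrightarrow> open (fst c)"
  shows "openin (mtop A) W \<longleftrightarrow> W \<subseteq> points A \<and> (\<forall>c\<in>A. open (fst c \<inter> snd c -` W))"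
proof -
  have "istopology (\<lambda>W. W \<subseteq> points A \<and> (\<forall>c\<in>A. open (fst c \<inter> snd c -` W)))"
    unfolding istopology_def
  proof (intro conjI allI impI)
    fix S T
    assume "S \<subseteq> points A \<and> (\<forall>c\<in>A. open (fst c \<inter> snd c -` S))"
      and "T \<subseteq> points A \<and> (\<forall>c\<in>A. open (fst c \<inter> snd c -` T))"
    moreover have "fst c \<inter> snd c -` (S \<inter> T) = (fst c \<inter> snd c -` S) \<inter> (fst c \<inter> snd c -` T)"
      for c :: "('a, 'n) chart" by auto
    ultimately show "S \<inter> T \<subseteq> points A" "\<forall>c\<in>A. open (fst c \<inter> snd c -` (S \<inter> T))"
      by (auto simp: open_Int)
  next
    fix \<K>
    assume *: "\<forall>K\<in>\<K>. K \<subseteq> points A \<and> (\<forall>c\<in>A. open (fst c \<inter> snd c -` K))"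
    then show "\<Union>\<K> \<subseteq> points A" by auto
    show "\<forall>c\<in>A. open (fst c \<inter> snd c -` \<Union>\<K>)"
    proof
      fix c assume "c \<in> A"
      with * have "open (\<Union>K\<in>\<K>. fst c \<inter> snd c -` K)" by (intro open_UN) blast
      moreover have "(\<Union>K\<in>\<K>. fst c \<inter> snd c -` K) = fst c \<inter> snd c -` \<Union>\<K>" by blast
      ultimately show "open (fst c \<inter> snd c -` \<Union>\<K>)" by (simp only:)
    qed
  qed
  then show ?thesis unfolding mtop_def by (simp add: topology_inverse')
qed

lemma topspace_mtop:
  assumes "\<And>c. c \<in> A \<Longrightarrow> open (fst c)"
  shows "topspace (mtop A) = points A"
proof -
  have "fst c \<inter> snd c -` points A = fst c" if "c \<in> A" for c
    using that by (auto simp: points_def cdom_def)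
  then have "openin (mtop A) (points A)" using assms by (simp add: openin_mtop)
  moreover have "topspace (mtop A) \<subseteq> points A"
    using openin_topspace[of "mtop A"] openin_mtop[of A] assms by blast
  ultimately show ?thesis by (meson openin_subset subset_antisym)
qed

text \<open>The openness requirement expresses continuity of \<open>f\<close>.\<close>
definition smooth_map ::
    "('a, 'n::finite) atlas \<Rightarrow> ('b, 'm::finite) atlas \<Rightarrow> ('a \<Rightarrow> 'b) \<Rightarrow> bool"
  where "smooth_map A B f \<longleftrightarrow>
    f ` points A \<subseteq> points B \<and>
    (\<forall>c\<in>A. \<forall>d\<in>B.
       open (fst c \<inter> (f \<circ> snd c) -` cdom d) \<and>
       smooth_on (fst c \<inter> (f \<circ> snd c) -` cdom d) (coord d \<circ> f \<circ> snd c))"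

definition diffeomorphism ::
    "('a, 'n::finite) atlas \<Rightarrow> ('b, 'm::finite) atlas \<Rightarrow> ('a \<Rightarrow> 'b) \<Rightarrow> bool"
  where "diffeomorphism A B f \<longleftrightarrow>
    bij_betw f (points A) (points B) \<and> smooth_map A B f \<and>
    smooth_map B A (the_inv_into (points A) f)"


section \<open>Tangent vectors and differentials\<close>

text \<open>A tangent vector at \<open>p\<close> is the family of its components with respect to the charts of
  the atlas around \<open>p\<close>, transforming by the derivatives of the transition maps; it is set to
  zero on all other charts. Addition, scaling and zero are componentwise.\<close>

type_synonym ('a, 'n) tvec = "('a, 'n) chart \<Rightarrow> complex ^ 'n"

definition charts_at :: "('a, 'n::finite) atlas \<Rightarrow> 'a \<Rightarrow> ('a, 'n) chart set"
  where "charts_at A p = {c \<in> A. p \<in> cdom c}"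

definition tangent_space :: "('a, 'n::finite) atlas \<Rightarrow> 'a \<Rightarrow> ('a, 'n) tvec set"
  where "tangent_space A p = {v.
    (\<forall>c. c \<notin> charts_at A p \<longrightarrow> v c = 0) \<and>
    (\<forall>c\<in>charts_at A p. \<forall>d\<in>charts_at A p.
       v d = frechet_derivative (coord d \<circ> snd c) (at (coord c p)) (v c))}"

definition lincomb :: "real \<Rightarrow> ('a, 'n::finite) tvec \<Rightarrow> real \<Rightarrow> ('a, 'n) tvec \<Rightarrow> ('a, 'n) tvec"
  where "lincomb a v b w = (\<lambda>c. a *\<^sub>R v c + b *\<^sub>R w c)"

text \<open>\<open>d\<phi>\<^sub>z(e)\<close> for a chart \<open>c = (U, \<phi>)\<close> of the maximal atlas, \<open>z \<in> U\<close> and \<open>e \<in> \<complex>\<^sup>n = T\<^sub>zU\<close>.\<close>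
definition dchart ::
    "('a, 'n::finite) atlas \<Rightarrow> ('a, 'n) chart \<Rightarrow> complex ^ 'n \<Rightarrow> complex ^ 'n \<Rightarrow> ('a, 'n) tvec"
  where "dchart A c z e = (\<lambda>d. if d \<in> charts_at A (snd c z)
    then frechet_derivative (coord d \<circ> snd c) (at z) e else 0)"

text \<open>\<open>df\<^sub>p(v)\<close>. For a tangent vector \<open>v\<close> and smooth \<open>f\<close> this does not depend on the chart
  \<open>c\<close> around \<open>p\<close> that is selected, by the chain rule.\<close>
definition differential ::
    "('a, 'n::finite) atlas \<Rightarrow> ('b, 'm::finite) atlas \<Rightarrow> ('a \<Rightarrow> 'b) \<Rightarrow> 'a \<Rightarrow>
     ('a, 'n) tvec \<Rightarrow> ('b, 'm) tvec"
  where "differential A B f p v = (\<lambda>d. if d \<in> charts_at B (f p)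
    then (let c = (SOME c. c \<in> charts_at A p)
          in frechet_derivative (coord d \<circ> f \<circ> snd c) (at (coord c p)) (v c))
    else 0)"


section \<open>Almost complex structures\<close>

text \<open>\<open>J p\<close> is an endomorphism of the tangent space at \<open>p\<close>; the last clause says that in every
  chart the matrix of \<open>J\<close> depends smoothly on the point.\<close>
definition almost_complex_structure ::
    "('a, 'n::finite) atlas \<Rightarrow> ('a \<Rightarrow> ('a, 'n) tvec \<Rightarrow> ('a, 'n) tvec) \<Rightarrow> bool"
  where "almost_complex_structure A J \<longleftrightarrow>
    (\<forall>p\<in>points A.
       J p ` tangent_space A p \<subseteq> tangent_space A p \<and>
       (\<forall>v\<in>tangent_space A p. \<forall>w\<in>tangent_space A p. \<forall>a b.
          J p (lincomb a v b w) = lincomb a (J p v) b (J p w)) \<and>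
       (\<forall>v\<in>tangent_space A p. J p (J p v) = (\<lambda>c. - v c))) \<and>
    (\<forall>c\<in>A. \<forall>e. smooth_on (fst c) (\<lambda>z. J (snd c z) (dchart A c z e) c))"

definition almost_complex_manifold ::
    "('a, 'n::finite) atlas \<Rightarrow> ('a \<Rightarrow> ('a, 'n) tvec \<Rightarrow> ('a, 'n) tvec) \<Rightarrow> bool"
  where "almost_complex_manifold A J \<longleftrightarrow> smooth_manifold A \<and> almost_complex_structure A J"

definition pseudoholomorphic ::
    "('a, 'n::finite) atlas \<Rightarrow> ('a \<Rightarrow> ('a, 'n) tvec \<Rightarrow> ('a, 'n) tvec) \<Rightarrow>
     ('b, 'm::finite) atlas \<Rightarrow> ('b \<Rightarrow> ('b, 'm) tvec \<Rightarrow> ('b, 'm) tvec) \<Rightarrow> ('a \<Rightarrow> 'b) \<Rightarrow> bool"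
  where "pseudoholomorphic A J B J' f \<longleftrightarrow>
    smooth_map A B f \<and>
    (\<forall>p\<in>points A. \<forall>v\<in>tangent_space A p.
       J' (f p) (differential A B f p v) = differential A B f p (J p v))"

definition pseudobiholomorphism ::
    "('a, 'n::finite) atlas \<Rightarrow> ('a \<Rightarrow> ('a, 'n) tvec \<Rightarrow> ('a, 'n) tvec) \<Rightarrow>
     ('b, 'm::finite) atlas \<Rightarrow> ('b \<Rightarrow> ('b, 'm) tvec \<Rightarrow> ('b, 'm) tvec) \<Rightarrow> ('a \<Rightarrow> 'b) \<Rightarrow> bool"
  where "pseudobiholomorphism A J B J' f \<longleftrightarrow>
    pseudoholomorphic A J B J' f \<and> diffeomorphism A B f"

text \<open>The \<open>J\<close>-complex line \<open>[e]\<close> spanned by a nonzero tangent vector \<open>e\<close> at \<open>p\<close>.\<close>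
definition Jline ::
    "('a \<Rightarrow> ('a, 'n::finite) tvec \<Rightarrow> ('a, 'n) tvec) \<Rightarrow> 'a \<Rightarrow> ('a, 'n) tvec \<Rightarrow> ('a, 'n) tvec set"
  where "Jline J p e = {lincomb a e b (J p e) | a b. True}"


section \<open>The blow-up of a smooth manifold at a point, with respect to a chart\<close>

text \<open>The point \<open>[v]\<close> of projective space, for \<open>v \<noteq> 0\<close>, as a complex line.\<close>
definition cline :: "complex ^ 'n::finite \<Rightarrow> (complex ^ 'n) set"
  where "cline v = range (\<lambda>t. t *s v)"

definition proj_space :: "(complex ^ 'n::finite) set set"
  where "proj_space = {cline v | v. v \<noteq> 0}"

definition incidence :: "(complex ^ 'n::finite) set \<Rightarrow> ((complex ^ 'n) \<times> (complex ^ 'n) set) set"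
  where "incidence U = {(z, L). z \<in> U \<and> L \<in> proj_space \<and>
    (\<forall>v\<in>L. \<forall>i j. z $ i * v $ j - z $ j * v $ i = 0)}"

text \<open>The blow-up is the quotient of \<open>(M \<setminus> {x}) <+> incidence U\<close> by the equivalence relation
  generated by \<open>\<phi>(z) \<sim> (z, [z])\<close> for \<open>z \<noteq> 0\<close>; its points are equivalence classes.\<close>

type_synonym ('a, 'n) pre_bl = "'a + (complex ^ 'n) \<times> (complex ^ 'n) set"

definition bl_set :: "('a, 'n::finite) atlas \<Rightarrow> 'a \<Rightarrow> ('a, 'n) chart \<Rightarrow> ('a, 'n) pre_bl set"
  where "bl_set A x c = (points A - {x}) <+> incidence (fst c)"

definition bl_glue :: "('a, 'n::finite) chart \<Rightarrow> ('a, 'n) pre_bl rel"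
  where "bl_glue c = {(Inl (snd c z), Inr (z, cline z)) | z. z \<in> fst c \<and> z \<noteq> 0}"

definition bl_rel :: "('a, 'n::finite) chart \<Rightarrow> ('a, 'n) pre_bl rel"
  where "bl_rel c = (bl_glue c \<union> (bl_glue c)\<inverse>)\<^sup>*"

definition bl_class :: "('a, 'n::finite) chart \<Rightarrow> ('a, 'n) pre_bl \<Rightarrow> ('a, 'n) pre_bl set"
  where "bl_class c a = bl_rel c `` {a}"

text \<open>The atlas consists of the charts of \<open>M\<close> restricted to \<open>M \<setminus> {x}\<close> and, for every index
  \<open>i\<close>, of the standard affine chart of \<open>incidence U \<subseteq> U \<times> \<P>\<^sup>n\<^sup>-\<^sup>1\<close> over \<open>{v\<^sub>i \<noteq> 0}\<close>: there
  \<open>[v] = [aff_dir i u]\<close> with \<open>v\<^sub>j / v\<^sub>i = u\<^sub>j\<close> for \<open>j \<noteq> i\<close>, and \<open>z = u\<^sub>i aff_dir i u\<close>.\<close>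

definition aff_dir :: "'n::finite \<Rightarrow> complex ^ 'n \<Rightarrow> complex ^ 'n"
  where "aff_dir i u = (\<chi> j. if j = i then 1 else u $ j)"

definition aff_base :: "'n::finite \<Rightarrow> complex ^ 'n \<Rightarrow> complex ^ 'n"
  where "aff_base i u = (u $ i) *s aff_dir i u"

definition blowup ::
    "('a, 'n::finite) atlas \<Rightarrow> 'a \<Rightarrow> ('a, 'n) chart \<Rightarrow> (('a, 'n) pre_bl set, 'n) atlas"
  where "blowup A x c =
    {(fst d \<inter> snd d -` (- {x}), \<lambda>u. bl_class c (Inl (snd d u))) | d. d \<in> A} \<union>
    {(aff_base i -` fst c, \<lambda>u. bl_class c (Inr (aff_base i u, cline (aff_dir i u)))) | i. True}"

text \<open>The map \<open>\<pi>\<close>, defined on representatives.\<close>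
definition blow_down :: "('a, 'n::finite) chart \<Rightarrow> ('a, 'n) pre_bl set \<Rightarrow> 'a"
  where "blow_down c q = the_elem (case_sum (\<lambda>y. y) (\<lambda>(z, L). snd c z) ` q)"

definition chart_centred :: "('a, 'n::finite) atlas \<Rightarrow> 'a \<Rightarrow> ('a, 'n) chart \<Rightarrow> bool"
  where "chart_centred A x c \<longleftrightarrow> smooth_chart A c \<and> 0 \<in> fst c \<and> snd c 0 = x"

definition almost_complex_blowup ::
    "('a, 'n::finite) atlas \<Rightarrow> ('a \<Rightarrow> ('a, 'n) tvec \<Rightarrow> ('a, 'n) tvec) \<Rightarrow> 'a \<Rightarrow> ('a, 'n) chart \<Rightarrow>
     (('a, 'n) pre_bl set \<Rightarrow> (('a, 'n) pre_bl set, 'n) tvec \<Rightarrow> (('a, 'n) pre_bl set, 'n) tvec) \<Rightarrow>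
     bool"
  where "almost_complex_blowup A J x c J' \<longleftrightarrow>
    chart_centred A x c \<and>
    almost_complex_structure (blowup A x c) J' \<and>
    pseudoholomorphic (blowup A x c) J' A J (blow_down c)"

definition exceptional_divisor ::
    "('a, 'n::finite) atlas \<Rightarrow> 'a \<Rightarrow> ('a, 'n) chart \<Rightarrow> ('a, 'n) pre_bl set set"
  where "exceptional_divisor A x c = {q \<in> points (blowup A x c). blow_down c q = x}"

text \<open>The identification \<open>[v] \<mapsto> [d\<phi>\<^sub>0(v)]\<close> of the exceptional divisor with the projectivized
  tangent space, as a relation: that it is a well-defined bijection is a consequence of
  \<open>\<pi>\<close> being pseudoholomorphic, which forces \<open>d\<phi>\<^sub>0\<close> to map complex lines to \<open>J\<close>-complex lines.\<close>
definition exc_ident ::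
    "('a, 'n::finite) atlas \<Rightarrow> ('a \<Rightarrow> ('a, 'n) tvec \<Rightarrow> ('a, 'n) tvec) \<Rightarrow> 'a \<Rightarrow> ('a, 'n) chart \<Rightarrow>
     (('a, 'n) pre_bl set \<times> ('a, 'n) tvec set) set"
  where "exc_ident A J x c =
    {(bl_class c (Inr (0, cline v)), Jline J x (dchart A c 0 v)) | v. v \<noteq> 0}"

lemma bl_rel_eq:
  assumes "inj_on (snd c) (fst c)"
  shows "bl_rel c = Id \<union> bl_glue c \<union> (bl_glue c)\<inverse>"
proof
  have "(a, b) \<in> Id \<union> bl_glue c \<union> (bl_glue c)\<inverse>"
    if "(a, b) \<in> (bl_glue c \<union> (bl_glue c)\<inverse>)\<^sup>*" for a b
    using that
  proof (induction rule: rtrancl_induct)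
    case (step y z)
    then show ?case using assms unfolding bl_glue_def by (auto dest: inj_onD)
  qed auto
  then show "bl_rel c \<subseteq> Id \<union> bl_glue c \<union> (bl_glue c)\<inverse>" unfolding bl_rel_def by auto
  show "Id \<union> bl_glue c \<union> (bl_glue c)\<inverse> \<subseteq> bl_rel c"
    unfolding bl_rel_def by auto
qed

lemma blow_down_class:
  assumes "inj_on (snd c) (fst c)"
  shows "blow_down c (bl_class c (Inl y)) = y"
    and "blow_down c (bl_class c (Inr (z, L))) = snd c z"
proof -
  have const: "case_sum (\<lambda>y. y) (\<lambda>(z, L). snd c z) b = case_sum (\<lambda>y. y) (\<lambda>(z, L). snd c z) a"
    if "b \<in> bl_class c a" for a b
    using that assms unfolding bl_class_def bl_rel_eq[OF assms] bl_glue_def by auto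
  have refl: "a \<in> bl_class c a" for a by (simp add: bl_class_def bl_rel_def)
  have "case_sum (\<lambda>y. y) (\<lambda>(z, L). snd c z) ` bl_class c a
      = {case_sum (\<lambda>y. y) (\<lambda>(z, L). snd c z) a}" for a
    using const refl by blast
  then have "blow_down c (bl_class c a) = case_sum (\<lambda>y. y) (\<lambda>(z, L). snd c z) a" for a
    by (simp add: blow_down_def)
  then show "blow_down c (bl_class c (Inl y)) = y"
    and "blow_down c (bl_class c (Inr (z, L))) = snd c z" by simp_all
qed

lemma cline_scale: "t \<noteq> 0 \<Longrightarrow> cline (t *s v) = cline v"
  unfolding cline_def
proof (intro equalityI subsetI)
  fix w assume "t \<noteq> 0" "w \<in> range (\<lambda>s. s *s v)"
  then obtain s where "w = (s / t) *s (t *s v)" by (auto simp: vector_smult_assoc)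
  then show "w \<in> range (\<lambda>s. s *s (t *s v))" by blast
qed (auto simp: vector_smult_assoc)

lemma incidence_cover:
  "incidence U = (\<Union>i. (\<lambda>u. (aff_base i u, cline (aff_dir i u))) ` (aff_base i -` U))"
proof (intro equalityI subsetI)
  fix p assume "p \<in> incidence U"
  then obtain z v where p: "p = (z, cline v)" "z \<in> U" "v \<noteq> 0"
    and inc: "\<And>w i j. w \<in> cline v \<Longrightarrow> z $ i * w $ j - z $ j * w $ i = 0"
    unfolding incidence_def proj_space_def by blast
  from p obtain i where i: "v $ i \<noteq> 0" by (metis vec_eq_iff zero_index)
  have "v \<in> cline v" unfolding cline_def by (metis rangeI vector_smult_lid)
  with inc have zv: "z $ i * v $ j = z $ j * v $ i" for j by fastforce
  define u where "u = (\<chi> j. if j = i then z $ i else v $ j / v $ i)"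
  have dir: "aff_dir i u = (1 / v $ i) *s v" using i by (auto simp: aff_dir_def u_def vec_eq_iff)
  have "aff_base i u = (z $ i) *s ((1 / v $ i) *s v)" unfolding aff_base_def dir by (simp add: u_def)
  also have "\<dots> = z" using i zv by (auto simp: vec_eq_iff field_simps)
  finally have "aff_base i u = z" .
  moreover have "cline (aff_dir i u) = cline v" using i by (simp add: dir cline_scale)
  ultimately have "p = (aff_base i u, cline (aff_dir i u))" "u \<in> aff_base i -` U"
    using p by auto
  then show "p \<in> (\<Union>i. (\<lambda>u. (aff_base i u, cline (aff_dir i u))) ` (aff_base i -` U))"
    by blast
next
  fix p assume "p \<in> (\<Union>i. (\<lambda>u. (aff_base i u, cline (aff_dir i u))) ` (aff_base i -` U))"
  then obtain i u where p: "p = (aff_base i u, cline (aff_dir i u))" "aff_base i u \<in> U" by auto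
  have "aff_dir i u $ i \<noteq> 0" by (simp add: aff_dir_def)
  then have "aff_dir i u \<noteq> 0" by auto
  then show "p \<in> incidence U"
    using p by (auto simp: incidence_def proj_space_def cline_def aff_base_def)
qed

lemma points_blowup: "points (blowup A x c) = bl_set A x c // bl_rel c"
proof -
  let ?f = "\<lambda>d. (fst d \<inter> snd d -` (- {x}), \<lambda>u. bl_class c (Inl (snd d u)))"
  let ?h = "\<lambda>i u. (aff_base i u, cline (aff_dir i u))"
  let ?g = "\<lambda>i. (aff_base i -` fst c, \<lambda>u. bl_class c (Inr (?h i u)))"
  have "blowup A x c = ?f ` A \<union> range ?g" 
    unfolding blowup_def by blast
  then have "points (blowup A x c) = (\<Union>d\<in>A. cdom (?f d)) \<union> (\<Union>i. cdom (?g i))"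
    unfolding points_def by (simp only: UN_Un image_Un Union_Un_distrib image_image)
  also have "(\<Union>d\<in>A. cdom (?f d)) = (\<lambda>y. bl_class c (Inl y)) ` (points A - {x})"
    unfolding cdom_def points_def fst_conv snd_conv
  proof (intro equalityI subsetI)
    fix q assume "q \<in> (\<lambda>y. bl_class c (Inl y)) ` ((\<Union>d\<in>A. snd d ` fst d) - {x})"
    then obtain d u where "d \<in> A" "u \<in> fst d" "snd d u \<noteq> x" "q = bl_class c (Inl (snd d u))"
      by auto
    then show "q \<in> (\<Union>d\<in>A. (\<lambda>u. bl_class c (Inl (snd d u))) ` (fst d \<inter> snd d -` (- {x})))"
      by (intro UN_I[of d] image_eqI[of _ _ u]) auto
  qed auto
  also have "(\<Union>i. cdom (?g i)) = (\<lambda>a. bl_class c (Inr a)) ` incidence (fst c)"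
    unfolding cdom_def incidence_cover fst_conv snd_conv image_UN image_image ..
  also have "(\<lambda>y. bl_class c (Inl y)) ` (points A - {x}) \<union> (\<lambda>a. bl_class c (Inr a)) ` incidence (fst c)
      = bl_class c ` bl_set A x c"
    unfolding bl_set_def Plus_def image_Un image_image ..
  also have "\<dots> = bl_set A x c // bl_rel c"
    unfolding quotient_def bl_class_def by (simp only: UNION_singleton_eq_range)
  finally show ?thesis .
qed

lemma smooth_on_has_derivative:
  assumes "smooth_on S f" "x \<in> S"
  shows "(f has_derivative frechet_derivative f (at x)) (at x)"
  using assms(1)[unfolded smooth_on_def, rule_format, of "Suc 0"] assms(2)
  by (auto simp: frechet_derivative_works)

text \<open>Every point of the projectivized tangent space is met by \<open>exc_ident\<close>.\<close>
lemma exc_ident_surj: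
  fixes A :: "('a, 'n::finite) atlas"
  assumes c: "chart_centred A x c" and e: "e \<in> tangent_space A x" "e \<noteq> (\<lambda>_. 0)"
    and A: "smooth_manifold A"
  shows "\<exists>q\<in>exceptional_divisor A x c. (q, Jline J x e) \<in> exc_ident A J x c"
proof -
  have cc: "smooth_chart A c" "0 \<in> fst c" "snd c 0 = x"
    using c by (auto simp: chart_centred_def)
  have inj: "inj_on (snd c) (fst c)" using cc by (simp add: smooth_chart_def)
  obtain d where d: "d \<in> charts_at A x" "e d \<noteq> 0" using e unfolding tangent_space_def by blast
  have dA: "d \<in> A" "x \<in> cdom d" "inj_on (snd d) (fst d)"
    using d A by (auto simp: charts_at_def smooth_manifold_def smooth_chart_def)
  define y where "y = coord d x"
  have y: "y \<in> fst d" "snd d y = x"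
    using dA by (auto simp: y_def coord_def cdom_def the_inv_into_f_f)
  have x: "x \<in> cdom c" using cc by (auto simp: cdom_def)
  have c0: "coord c x = 0" using cc inj by (auto simp: coord_def the_inv_into_f_f)
  have coordc: "snd c (coord c w) = w" "coord c w \<in> fst c" if "w \<in> cdom c" for w
    using that inj by (auto simp: coord_def cdom_def the_inv_into_f_f)
  let ?S = "fst d \<inter> snd d -` cdom c"
  have tr: "smooth_transition c d'" "smooth_transition d' c" if "d' \<in> A" for d'
    using cc that by (auto simp: smooth_chart_def)
  have D1: "(coord c \<circ> snd d has_derivative frechet_derivative (coord c \<circ> snd d) (at y)) (at y)"
    using tr(2)[OF dA(1)] x y by (intro smooth_on_has_derivative[of ?S]) (auto simp: smooth_transition_def)
  define v where "v = frechet_derivative (coord c \<circ> snd d) (at y) (e d)"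
  have key: "frechet_derivative (coord d' \<circ> snd c) (at 0) v = e d'" if d': "d' \<in> charts_at A x" for d'
  proof -
    have d'A: "d' \<in> A" "x \<in> cdom d'" using d' by (auto simp: charts_at_def)
    have D2: "(coord d' \<circ> snd c has_derivative frechet_derivative (coord d' \<circ> snd c) (at 0)) (at 0)"
      using tr(1)[OF d'A(1)] d'A cc
      by (intro smooth_on_has_derivative[of "fst c \<inter> snd c -` cdom d'"]) (auto simp: smooth_transition_def)
    have "(coord c \<circ> snd d) y = 0" using y c0 by simp
    with D1 D2 have "((coord d' \<circ> snd c) \<circ> (coord c \<circ> snd d) has_derivative
       frechet_derivative (coord d' \<circ> snd c) (at 0) \<circ> frechet_derivative (coord c \<circ> snd d) (at y)) (at y)"
      by (intro diff_chain_at) auto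
    moreover have "open ?S" "y \<in> ?S"
      using tr(2)[OF dA(1)] x y by (auto simp: smooth_transition_def)
    ultimately have "(coord d' \<circ> snd d has_derivative
       frechet_derivative (coord d' \<circ> snd c) (at 0) \<circ> frechet_derivative (coord c \<circ> snd d) (at y)) (at y)"
      by (rule has_derivative_transform_within_open) (auto simp: coordc)
    then have "frechet_derivative (coord d' \<circ> snd d) (at y) (e d)
        = frechet_derivative (coord d' \<circ> snd c) (at 0) v"
      unfolding v_def by (simp add: frechet_derivative_at[symmetric])
    moreover have "e d' = frechet_derivative (coord d' \<circ> snd d) (at y) (e d)"
      using e(1) d(1) d' unfolding tangent_space_def y_def by blast
    ultimately show ?thesis by simp
  qed
  have "dchart A c 0 v = e"
  proof
    fix d' show "dchart A c 0 v d' = e d'"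
    proof (cases "d' \<in> charts_at A x")
      case True then show ?thesis using key by (simp add: dchart_def cc(3))
    next
      case False
      then have "e d' = 0" using e(1) unfolding tangent_space_def by blast
      with False show ?thesis by (simp add: dchart_def cc(3))
    qed
  qed
  moreover have "v \<noteq> 0"
  proof
    assume "v = 0"
    have "linear (frechet_derivative (coord d \<circ> snd c) (at 0))"
      using tr(1)[OF dA(1)] dA(2) cc
      by (intro has_derivative_linear[OF smooth_on_has_derivative[of "fst c \<inter> snd c -` cdom d"]])
         (auto simp: smooth_transition_def)
    from linear_0[OF this] key[OF d(1)] d(2) \<open>v = 0\<close> show False by simp
  qed
  moreover have "bl_class c (Inr (0, cline v)) \<in> exceptional_divisor A x c" if "v \<noteq> 0"
  proof -
    have "(0, cline v) \<in> incidence (fst c)"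
      using that cc by (auto simp: incidence_def proj_space_def)
    then have "bl_class c (Inr (0, cline v)) \<in> points (blowup A x c)"
      unfolding points_blowup bl_set_def bl_class_def by (intro quotientI InrI)
    then show ?thesis using cc inj by (simp add: exceptional_divisor_def blow_down_class)
  qed
  moreover have "(bl_class c (Inr (0, cline v)), Jline J x (dchart A c 0 v)) \<in> exc_ident A J x c"
    if "v \<noteq> 0"
    using that unfolding exc_ident_def by blast
  ultimately show ?thesis by auto
qed

end

theory Submission
  imports Defs
begin

text \<open>
  In the charts of the two blow-ups, \<open>f\<close> becomes a diffeomorphism \<open>\<psi>\<close> of neighbourhoods of the origin
  of \<open>\<complex>\<^sup>n\<close>. Write the almost complex structures there as \<open>v \<mapsto> a v + b v\<^sup>*\<close> with matrices \<open>a\<close>, \<open>b\<close>,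
  the star being conjugation. For \<open>n \<ge> 2\<close>, smoothness of the lifted structure on the blow-up forces
  \<open>a(0) = \<plusminus>i\<close> and forces all pure antiholomorphic derivatives of \<open>b\<close> to vanish at the origin: in an
  affine chart \<open>z = s w\<close> some multiples of \<open>s\<^sup>*\<close> are divisible by \<open>s\<close>. After a conjugation the two signs
  agree, and the antilinear part of the equation \<open>J2 d\<psi> = d\<psi> J1\<close> then shows, by induction on the order,
  that all pure antiholomorphic derivatives of \<open>\<psi>\<close> vanish at the origin. By the Hadamard
  lemma, \<open>\<psi>(s w)\<close> differs from a smooth multiple of \<open>s\<close> by a smooth multiple of \<open>(s\<^sup>*)\<^sup>m\<close>, for every \<open>m\<close>;
  as \<open>(s\<^sup>*)\<^sup>m / s\<close> is of class \<open>C\<^sup>m\<^sup>-\<^sup>2\<close>, the quotient \<open>\<psi>(s w) / s\<close> is smooth, and so is the lift of \<open>\<psi>\<close>.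
  The lift is pseudoholomorphic off the exceptional divisor because the blow-down maps are
  pseudoholomorphic and immersive there, and on the divisor by continuity. For \<open>n = 1\<close> the blow-down
  maps are diffeomorphisms.
\<close>

subsection \<open>Calculus of smooth maps\<close>

text \<open>Vanishing of the pure antiholomorphic derivatives means that every monomial of the
  Taylor series at the origin contains some \<open>z_j\<close>. Under \<open>z = s w\<close> such a
  monomial is divisible by \<open>s\<close>, while a monomial in the conjugates alone is not. Mixed
  derivatives are not controlled, so ordinary flatness would be the wrong notion. As the structures
  are not assumed integrable, neither holomorphic coordinates nor convergent power series are at
  hand, and formal divisibility has to be turned into smoothness of the actual quotient; hence the
  expansions of every order, each giving one class C^k. The sign of \<open>a(0)\<close> depends on
  the chart, and complex lines do not see it. When the signs differ, \<open>\<psi>(s w)\<close> is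
  divisible by the conjugate of \<open>s\<close> instead of \<open>s\<close>, but it still moves
  along a smooth family of lines. The lift is therefore described by a smooth nonzero vector
  spanning the line and not by the quotient. For n = 1 nothing is forced on \<open>a\<close> and
  \<open>b\<close>, but there is only one line.\<close>

lemma ck_on_continuous: "ck_on k S f \<Longrightarrow> continuous_on S f"
  by (cases k) (auto intro!: continuous_at_imp_continuous_on differentiable_imp_continuous_within)

lemma ck_on_subset: "ck_on k S f \<Longrightarrow> T \<subseteq> S \<Longrightarrow> ck_on k T f"
  by (induction k arbitrary: f) (auto intro: continuous_on_subset)

lemma ck_on_Suc_imp: "ck_on (Suc k) S f \<Longrightarrow> ck_on k S f"
proof (induction k arbitrary: f)
  case 0
  then show ?case using ck_on_continuous by fastforce
next
  case (Suc k)
  from Suc.prems show ?case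
    using Suc.IH by (subst ck_on.simps) (subst (asm) ck_on.simps, blast)
qed

lemma frechet_derivative_eq_on:
  assumes "open S" "x \<in> S" "\<And>y. y \<in> S \<Longrightarrow> f y = g y"
  shows "frechet_derivative f (at x) = frechet_derivative g (at x)"
    and "f differentiable (at x) \<longleftrightarrow> g differentiable (at x)"
proof -
  have *: "(f has_derivative D) (at x) \<longleftrightarrow> (g has_derivative D) (at x)" for D
    using assms by (metis has_derivative_transform_within_open)
  show "frechet_derivative f (at x) = frechet_derivative g (at x)"
    by (simp add: frechet_derivative_def *)
  show "f differentiable (at x) \<longleftrightarrow> g differentiable (at x)"
    by (simp add: differentiable_def *)
qed

lemma ck_on_cong:
  assumes "open S" "\<And>x. x \<in> S \<Longrightarrow> f x = g x"
  shows "ck_on k S f \<longleftrightarrow> ck_on k S g"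
  using assms(2)
proof (induction k arbitrary: f g)
  case (Suc k)
  have "ck_on k S (\<lambda>x. frechet_derivative f (at x) v) \<longleftrightarrow>
        ck_on k S (\<lambda>x. frechet_derivative g (at x) v)" for v
    using frechet_derivative_eq_on[OF assms(1) _ Suc.prems] by (intro Suc.IH) auto
  moreover have "f differentiable (at x) \<longleftrightarrow> g differentiable (at x)" if "x \<in> S" for x
    using frechet_derivative_eq_on(2)[OF assms(1) that Suc.prems] .
  ultimately show ?case by auto
qed (simp cong: continuous_on_cong)

lemma ck_on_local:
  assumes "\<And>x. x \<in> S \<Longrightarrow> \<exists>T. open T \<and> x \<in> T \<and> ck_on k T f"
  shows "ck_on k S f"
  using assms
proof (induction k arbitrary: f)
  case 0
  then show ?case
    by (metis ck_on.simps(1) continuous_at_imp_continuous_on continuous_on_eq_continuous_at)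
next
  case (Suc k)
  have "ck_on k S (\<lambda>x. frechet_derivative f (at x) v)" for v
    using Suc.prems by (intro Suc.IH) fastforce
  then show ?case using Suc.prems by fastforce
qed

text \<open>\<open>frechet_derivative\<close> is a choice operator. Uniqueness of derivatives
  replaces it by a known formula on \<open>S\<close>, and openness of \<open>S\<close> makes this
  replacement legitimate in all further derivatives.\<close>

lemma ck_on_SucI:
  assumes "open S" "\<And>x. x \<in> S \<Longrightarrow> (f has_derivative f' x) (at x)"
    and "\<And>v. ck_on k S (\<lambda>x. f' x v)"
  shows "ck_on (Suc k) S f"
proof -
  have "frechet_derivative f (at x) = f' x" if "x \<in> S" for x
    using frechet_derivative_at[OF assms(2)[OF that]] by simp
  then have "ck_on k S (\<lambda>x. frechet_derivative f (at x) v)" for v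
    using assms(3)[of v] by (subst ck_on_cong[OF assms(1), where g="\<lambda>x. f' x v"]) auto
  then show ?thesis using assms(2) by (auto simp: differentiable_def)
qed

lemma ck_on_SucD:
  assumes "ck_on (Suc k) S f"
  shows "x \<in> S \<Longrightarrow> (f has_derivative frechet_derivative f (at x)) (at x)"
    and "ck_on k S (\<lambda>x. frechet_derivative f (at x) v)"
  using assms by (auto simp: frechet_derivative_works)

lemma ck_on_const [intro, simp]: "ck_on k S (\<lambda>_. a)"
  by (induction k arbitrary: a) auto

lemma ck_on_bounded_linear:
  assumes "bounded_linear L" shows "ck_on k S L"
proof (cases k)
  case 0
  then show ?thesis using assms by (simp add: linear_continuous_on)
next
  case (Suc m)
  have "(L has_derivative L) (at x)" for x using bounded_linear_imp_has_derivative assms by blast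
  then have "frechet_derivative L (at x) = L" "L differentiable (at x)" for x
    using frechet_derivative_at differentiable_def by metis+
  then show ?thesis using Suc by simp
qed

lemma ck_on_bounded_linear_compose:
  assumes "bounded_linear L" "open S" "ck_on k S f" shows "ck_on k S (\<lambda>x. L (f x))"
  using assms(3)
proof (induction k arbitrary: f)
  case 0
  then show ?case using assms(1) bounded_linear.continuous_on by fastforce
next
  case (Suc k)
  show ?case
  proof (rule ck_on_SucI[OF assms(2), where f'="\<lambda>x v. L (frechet_derivative f (at x) v)"])
    show "((\<lambda>x. L (f x)) has_derivative (\<lambda>v. L (frechet_derivative f (at x) v))) (at x)"
      if "x \<in> S" for x
      using ck_on_SucD(1)[OF Suc.prems that] by (rule bounded_linear.has_derivative[OF assms(1)])
    show "ck_on k S (\<lambda>x. L (frechet_derivative f (at x) v))" for v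
      using ck_on_SucD(2)[OF Suc.prems] by (rule Suc.IH)
  qed
qed

lemma ck_on_add:
  assumes "open S" "ck_on k S f" "ck_on k S g" shows "ck_on k S (\<lambda>x. f x + g x)"
  using assms(2,3)
proof (induction k arbitrary: f g)
  case 0
  then show ?case by (simp add: continuous_on_add)
next
  case (Suc k)
  show ?case
    by (rule ck_on_SucI[OF assms(1)], rule has_derivative_add)
       (use ck_on_SucD[OF Suc.prems(1)] ck_on_SucD[OF Suc.prems(2)] Suc.IH in auto)
qed

lemma ck_on_bilinear:
  assumes B: "bounded_bilinear B" and S: "open S" and "ck_on k S f" "ck_on k S g"
  shows "ck_on k S (\<lambda>x. B (f x) (g x))"
  using assms(3,4)
proof (induction k arbitrary: f g)
  case 0
  then show ?case using bounded_bilinear.continuous_on[OF B] by fastforce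
next
  case (Suc k)
  show ?case
  proof (rule ck_on_SucI[OF S])
    show "((\<lambda>x. B (f x) (g x)) has_derivative
        (\<lambda>v. B (f x) (frechet_derivative g (at x) v) + B (frechet_derivative f (at x) v) (g x))) (at x)"
      if "x \<in> S" for x
      using bounded_bilinear.FDERIV[OF B ck_on_SucD(1)[OF Suc.prems(1) that]
          ck_on_SucD(1)[OF Suc.prems(2) that]] .
    show "ck_on k S (\<lambda>x. B (f x) (frechet_derivative g (at x) v) + B (frechet_derivative f (at x) v) (g x))" for v
      by (intro ck_on_add[OF S] Suc.IH ck_on_SucD(2) Suc.prems ck_on_Suc_imp)
  qed
qed

lemma ck_on_sum:
  assumes "open S" "\<And>i. i \<in> I \<Longrightarrow> ck_on k S (f i)"
  shows "ck_on k S (\<lambda>x. \<Sum>i\<in>I. f i x)"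
  using assms(2) by (induction I rule: infinite_finite_induct) (auto intro: ck_on_add[OF assms(1)])

lemma linear_euclidean_sum:
  fixes L :: "'a::euclidean_space \<Rightarrow> 'b::real_vector"
  assumes "linear L" shows "L v = (\<Sum>b\<in>Basis. (v \<bullet> b) *\<^sub>R L b)"
proof -
  have "L v = L (\<Sum>b\<in>Basis. (v \<bullet> b) *\<^sub>R b)" by (simp add: euclidean_representation)
  then show ?thesis by (simp add: linear_sum[OF assms] linear_scale[OF assms])
qed

text \<open>Regularity of \<open>L\<close> is asked for only at each fixed vector. Expanding
  \<open>f x\<close> in the standard basis turns \<open>L x (f x)\<close> into a finite sum of
  products, so spaces of operators do not enter.\<close>

lemma ck_on_linear_apply:
  fixes L :: "'a::euclidean_space \<Rightarrow> 'b::euclidean_space \<Rightarrow> 'c::real_normed_vector"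
  assumes "open S" "\<And>x. x \<in> S \<Longrightarrow> linear (L x)" "\<And>v. ck_on k S (\<lambda>x. L x v)" "ck_on k S f"
  shows "ck_on k S (\<lambda>x. L x (f x))"
proof -
  have "ck_on k S (\<lambda>x. \<Sum>b\<in>Basis. (f x \<bullet> b) *\<^sub>R L x b)"
    by (intro ck_on_sum[OF assms(1)] ck_on_bilinear[OF bounded_bilinear_scaleR assms(1)] assms(3)
        ck_on_bounded_linear_compose[OF bounded_linear_inner_left assms(1)] assms(4))
  then show ?thesis
    using linear_euclidean_sum[OF assms(2)] by (subst ck_on_cong[OF assms(1)]) auto
qed

text \<open>The derivative of the composite is a linear map depending on \<open>f x\<close>, applied
  to a derivative of \<open>f\<close>. The induction hypothesis treats the former, and
  \<open>ck_on_linear_apply\<close> combines the two.\<close>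

lemma ck_on_compose:
  fixes f :: "'a::euclidean_space \<Rightarrow> 'b::euclidean_space"
  assumes "open S" "open T" "ck_on k T g" "ck_on k S f" "f ` S \<subseteq> T"
  shows "ck_on k S (\<lambda>x. g (f x))"
  using assms(3,4)
proof (induction k arbitrary: g)
  case 0
  then show ?case using assms(5) by (auto intro: continuous_on_compose2)
next
  case (Suc k)
  have in_T: "f x \<in> T" if "x \<in> S" for x using that assms(5) by auto
  show ?case
  proof (rule ck_on_SucI[OF assms(1),
        where f'="\<lambda>x v. frechet_derivative g (at (f x)) (frechet_derivative f (at x) v)"])
    show "((\<lambda>x. g (f x)) has_derivative
        (\<lambda>v. frechet_derivative g (at (f x)) (frechet_derivative f (at x) v))) (at x)"
      if "x \<in> S" for x
      using ck_on_SucD(1)[OF Suc.prems(2) that] ck_on_SucD(1)[OF Suc.prems(1) in_T[OF that]]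
      by (rule has_derivative_compose)
    show "ck_on k S (\<lambda>x. frechet_derivative g (at (f x)) (frechet_derivative f (at x) v))" for v
    proof (rule ck_on_linear_apply[OF assms(1)])
      show "linear (frechet_derivative g (at (f x)))" if "x \<in> S" for x
        using Suc.prems(1) in_T[OF that] by (intro linear_frechet_derivative) auto
      show "ck_on k S (\<lambda>x. frechet_derivative g (at (f x)) v)" for v
        using Suc.IH ck_on_SucD(2)[OF Suc.prems(1)] ck_on_Suc_imp[OF Suc.prems(2)] by blast
    qed (rule ck_on_SucD(2)[OF Suc.prems(2)])
  qed
qed

text \<open>The derivative at \<open>x\<close> is a polynomial in \<open>inverse x\<close>, so the
  induction feeds itself.\<close>

lemma ck_on_inverse: "ck_on k (- {0}) (inverse :: complex \<Rightarrow> complex)"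
proof (induction k)
  case 0
  show ?case by (auto intro!: continuous_intros)
next
  case (Suc k)
  have op: "open (- {0::complex})" by auto
  show ?case
  proof (rule ck_on_SucI[OF op])
    show "(inverse has_derivative (\<lambda>v. - (inverse x * v * inverse x))) (at x)"
      if "x \<in> - {0}" for x :: complex
      using has_derivative_inverse'[of x UNIV] that by simp
    show "ck_on k (- {0}) (\<lambda>x::complex. - (inverse x * v * inverse x))" for v
      by (intro ck_on_bounded_linear_compose[OF bounded_linear_minus[OF bounded_linear_ident] op]
            ck_on_bilinear[OF bounded_bilinear_mult op] Suc ck_on_const)
  qed
qed

section \<open>The same rules for smooth maps\<close>

lemma smooth_on_open_cong:
  "open S \<Longrightarrow> (\<And>x. x \<in> S \<Longrightarrow> f x = g x) \<Longrightarrow> smooth_on S f \<longleftrightarrow> smooth_on S g"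
  unfolding smooth_on_def by (metis ck_on_cong)

lemma smooth_on_subset: "smooth_on S f \<Longrightarrow> T \<subseteq> S \<Longrightarrow> smooth_on T f"
  unfolding smooth_on_def by (meson ck_on_subset)

lemma smooth_on_local:
  "(\<And>x. x \<in> S \<Longrightarrow> \<exists>T. open T \<and> x \<in> T \<and> smooth_on T f) \<Longrightarrow> smooth_on S f"
  unfolding smooth_on_def by (intro allI ck_on_local) blast

lemma smooth_on_continuous: "smooth_on S f \<Longrightarrow> continuous_on S f"
  unfolding smooth_on_def by (meson ck_on_continuous)

lemma smooth_on_frechet_derivative:
  "smooth_on S f \<Longrightarrow> smooth_on S (\<lambda>x. frechet_derivative f (at x) v)"
  unfolding smooth_on_def using ck_on_SucD(2) by blast

lemma smooth_on_differentiable: "smooth_on S f \<Longrightarrow> x \<in> S \<Longrightarrow> f differentiable (at x)"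
  using smooth_on_has_derivative[of S f x] differentiableI by auto

lemma smooth_on_const: "smooth_on S (\<lambda>_. a)"
  by (simp add: smooth_on_def)

lemma smooth_on_bounded_linear: "bounded_linear L \<Longrightarrow> smooth_on S L"
  unfolding smooth_on_def by (intro allI ck_on_bounded_linear)

lemma smooth_on_id: "smooth_on S (\<lambda>x. x)"
  by (rule smooth_on_bounded_linear[OF bounded_linear_ident])

lemma smooth_on_bounded_linear_compose:
  "bounded_linear L \<Longrightarrow> open S \<Longrightarrow> smooth_on S f \<Longrightarrow> smooth_on S (\<lambda>x. L (f x))"
  using ck_on_bounded_linear_compose[of L S _ f] by (simp add: smooth_on_def)

lemmas smooth_on_uminus =
  smooth_on_bounded_linear_compose[OF bounded_linear_minus[OF bounded_linear_ident]]
lemmas smooth_on_cnj = smooth_on_bounded_linear_compose[OF bounded_linear_cnj]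
lemmas smooth_on_vec_nth = smooth_on_bounded_linear_compose[OF bounded_linear_vec_nth]

lemma smooth_on_add:
  "open S \<Longrightarrow> smooth_on S f \<Longrightarrow> smooth_on S g \<Longrightarrow> smooth_on S (\<lambda>x. f x + g x)"
  using ck_on_add[of S _ f g] by (simp add: smooth_on_def)

lemma smooth_on_diff:
  "open S \<Longrightarrow> smooth_on S f \<Longrightarrow> smooth_on S g \<Longrightarrow> smooth_on S (\<lambda>x. f x - g x)"
  using smooth_on_add[of S f "\<lambda>x. - g x"] smooth_on_uminus[of S g] by simp

lemma smooth_on_sum:
  "open S \<Longrightarrow> (\<And>i. i \<in> I \<Longrightarrow> smooth_on S (f i)) \<Longrightarrow> smooth_on S (\<lambda>x. \<Sum>i\<in>I. f i x)"
  using ck_on_sum[of S I _ f] by (simp add: smooth_on_def)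

lemma smooth_on_bilinear:
  "bounded_bilinear B \<Longrightarrow> open S \<Longrightarrow> smooth_on S f \<Longrightarrow> smooth_on S g \<Longrightarrow>
    smooth_on S (\<lambda>x. B (f x) (g x))"
  using ck_on_bilinear[of B S _ f g] by (simp add: smooth_on_def)

lemmas smooth_on_mult = smooth_on_bilinear[OF bounded_bilinear_mult]
lemmas smooth_on_scaleR = smooth_on_bilinear[OF bounded_bilinear_scaleR]

lemma smooth_on_linear_apply:
  fixes L :: "'a::euclidean_space \<Rightarrow> 'b::euclidean_space \<Rightarrow> 'c::real_normed_vector"
  assumes "open S" "\<And>x. x \<in> S \<Longrightarrow> linear (L x)" "\<And>v. smooth_on S (\<lambda>x. L x v)" "smooth_on S f"
  shows "smooth_on S (\<lambda>x. L x (f x))"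
  using ck_on_linear_apply[OF assms(1,2), where f=f] assms(3,4) by (simp add: smooth_on_def)

lemma smooth_on_compose:
  fixes f :: "'a::euclidean_space \<Rightarrow> 'b::euclidean_space"
  assumes "open S" "open T" "smooth_on T g" "smooth_on S f" "f ` S \<subseteq> T"
  shows "smooth_on S (\<lambda>x. g (f x))"
  using ck_on_compose[OF assms(1,2) _ _ assms(5), of _ g] assms(3,4) by (simp add: smooth_on_def)

lemma smooth_on_divide:
  fixes f g :: "'a::euclidean_space \<Rightarrow> complex"
  assumes "open S" "smooth_on S f" "smooth_on S g" "\<And>x. x \<in> S \<Longrightarrow> g x \<noteq> 0"
  shows "smooth_on S (\<lambda>x. f x / g x)"
proof -
  have "smooth_on S (\<lambda>x. inverse (g x))"
    using assms(4)
    by (intro smooth_on_compose[OF assms(1) _ _ assms(3), where T="- {0}" and g=inverse])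
       (auto simp: smooth_on_def ck_on_inverse)
  then show ?thesis by (simp only: divide_inverse smooth_on_mult assms(1,2))
qed

lemma bounded_linear_axis:
  "bounded_linear (axis i :: 'b::euclidean_space \<Rightarrow> 'b ^ 'n::finite)"
  by (intro linear_conv_bounded_linear[THEN iffD1] linearI) (auto simp: axis_def vec_eq_iff)

lemma bounded_linear_vector_smult_left:
  "bounded_linear (\<lambda>s :: complex. s *s (w :: complex ^ 'n::finite))"
  by (intro linear_conv_bounded_linear[THEN iffD1] linearI) (simp_all add: vec_eq_iff algebra_simps)

lemma smooth_on_vec_lambda:
  fixes f :: "'n::finite \<Rightarrow> 'a::euclidean_space \<Rightarrow> 'b::euclidean_space"
  assumes "open S" "\<And>i. smooth_on S (f i)"
  shows "smooth_on S (\<lambda>x. \<chi> i. f i x)"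
proof -
  have "(\<chi> i. f i x) = (\<Sum>i\<in>UNIV. axis i (f i x))" for x
    by (simp add: vec_eq_iff axis_def if_distrib sum.delta cong: if_cong)
  then show ?thesis
    using smooth_on_sum[OF assms(1) smooth_on_bounded_linear_compose[OF bounded_linear_axis assms]] by simp
qed

lemma smooth_on_pow:
  fixes f :: "'a::euclidean_space \<Rightarrow> complex"
  shows "open S \<Longrightarrow> smooth_on S f \<Longrightarrow> smooth_on S (\<lambda>x. f x ^ m)"
  by (induction m) (simp_all add: smooth_on_const smooth_on_mult)

lemma smooth_on_vector_smult:
  fixes f :: "'a::euclidean_space \<Rightarrow> complex" and g :: "'a \<Rightarrow> complex ^ 'n::finite"
  assumes "open S" "smooth_on S f" "smooth_on S g"
  shows "smooth_on S (\<lambda>x. f x *s g x)"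
proof -
  have "smooth_on S (\<lambda>x. \<chi> i. f x * g x $ i)" by (intro smooth_on_vec_lambda smooth_on_mult smooth_on_vec_nth assms)
  then show ?thesis by (simp add: vector_scalar_mult_def)
qed

subsection \<open>Parametric integrals and symmetry of second derivatives\<close>

text \<open>Differentiation under the integral sign. The integrand lives on an open set around
  \<open>S \<times> {0..1}\<close>, so that it has full derivatives at the end points of the
  interval as well.\<close>

lemma has_derivative_parametric_integral:
  fixes f :: "'a::euclidean_space \<times> real \<Rightarrow> 'b::euclidean_space"
  assumes \<Omega>: "open \<Omega>" and S: "open S" "S \<times> {0..1} \<subseteq> \<Omega>" and f: "ck_on (Suc 0) \<Omega> f" and x0: "x0 \<in> S"
  shows "((\<lambda>x. integral {0..1} (\<lambda>t. f (x, t))) has_derivative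
    (\<lambda>v. integral {0..1} (\<lambda>t. frechet_derivative f (at (x0, t)) (v, 0)))) (at x0)"
proof -
  obtain e where e: "e > 0" "ball x0 e \<subseteq> S" using S(1) x0 openE by blast
  \<comment> \<open>\<open>leibniz_rule\<close> takes operator-valued derivatives; their continuity
    is checked on basis vectors.\<close>
  define D where "D x t = Blinfun (\<lambda>v. frechet_derivative f (at (x, t)) (v, 0))" for x t
  have fd: "(f has_derivative frechet_derivative f (at (x, t))) (at (x, t))"
    if "x \<in> S" "t \<in> {0..1}" for x t
    using f that S(2) by (intro ck_on_SucD(1)[OF f]) auto
  have bl: "bounded_linear (\<lambda>v. frechet_derivative f (at (x, t)) (v, 0))"
    if "x \<in> S" "t \<in> {0..1}" for x t
    using has_derivative_bounded_linear[OF fd[OF that]]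
    by (rule bounded_linear_compose) (intro bounded_linear_intros)
  have D: "blinfun_apply (D x t) v = frechet_derivative f (at (x, t)) (v, 0)"
    if "x \<in> S" "t \<in> {0..1}" for x t v
    unfolding D_def using bl[OF that] by (simp add: bounded_linear_Blinfun_apply)
  have cf: "continuous_on \<Omega> f" by (rule ck_on_continuous[OF f])
  have cD: "continuous_on (S \<times> {0..1}) (\<lambda>(x, t). D x t)"
  proof (rule continuous_on_blinfun_componentwise)
    fix b :: 'a
    have "continuous_on (S \<times> {0..1}) (\<lambda>p. frechet_derivative f (at p) (b, 0))"
      using ck_on_SucD(2)[OF f, of "(b, 0)"] S(2) continuous_on_subset by auto
    then show "continuous_on (S \<times> {0..1}) (\<lambda>p. blinfun_apply (case p of (x, t) \<Rightarrow> D x t) b)"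
      by (rule continuous_on_eq) (auto simp: D)
  qed
  have "((\<lambda>x. integral (cbox 0 1) (\<lambda>t. f (x, t))) has_derivative integral (cbox 0 1) (D x0))
    (at x0 within ball x0 e)"
  proof (rule leibniz_rule)
    show "((\<lambda>x. f (x, t)) has_derivative blinfun_apply (D x t)) (at x within ball x0 e)"
      if "x \<in> ball x0 e" "t \<in> cbox 0 1" for x t
    proof -
      have xt: "x \<in> S" "t \<in> {0..1}" using that e by auto
      have "((\<lambda>x. (x, t)) has_derivative (\<lambda>v. (v, 0))) (at x within ball x0 e)"
        by (intro derivative_eq_intros) auto
      from has_derivative_compose[OF this fd[OF xt]] show ?thesis
        by (subst ext[OF D[OF xt]])
    qed
    show "(\<lambda>t. f (x, t)) integrable_on cbox 0 1" if "x \<in> ball x0 e" for x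
    proof (rule integrable_continuous)
      show "continuous_on (cbox 0 1) (\<lambda>t. f (x, t))"
        using S(2) that e by (intro continuous_on_compose2[OF cf]) (auto intro!: continuous_intros)
    qed
    show "continuous_on (ball x0 e \<times> cbox 0 1) (\<lambda>(x, t). D x t)"
      using e by (intro continuous_on_subset[OF cD]) auto
  qed (use e in auto)
  then have *: "((\<lambda>x. integral {0..1} (\<lambda>t. f (x, t))) has_derivative integral {0..1} (D x0)) (at x0)"
    using e by (simp add: at_within_open[of x0 "ball x0 e"])
  have int: "D x0 integrable_on {0..1}"
  proof (rule integrable_continuous_real)
    have "continuous_on {0..1} (\<lambda>t. (\<lambda>(x, t). D x t) (x0, t))"
      using x0 by (intro continuous_on_compose2[OF cD]) (auto intro!: continuous_intros)
    then show "continuous_on {0..1} (D x0)" by simp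
  qed
  have "blinfun_apply (integral {0..1} (D x0)) =
      (\<lambda>v. integral {0..1} (\<lambda>t. frechet_derivative f (at (x0, t)) (v, 0)))"
  proof
    fix v
    have "integral {0..1} (\<lambda>t. frechet_derivative f (at (x0, t)) (v, 0)) = integral {0..1} (\<lambda>t. blinfun_apply (D x0 t) v)"
      using D[OF x0] by (intro integral_cong) auto
    also have "\<dots> = blinfun_apply (integral {0..1} (D x0)) v"
      using int by (rule blinfun_apply_integral[symmetric])
    finally show "blinfun_apply (integral {0..1} (D x0)) v = integral {0..1} (\<lambda>t. frechet_derivative f (at (x0, t)) (v, 0))" by simp
  qed
  with * show ?thesis by simp
qed

text \<open>A derivative of the integral is the integral of a derivative of \<open>f\<close> in a
  direction \<open>(v, 0)\<close>, which is of one class less; this closes the induction.\<close>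

lemma ck_on_parametric_integral:
  fixes f :: "'a::euclidean_space \<times> real \<Rightarrow> 'b::euclidean_space"
  assumes \<Omega>: "open \<Omega>" and S: "open S" "S \<times> {0..1} \<subseteq> \<Omega>" and f: "ck_on k \<Omega> f"
  shows "ck_on k S (\<lambda>x. integral {0..1} (\<lambda>t. f (x, t)))"
  using f
proof (induction k arbitrary: f)
  case 0
  have "continuous_on (S \<times> cbox 0 1) (\<lambda>(x, t). f (x, t))"
    using 0 S(2) by (auto intro: continuous_on_subset)
  from integral_continuous_on_param[OF this] show ?case by simp
next
  case (Suc k)
  have "ck_on (Suc 0) \<Omega> f"
    using Suc.prems ck_on_continuous[OF ck_on_SucD(2)[OF Suc.prems]] by simp
  then show ?case
    by (rule ck_on_SucI[OF S(1) has_derivative_parametric_integral[OF \<Omega> S]])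
       (assumption, rule Suc.IH[OF ck_on_SucD(2)[OF Suc.prems]])
qed

lemma integral_along_segment:
  fixes f :: "'a::euclidean_space \<Rightarrow> 'b::euclidean_space"
  assumes f: "\<And>y. y \<in> S \<Longrightarrow> f differentiable (at y)" and seg: "\<And>r. r \<in> {0..1} \<Longrightarrow> x + r *\<^sub>R h \<in> S"
  shows "integral {0..1} (\<lambda>r. frechet_derivative f (at (x + r *\<^sub>R h)) h) = f (x + h) - f x"
proof (rule integral_unique)
  have "((\<lambda>r. frechet_derivative f (at (x + r *\<^sub>R h)) h) has_integral
      f (x + 1 *\<^sub>R h) - f (x + 0 *\<^sub>R h)) {0..1}"
  proof (rule fundamental_theorem_of_calculus)
    fix r :: real assume r: "r \<in> {0..1}"
    note fd = f[OF seg[OF r], unfolded frechet_derivative_works]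
    have "((\<lambda>r. x + r *\<^sub>R h) has_derivative (\<lambda>t. t *\<^sub>R h)) (at r within {0..1})"
      by (auto intro!: derivative_eq_intros)
    from has_derivative_compose[OF this fd]
    show "((\<lambda>r. f (x + r *\<^sub>R h)) has_vector_derivative frechet_derivative f (at (x + r *\<^sub>R h)) h)
        (at r within {0..1})"
      unfolding has_vector_derivative_def
      using linear_scale[OF linear_frechet_derivative[OF f[OF seg[OF r]]]] by simp
  qed auto
  then show "((\<lambda>r. frechet_derivative f (at (x + r *\<^sub>R h)) h) has_integral f (x + h) - f x) {0..1}"
    by simp
qed

lemma has_vector_derivative_along_line:
  fixes f :: "'a::euclidean_space \<Rightarrow> 'b::real_normed_vector"
  assumes "f differentiable (at (x + r *\<^sub>R v))"
  shows "((\<lambda>r. f (x + r *\<^sub>R v)) has_vector_derivative frechet_derivative f (at (x + r *\<^sub>R v)) v) (at r)"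
proof -
  have "((\<lambda>r. x + r *\<^sub>R v) has_derivative (\<lambda>t. t *\<^sub>R v)) (at r)"
    by (auto intro!: derivative_eq_intros)
  from has_derivative_compose[OF this assms[unfolded frechet_derivative_works]]
  show ?thesis
    unfolding has_vector_derivative_def
    using linear_scale[OF linear_frechet_derivative[OF assms]] by simp
qed

text \<open>Differentiating \<open>f (x + y w) - f x = y \<integral> D\<^sub>w f (x + r y w) dr\<close> under the integral sign in the
  direction \<open>v\<close>, dividing by \<open>y\<close> and letting \<open>y\<close> tend to \<open>0\<close> avoids any mean value estimate.\<close>
lemma symmetric_frechet_derivative:
  fixes f :: "'a::euclidean_space \<Rightarrow> 'b::euclidean_space"
  assumes S: "open S" "x0 \<in> S" and f: "smooth_on S f"
  shows "frechet_derivative (\<lambda>x. frechet_derivative f (at x) w) (at x0) v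
    = frechet_derivative (\<lambda>x. frechet_derivative f (at x) v) (at x0) w"
proof -
  define Dw where "Dw x = frechet_derivative f (at x) w" for x
  define Dv where "Dv x = frechet_derivative f (at x) v" for x
  have sm: "smooth_on S Dw" "smooth_on S Dv"
    unfolding Dw_def Dv_def by (rule smooth_on_frechet_derivative[OF f])+
  define DvDw where "DvDw x = frechet_derivative Dw (at x) v" for x
  have sm2: "smooth_on S DvDw" unfolding DvDw_def by (rule smooth_on_frechet_derivative[OF sm(1)])
  define \<Omega> where "\<Omega> = {(p :: ('a \<times> real) \<times> real). fst (fst p) + (snd p * snd (fst p)) *\<^sub>R w \<in> S}"
  have "open ((\<lambda>p :: ('a \<times> real) \<times> real. fst (fst p) + (snd p * snd (fst p)) *\<^sub>R w) -` S)"
    by (intro open_vimage S continuous_intros)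
  then have \<Omega>: "open \<Omega>" by (simp add: \<Omega>_def vimage_def)
  obtain e where e: "e > 0" "ball x0 e \<subseteq> S" using S openE by blast
  \<comment> \<open>With this choice \<open>x + (r * y) *\<^sub>R w\<close> stays in
    \<open>ball x0 e\<close> for \<open>x\<close> in the ball of half the radius,
    \<open>\<bar>y\<bar> < \<delta>\<close> and \<open>r\<close> in the unit interval. The summand 1
    covers \<open>w = 0\<close>.\<close>
  define \<delta> where "\<delta> = e / (2 * (norm w + 1))"
  have \<delta>: "\<delta> > 0" "\<delta> * norm w \<le> e / 2"
  proof -
    show "\<delta> > 0" unfolding \<delta>_def using e by (intro divide_pos_pos) (auto intro: add_nonneg_pos)
    have "norm w + 1 > 0" by (intro add_nonneg_pos) auto
    then have "\<delta> * (norm w + 1) = e / 2" unfolding \<delta>_def by (simp add: field_simps)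
    moreover have "\<delta> * norm w \<le> \<delta> * (norm w + 1)" using \<open>\<delta> > 0\<close> by simp
    ultimately show "\<delta> * norm w \<le> e / 2" by simp
  qed
  have inS: "x + (r * y) *\<^sub>R w \<in> S" if "x \<in> ball x0 (e/2)" "\<bar>y\<bar> < \<delta>" "r \<in> {0..1}" for x y r
  proof -
    have "\<bar>r * y\<bar> \<le> 1 * \<delta>" unfolding abs_mult using that by (intro mult_mono) auto
    then have "norm ((r * y) *\<^sub>R w) \<le> \<delta> * norm w" by (simp add: mult_right_mono)
    then have "norm ((r * y) *\<^sub>R w) \<le> e / 2" using \<delta> by simp
    then have "dist x0 (x + (r * y) *\<^sub>R w) < e"
      using that(1) norm_triangle_ineq4[of "x0 - x" "(r * y) *\<^sub>R w"] by (simp add: dist_norm algebra_simps)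
    then show ?thesis using e by auto
  qed
  have eq: "Dv (x0 + y *\<^sub>R w) - Dv x0 = y *\<^sub>R integral {0..1} (\<lambda>r. DvDw (x0 + (r * y) *\<^sub>R w))"
    if y: "\<bar>y\<bar> < \<delta>" for y
  proof -
    define \<Omega>y where "\<Omega>y = {(p :: 'a \<times> real). fst p + (snd p * y) *\<^sub>R w \<in> S}"
    have "open ((\<lambda>p :: 'a \<times> real. fst p + (snd p * y) *\<^sub>R w) -` S)"
      by (intro open_vimage S continuous_intros)
    then have \<Omega>y: "open \<Omega>y" by (simp add: \<Omega>y_def vimage_def)
    have sub: "ball x0 (e/2) \<times> {0..1} \<subseteq> \<Omega>y" using inS y by (auto simp: \<Omega>y_def)
    have sm3: "smooth_on \<Omega>y (\<lambda>p. Dw (fst p + (snd p * y) *\<^sub>R w))"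
      by (rule smooth_on_compose[OF \<Omega>y S(1) sm(1)])
         (auto simp: \<Omega>y_def intro!: smooth_on_bounded_linear bounded_linear_add bounded_linear_fst
            bounded_linear_compose[OF bounded_linear_scaleR_left]
            bounded_linear_compose[OF bounded_linear_mult_left bounded_linear_snd])
    have x0b: "x0 \<in> ball x0 (e/2)" using e by simp
    have D1: "((\<lambda>x. integral {0..1} (\<lambda>r. Dw (x + (r * y) *\<^sub>R w))) has_derivative
       (\<lambda>u. integral {0..1} (\<lambda>r. frechet_derivative (\<lambda>p. Dw (fst p + (snd p * y) *\<^sub>R w)) (at (x0, r)) (u, 0)))) (at x0)"
      using has_derivative_parametric_integral[OF \<Omega>y open_ball sub sm3[unfolded smooth_on_def, rule_format] x0b]
      by simp
    have inner: "frechet_derivative (\<lambda>p. Dw (fst p + (snd p * y) *\<^sub>R w)) (at (x0, r)) (v, 0) = DvDw (x0 + (r * y) *\<^sub>R w)"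
      if r: "r \<in> {0..1}" for r
    proof -
      have "((\<lambda>p. fst p + (snd p * y) *\<^sub>R w) has_derivative (\<lambda>q. fst q + (snd q * y) *\<^sub>R w)) (at (x0, r))"
        by (auto intro!: derivative_eq_intros)
      moreover have "(Dw has_derivative frechet_derivative Dw (at (x0 + (r * y) *\<^sub>R w))) (at (x0 + (r * y) *\<^sub>R w))"
        using smooth_on_has_derivative[OF sm(1)] inS[OF x0b y r] by auto
      ultimately have "((\<lambda>p. Dw (fst p + (snd p * y) *\<^sub>R w)) has_derivative
         (\<lambda>q. frechet_derivative Dw (at (x0 + (r * y) *\<^sub>R w)) (fst q + (snd q * y) *\<^sub>R w))) (at (x0, r))"
        using has_derivative_compose[of "\<lambda>p. fst p + (snd p * y) *\<^sub>R w" _ "(x0, r)" UNIV Dw] by simp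
      from frechet_derivative_at[OF this, symmetric] show ?thesis by (simp add: DvDw_def)
    qed
    have D1': "frechet_derivative (\<lambda>x. integral {0..1} (\<lambda>r. Dw (x + (r * y) *\<^sub>R w))) (at x0) v
       = integral {0..1} (\<lambda>r. DvDw (x0 + (r * y) *\<^sub>R w))"
      using inner by (subst frechet_derivative_at[OF D1, symmetric]) (intro integral_cong, auto)
    have ftc: "f (x + y *\<^sub>R w) - f x = y *\<^sub>R integral {0..1} (\<lambda>r. Dw (x + (r * y) *\<^sub>R w))"
      if x: "x \<in> ball x0 (e/2)" for x
    proof -
      have "f (x + y *\<^sub>R w) - f x = integral {0..1} (\<lambda>r. frechet_derivative f (at (x + r *\<^sub>R (y *\<^sub>R w))) (y *\<^sub>R w))"
        using inS[OF x y] by (intro integral_along_segment[symmetric, of S] smooth_on_differentiable[OF f]) auto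
      also have "\<dots> = integral {0..1} (\<lambda>r. y *\<^sub>R Dw (x + (r * y) *\<^sub>R w))"
        using linear_scale[OF linear_frechet_derivative[OF smooth_on_differentiable[OF f]]] inS[OF x y]
        by (intro integral_cong) (auto simp: Dw_def)
      finally show ?thesis by simp
    qed
    have "frechet_derivative (\<lambda>x. f (x + y *\<^sub>R w) - f x) (at x0) v
       = frechet_derivative (\<lambda>x. y *\<^sub>R integral {0..1} (\<lambda>r. Dw (x + (r * y) *\<^sub>R w))) (at x0) v"
      using frechet_derivative_eq_on(1)[OF open_ball x0b ftc] by simp
    also have "\<dots> = y *\<^sub>R integral {0..1} (\<lambda>r. DvDw (x0 + (r * y) *\<^sub>R w))"
      using frechet_derivative_at[OF has_derivative_scaleR_right[OF D1, of y], symmetric]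
        frechet_derivative_at[OF D1, symmetric] D1' by simp
    also have "frechet_derivative (\<lambda>x. f (x + y *\<^sub>R w) - f x) (at x0) v = Dv (x0 + y *\<^sub>R w) - Dv x0"
    proof -
      have 1: "((\<lambda>x. x + y *\<^sub>R w) has_derivative (\<lambda>u. u)) (at x0)" by (auto intro!: derivative_eq_intros)
      have 2: "(f has_derivative frechet_derivative f (at (x0 + y *\<^sub>R w))) (at (x0 + y *\<^sub>R w))"
        using inS[OF x0b y, of 1] by (intro smooth_on_has_derivative[OF f]) auto
      have "((\<lambda>x. f (x + y *\<^sub>R w) - f x) has_derivative
         (\<lambda>u. frechet_derivative f (at (x0 + y *\<^sub>R w)) u - frechet_derivative f (at x0) u)) (at x0)"
        using has_derivative_diff[OF has_derivative_compose[OF 1 2] smooth_on_has_derivative[OF f S(2)]] .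
      from frechet_derivative_at[OF this, symmetric] show ?thesis by (simp add: Dv_def)
    qed
    finally show ?thesis .
  qed
  define G where "G y = integral {0..1} (\<lambda>r. DvDw (x0 + (r * y) *\<^sub>R w))" for y
  have "continuous_on (ball 0 \<delta>) G"
  proof -
    define \<Omega> where "\<Omega> = {(p :: real \<times> real). x0 + (snd p * fst p) *\<^sub>R w \<in> S}"
    have "open ((\<lambda>p :: real \<times> real. x0 + (snd p * fst p) *\<^sub>R w) -` S)"
      by (intro open_vimage S continuous_intros)
    then have \<Omega>: "open \<Omega>" by (simp add: \<Omega>_def vimage_def)
    have sub: "ball 0 \<delta> \<times> {0..1} \<subseteq> \<Omega>" using inS e by (auto simp: \<Omega>_def)
    have "continuous_on \<Omega> (\<lambda>p. DvDw (x0 + (snd p * fst p) *\<^sub>R w))"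
      by (rule continuous_on_compose2[OF smooth_on_continuous[OF sm2]])
         (auto simp: \<Omega>_def intro!: continuous_intros)
    then show ?thesis
      using ck_on_parametric_integral[OF \<Omega> open_ball sub, of 0 "\<lambda>p. DvDw (x0 + (snd p * fst p) *\<^sub>R w)"]
      by (simp add: G_def)
  qed
  then have "isCont G 0" using \<delta> by (simp add: continuous_on_eq_continuous_at)
  have "((\<lambda>y. Dv (x0 + y *\<^sub>R w)) has_vector_derivative G 0) (at 0)"
  proof -
    \<comment> \<open>Continuity of \<open>G\<close> at 0 suffices here: the difference of
      \<open>y *\<^sub>R G y\<close> and \<open>y *\<^sub>R G 0\<close> is of smaller order than
      \<open>y\<close>.\<close>
    have "((\<lambda>y. norm (y *\<^sub>R G y - y *\<^sub>R G 0) / norm y) \<longlongrightarrow> 0) (at 0)"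
    proof (rule Lim_transform_eventually)
      show "((\<lambda>y. norm (G y - G 0)) \<longlongrightarrow> 0) (at 0)"
        using \<open>isCont G 0\<close> by (simp add: isCont_def tendsto_norm_zero_iff LIM_zero)
      show "\<forall>\<^sub>F y in at 0. norm (G y - G 0) = norm (y *\<^sub>R G y - y *\<^sub>R G 0) / norm y"
        by (simp add: eventually_at_filter flip: scaleR_diff_right)
    qed
    then have "((\<lambda>y. y *\<^sub>R G y) has_derivative (\<lambda>y. y *\<^sub>R G 0)) (at 0)"
      by (simp add: has_derivative_iff_norm bounded_linear_scaleR_left)
    then have "((\<lambda>y. Dv x0 + y *\<^sub>R G y) has_derivative (\<lambda>y. y *\<^sub>R G 0)) (at 0)"
      using has_derivative_add[OF has_derivative_const] by fastforce
    moreover have "Dv x0 + y *\<^sub>R G y = Dv (x0 + y *\<^sub>R w)" if "y \<in> ball 0 \<delta>" for y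
      using eq[of y] that by (simp add: G_def algebra_simps)
    ultimately show ?thesis
      unfolding has_vector_derivative_def using \<delta>
      by (elim has_derivative_transform_within_open[where s="ball 0 \<delta>"]) auto
  qed
  moreover have "((\<lambda>y. Dv (x0 + y *\<^sub>R w)) has_vector_derivative frechet_derivative Dv (at (x0 + 0 *\<^sub>R w)) w) (at 0)"
    using smooth_on_differentiable[OF sm(2) S(2)] by (intro has_vector_derivative_along_line) simp
  ultimately have "G 0 = frechet_derivative Dv (at x0) w"
    using vector_derivative_unique_at by fastforce
  then show ?thesis by (simp add: G_def DvDw_def[abs_def] Dv_def[abs_def] Dw_def[abs_def])
qed

subsection \<open>Antiholomorphic derivatives\<close>

text \<open>For \<open>b = i a\<close> and \<open>b = - i a\<close> this is the antiholomorphic and the holomorphic derivative in the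
  direction \<open>a\<close>; leaving \<open>a\<close> and \<open>b\<close> free covers functions of one and of several complex variables.\<close>
definition dbar2 :: "'a::euclidean_space \<Rightarrow> 'a \<Rightarrow> ('a \<Rightarrow> complex) \<Rightarrow> 'a \<Rightarrow> complex"
  where "dbar2 a b F x = (frechet_derivative F (at x) a + \<i> * frechet_derivative F (at x) b) / 2"

abbreviation dbar :: "complex ^ 'n::finite \<Rightarrow> (complex ^ 'n \<Rightarrow> complex) \<Rightarrow> complex ^ 'n \<Rightarrow> complex"
  where "dbar v \<equiv> dbar2 v (\<i> *s v)"

abbreviation ddel :: "complex ^ 'n::finite \<Rightarrow> (complex ^ 'n \<Rightarrow> complex) \<Rightarrow> complex ^ 'n \<Rightarrow> complex"
  where "ddel v \<equiv> dbar2 v (- (\<i> *s v))"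

abbreviation unit :: "'n::finite \<Rightarrow> complex ^ 'n" where "unit j \<equiv> axis j 1"

lemma smooth_on_dbar2: "open S \<Longrightarrow> smooth_on S F \<Longrightarrow> smooth_on S (dbar2 a b F)"
  unfolding dbar2_def[abs_def]
  by (intro smooth_on_divide smooth_on_add smooth_on_mult smooth_on_const smooth_on_frechet_derivative) auto

lemma dbar2_cong:
  assumes "open S" "x \<in> S" "\<And>y. y \<in> S \<Longrightarrow> F y = G y"
  shows "dbar2 a b F x = dbar2 a b G x"
  using frechet_derivative_eq_on(1)[OF assms] by (simp add: dbar2_def)

lemma dbar2_eqI: "(F has_derivative D) (at x) \<Longrightarrow> dbar2 a b F x = (D a + \<i> * D b) / 2"
  by (simp add: dbar2_def frechet_derivative_at[symmetric])

lemma dbar2_const [simp]: "dbar2 a b (\<lambda>_. c) x = 0"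
  by (subst dbar2_eqI[OF has_derivative_const]) simp

lemma dbar2_add:
  assumes "smooth_on S F" "smooth_on S G" "x \<in> S"
  shows "dbar2 a b (\<lambda>x. F x + G x) x = dbar2 a b F x + dbar2 a b G x"
  by (subst dbar2_eqI[OF has_derivative_add[OF smooth_on_has_derivative smooth_on_has_derivative]], rule assms, rule assms, rule assms, rule assms)
     (simp add: dbar2_def field_simps)

lemma dbar2_mult:
  assumes "smooth_on S F" "smooth_on S G" "x \<in> S"
  shows "dbar2 a b (\<lambda>x. F x * G x) x = dbar2 a b F x * G x + F x * dbar2 a b G x"
  by (subst dbar2_eqI[OF has_derivative_mult[OF smooth_on_has_derivative smooth_on_has_derivative]], rule assms, rule assms, rule assms, rule assms)
     (simp add: dbar2_def field_simps)

lemma dbar2_sum: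
  assumes "open S" "\<And>i. i \<in> I \<Longrightarrow> smooth_on S (F i)" "x \<in> S"
  shows "dbar2 a b (\<lambda>x. \<Sum>i\<in>I. F i x) x = (\<Sum>i\<in>I. dbar2 a b (F i) x)"
  using assms(2)
proof (induction I rule: infinite_finite_induct)
  case (insert i I)
  then show ?case
    using dbar2_add[of S "F i" "\<lambda>x. \<Sum>i\<in>I. F i x" x a b] assms(1,3) by (auto intro: smooth_on_sum)
qed auto

lemma vec_smult_decompose:
  fixes w :: "complex ^ 'n::finite"
  shows "w = (\<Sum>j\<in>UNIV. Re (w $ j) *\<^sub>R unit j + Im (w $ j) *\<^sub>R (\<i> *s unit j))"
  by (simp add: vec_eq_iff axis_def if_distrib sum.delta complex_eq_iff cong: if_cong)

text \<open>With \<open>a\<close> and \<open>b\<close> the values of a real linear map at 1 and at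
  \<open>\<i>\<close>, this is its splitting into a complex linear and an antilinear part.\<close>

lemma scaleR_Re_Im_decompose:
  "Re w *\<^sub>R a + Im w *\<^sub>R b = w * ((a + \<i> * (- b)) / 2) + cnj w * ((a + \<i> * b) / 2)"
proof -
  have "w = of_real (Re w) + \<i> * of_real (Im w)" "cnj w = of_real (Re w) - \<i> * of_real (Im w)"
    by (simp_all add: complex_eq_iff)
  then have "w * ((a + \<i> * (- b)) / 2) + cnj w * ((a + \<i> * b) / 2)
    = (of_real (Re w) + \<i> * of_real (Im w)) * ((a + \<i> * (- b)) / 2)
      + (of_real (Re w) - \<i> * of_real (Im w)) * ((a + \<i> * b) / 2)" by simp
  also have "\<dots> = of_real (Re w) * a + of_real (Im w) * b"
    by (simp add: field_simps)
  finally show ?thesis by (simp add: scaleR_conv_of_real)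
qed

lemma linear_complex_decompose:
  fixes L :: "complex ^ 'n::finite \<Rightarrow> complex"
  assumes "linear L"
  shows "L w = (\<Sum>j\<in>UNIV. w $ j * ((L (unit j) + \<i> * L (- (\<i> *s unit j))) / 2)
    + cnj (w $ j) * ((L (unit j) + \<i> * L (\<i> *s unit j)) / 2))"
proof -
  have "L w = (\<Sum>j\<in>UNIV. Re (w $ j) *\<^sub>R L (unit j) + Im (w $ j) *\<^sub>R L (\<i> *s unit j))"
    by (subst vec_smult_decompose[of w])
       (simp add: linear_sum[OF assms] linear_add[OF assms] linear_scale[OF assms])
  also have "\<dots> = (\<Sum>j\<in>UNIV. w $ j * ((L (unit j) + \<i> * L (- (\<i> *s unit j))) / 2)
    + cnj (w $ j) * ((L (unit j) + \<i> * L (\<i> *s unit j)) / 2))"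
    by (simp only: scaleR_Re_Im_decompose linear_neg[OF assms])
  finally show ?thesis .
qed

lemma dbar_decompose:
  fixes F :: "complex ^ 'n::finite \<Rightarrow> complex"
  assumes "smooth_on S F" "z \<in> S"
  shows "frechet_derivative F (at z) w =
    (\<Sum>j\<in>UNIV. w $ j * ddel (unit j) F z + cnj (w $ j) * dbar (unit j) F z)"
  unfolding dbar2_def
  by (rule linear_complex_decompose[OF linear_frechet_derivative[OF smooth_on_differentiable[OF assms]]])

text \<open>The holomorphic coefficients cancel between \<open>w\<close> and
  \<open>\<i> *s w\<close>. What remains is antilinear in the direction, so the derivatives along
  the unit vectors determine all others.\<close>

lemma dbar_expand:
  fixes F :: "complex ^ 'n::finite \<Rightarrow> complex"
  assumes "smooth_on S F" "z \<in> S"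
  shows "dbar w F z = (\<Sum>j\<in>UNIV. cnj (w $ j) * dbar (unit j) F z)"
proof -
  have "dbar w F z = (frechet_derivative F (at z) w + \<i> * frechet_derivative F (at z) (\<i> *s w)) / 2"
    by (simp add: dbar2_def)
  also have "\<dots> = (\<Sum>j\<in>UNIV. cnj (w $ j) * dbar (unit j) F z)"
    unfolding dbar_decompose[OF assms] sum_distrib_left sum.distrib[symmetric] sum_divide_distrib
    by (intro sum.cong refl) (simp add: field_simps)
  finally show ?thesis .
qed

lemma dbar_smult:
  fixes F :: "complex ^ 'n::finite \<Rightarrow> complex"
  assumes "smooth_on S F" "z \<in> S"
  shows "dbar (c *s w) F z = cnj c * dbar w F z"
  unfolding dbar_expand[OF assms, of "c *s w"] dbar_expand[OF assms, of w]
  by (simp add: sum_distrib_left mult.assoc)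

lemma dbar_add_dir:
  fixes F :: "complex ^ 'n::finite \<Rightarrow> complex"
  assumes "smooth_on S F" "z \<in> S"
  shows "dbar (v + w) F z = dbar v F z + dbar w F z"
  unfolding dbar_expand[OF assms, of "v + w"] dbar_expand[OF assms, of w] dbar_expand[OF assms, of v]
  by (simp add: sum.distrib[symmetric] algebra_simps)

text \<open>The chain rule in Wirtinger form. Derivatives of \<open>F\<close> of both types occur,
  because \<open>h\<close> need not be holomorphic.\<close>

lemma dbar2_compose:
  fixes F :: "complex ^ 'n::finite \<Rightarrow> complex" and h :: "'a::euclidean_space \<Rightarrow> complex ^ 'n"
  assumes F: "smooth_on T F" and h: "smooth_on S h" and x: "x \<in> S" "h x \<in> T"
  shows "dbar2 a b (\<lambda>x. F (h x)) x = (\<Sum>j\<in>UNIV. ddel (unit j) F (h x) * dbar2 a b (\<lambda>x. h x $ j) x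
     + dbar (unit j) F (h x) * dbar2 a b (\<lambda>x. cnj (h x $ j)) x)"
proof -
  note hd = smooth_on_has_derivative[OF h x(1)]
  have hj: "dbar2 a b (\<lambda>x. h x $ j) x = (frechet_derivative h (at x) a $ j + \<i> * frechet_derivative h (at x) b $ j) / 2" for j
    by (rule dbar2_eqI) (rule bounded_linear.has_derivative[OF bounded_linear_vec_nth hd])
  have cj: "dbar2 a b (\<lambda>x. cnj (h x $ j)) x
      = (cnj (frechet_derivative h (at x) a $ j) + \<i> * cnj (frechet_derivative h (at x) b $ j)) / 2" for j
    by (rule dbar2_eqI) (intro bounded_linear.has_derivative[OF bounded_linear_cnj] bounded_linear.has_derivative[OF bounded_linear_vec_nth hd])
  have "dbar2 a b (\<lambda>x. F (h x)) x = (frechet_derivative F (at (h x)) (frechet_derivative h (at x) a)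
      + \<i> * frechet_derivative F (at (h x)) (frechet_derivative h (at x) b)) / 2"
    by (rule dbar2_eqI) (rule has_derivative_compose[OF hd smooth_on_has_derivative[OF F x(2)]])
  also have "\<dots> = (\<Sum>j\<in>UNIV. ddel (unit j) F (h x) * dbar2 a b (\<lambda>x. h x $ j) x
     + dbar (unit j) F (h x) * dbar2 a b (\<lambda>x. cnj (h x $ j)) x)"
    unfolding dbar_decompose[OF F x(2)] sum_distrib_left sum.distrib[symmetric] sum_divide_distrib hj cj
    by (intro sum.cong refl) (simp add: field_simps)
  finally show ?thesis .
qed

lemma dbar_commute:
  fixes F :: "complex ^ 'n::finite \<Rightarrow> complex"
  assumes "open S" "z \<in> S" "smooth_on S F"
  shows "dbar v (dbar w F) z = dbar w (dbar v F) z"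
proof -
  have fd: "frechet_derivative (dbar2 c d F) (at z) v =
      (frechet_derivative (\<lambda>x. frechet_derivative F (at x) c) (at z) v
       + \<i> * frechet_derivative (\<lambda>x. frechet_derivative F (at x) d) (at z) v) / 2" for c d v
    unfolding dbar2_def[abs_def]
    by (rule frechet_derivative_at[symmetric, THEN fun_cong])
       (intro bounded_linear.has_derivative[OF bounded_linear_divide] has_derivative_add
         bounded_linear.has_derivative[OF bounded_linear_mult_right]
         smooth_on_has_derivative[OF smooth_on_frechet_derivative[OF assms(3)] assms(2)])
  show ?thesis
    unfolding dbar2_def[of _ _ "dbar2 _ _ F"] fd symmetric_frechet_derivative[OF assms, of w v]
      symmetric_frechet_derivative[OF assms, of "\<i> *s w" v] symmetric_frechet_derivative[OF assms, of w "\<i> *s v"]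
      symmetric_frechet_derivative[OF assms, of "\<i> *s w" "\<i> *s v"]
    by (simp add: field_simps)
qed

text \<open>All pure antiholomorphic derivatives of order less than \<open>m\<close> vanish at the origin. Stepping with all
  directions \<open>v\<close> makes the stability under products and compositions a straightforward induction.\<close>
primrec flat_bar :: "nat \<Rightarrow> (complex ^ 'n::finite \<Rightarrow> complex) \<Rightarrow> bool"
  where
    "flat_bar 0 F \<longleftrightarrow> True"
  | "flat_bar (Suc m) F \<longleftrightarrow> F 0 = 0 \<and> (\<forall>v. flat_bar m (dbar v F))"

lemma flat_bar_cong:
  assumes "open S" "0 \<in> S" "\<And>z. z \<in> S \<Longrightarrow> F z = G z"
  shows "flat_bar m F \<longleftrightarrow> flat_bar m G"
  using assms(3)
proof (induction m arbitrary: F G)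
  case (Suc m)
  have "flat_bar m (dbar v F) \<longleftrightarrow> flat_bar m (dbar v G)" for v
    by (rule Suc.IH) (rule dbar2_cong[OF assms(1) _ Suc.prems])
  with Suc.prems[OF assms(2)] show ?case by simp
qed simp

lemma flat_bar_Suc_imp: "flat_bar (Suc m) F \<Longrightarrow> flat_bar m F"
proof (induction m arbitrary: F)
  case (Suc m)
  from Suc.prems show ?case using Suc.IH by (subst flat_bar.simps) (subst (asm) flat_bar.simps, blast)
qed simp

lemma flat_bar_mono: "flat_bar m F \<Longrightarrow> k \<le> m \<Longrightarrow> flat_bar k F"
proof (induction m)
  case (Suc m)
  then show ?case using flat_bar_Suc_imp le_Suc_eq by metis
qed simp

lemma flat_bar_zero [simp]: "flat_bar m (\<lambda>_ :: complex ^ 'n::finite. 0)"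
proof (induction m)
  case (Suc m)
  have "dbar v (\<lambda>_. 0) = (\<lambda>_. 0)" for v :: "complex ^ 'n" by auto
  with Suc show ?case by simp
qed simp

context
  fixes S :: "(complex ^ 'n::finite) set"
  assumes S: "open S" "0 \<in> S"
begin

lemma flat_bar_add:
  assumes "smooth_on S F" "smooth_on S G" "flat_bar m F" "flat_bar m G"
  shows "flat_bar m (\<lambda>z. F z + G z)"
  using assms
proof (induction m arbitrary: F G)
  case (Suc m)
  have "flat_bar m (\<lambda>z. dbar v F z + dbar v G z)" for v
    using Suc by (intro Suc.IH smooth_on_dbar2 S) auto
  then have "flat_bar m (dbar v (\<lambda>z. F z + G z))" for v
    using dbar2_add[OF Suc.prems(1,2)] by (subst flat_bar_cong[OF S]) auto
  then show ?case using Suc.prems by simp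
qed simp

lemma flat_bar_sum:
  assumes "\<And>i. i \<in> I \<Longrightarrow> smooth_on S (F i)" "\<And>i. i \<in> I \<Longrightarrow> flat_bar m (F i)"
  shows "flat_bar m (\<lambda>z. \<Sum>i\<in>I. F i z)"
  using assms
proof (induction I rule: infinite_finite_induct)
  case (insert i I)
  then have "flat_bar m (\<lambda>z. F i z + (\<Sum>i\<in>I. F i z))"
    by (intro flat_bar_add smooth_on_sum S) auto
  with insert show ?case by simp
qed auto

text \<open>By the product rule the flat functions form an ideal among the smooth ones: each term
  keeps \<open>F\<close> or \<open>dbar v F\<close> as a factor.\<close>

lemma flat_bar_mult:
  assumes "smooth_on S F" "smooth_on S G" "flat_bar m F"
  shows "flat_bar m (\<lambda>z. F z * G z)" "flat_bar m (\<lambda>z. G z * F z)"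
proof -
  show 1: "flat_bar m (\<lambda>z. F z * G z)"
    using assms
  proof (induction m arbitrary: F G)
    case (Suc m)
    have "flat_bar m (\<lambda>z. dbar v F z * G z + F z * dbar v G z)" for v
    proof (rule flat_bar_add)
      show "flat_bar m (\<lambda>z. dbar v F z * G z)"
        using Suc.prems by (intro Suc.IH[of "dbar v F"] smooth_on_dbar2 S) auto
      show "flat_bar m (\<lambda>z. F z * dbar v G z)"
        using Suc.prems flat_bar_Suc_imp[OF Suc.prems(3)] by (intro Suc.IH[of F] smooth_on_dbar2 S) auto
    qed (intro smooth_on_mult smooth_on_dbar2 S Suc.prems)+
    then have "flat_bar m (dbar v (\<lambda>z. F z * G z))" for v
      using dbar2_mult[OF Suc.prems(1,2)] by (subst flat_bar_cong[OF S]) auto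
    then show ?case using Suc.prems by simp
  qed simp
  then show "flat_bar m (\<lambda>z. G z * F z)" by (simp add: mult.commute)
qed

text \<open>A factor that merely vanishes at the origin raises the order by one. This gain drives
  the iteration in \<open>flat_bar_pseudoholomorphic\<close>.\<close>

lemma flat_bar_mult_vanishing:
  assumes "smooth_on S F" "smooth_on S G" "F 0 = 0" "flat_bar m G"
  shows "flat_bar (Suc m) (\<lambda>z. F z * G z)"
  using assms
proof (induction m arbitrary: F G)
  case (Suc m)
  have "flat_bar (Suc m) (\<lambda>z. dbar v F z * G z + F z * dbar v G z)" for v
  proof (rule flat_bar_add)
    show "flat_bar (Suc m) (\<lambda>z. dbar v F z * G z)"
      by (rule flat_bar_mult(2)[of G "dbar v F"]) (intro smooth_on_dbar2 S Suc.prems)+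
    show "flat_bar (Suc m) (\<lambda>z. F z * dbar v G z)"
      using Suc.prems by (intro Suc.IH[of F "dbar v G"] smooth_on_dbar2 S) auto
  qed (intro smooth_on_mult smooth_on_dbar2 S Suc.prems)+
  then have "flat_bar (Suc m) (dbar v (\<lambda>z. F z * G z))" for v
    using dbar2_mult[OF Suc.prems(1,2)] by (subst flat_bar_cong[OF S]) auto
  then show ?case using Suc.prems by (subst flat_bar.simps) simp
qed simp

text \<open>One kind of term in the chain rule contains an antiholomorphic derivative of a component
  of \<open>h\<close>, the other an antiholomorphic derivative of \<open>F\<close> at
  \<open>h z\<close>. The former is flat by hypothesis, the latter by induction.\<close>

lemma flat_bar_compose:
  fixes h :: "complex ^ 'n \<Rightarrow> complex ^ 'm::finite"
  assumes T: "open T" "h ` S \<subseteq> T" and "smooth_on T F" and h: "smooth_on S h" "h 0 = 0"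
    and "flat_bar m F" "\<And>j. flat_bar m (\<lambda>z. h z $ j)"
  shows "flat_bar m (\<lambda>z. F (h z))"
  using assms(3,6,7)
proof (induction m arbitrary: F)
  case (Suc m)
  have inT: "h z \<in> T" if "z \<in> S" for z using that T by auto
  have comp: "smooth_on S (\<lambda>z. G (h z))" if "smooth_on T G" for G :: "complex ^ 'm \<Rightarrow> complex"
    using smooth_on_compose[OF S(1) T(1) that h(1) T(2)] .
  have "flat_bar m (\<lambda>z. \<Sum>j\<in>UNIV. ddel (unit j) F (h z) * dbar v (\<lambda>z. h z $ j) z
      + dbar (unit j) F (h z) * dbar v (\<lambda>z. cnj (h z $ j)) z)" for v
  proof (rule flat_bar_sum)
    fix j :: 'm
    have sm: "smooth_on S (\<lambda>z. dbar2 a b F (h z))" for a b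
      using comp smooth_on_dbar2[OF T(1) Suc.prems(1)] by blast
    have hj: "smooth_on S (\<lambda>z. h z $ j)" by (rule smooth_on_vec_nth[OF S(1) h(1)])
    have sm2: "smooth_on S (dbar v (\<lambda>z. h z $ j))" by (rule smooth_on_dbar2[OF S(1) hj])
    have sm3: "smooth_on S (dbar v (\<lambda>z. cnj (h z $ j)))"
      by (rule smooth_on_dbar2[OF S(1) smooth_on_cnj[OF S(1) hj]])
    have "flat_bar m (\<lambda>z. dbar (unit j) F (h z))"
    proof (rule Suc.IH)
      show "smooth_on T (dbar (unit j) F)" by (rule smooth_on_dbar2[OF T(1) Suc.prems(1)])
      show "flat_bar m (dbar (unit j) F)" using Suc.prems(2) by simp
      show "flat_bar m (\<lambda>z. h z $ i)" for i by (rule flat_bar_Suc_imp[OF Suc.prems(3)])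
    qed
    moreover have "flat_bar m (dbar v (\<lambda>z. h z $ j))" using Suc.prems(3)[of j] by simp
    ultimately show "flat_bar m (\<lambda>z. ddel (unit j) F (h z) * dbar v (\<lambda>z. h z $ j) z
      + dbar (unit j) F (h z) * dbar v (\<lambda>z. cnj (h z $ j)) z)"
      by (intro flat_bar_add flat_bar_mult(1)[OF sm] flat_bar_mult(2)[OF sm2] smooth_on_mult S sm sm2 sm3)
    show "smooth_on S (\<lambda>z. ddel (unit j) F (h z) * dbar v (\<lambda>z. h z $ j) z
      + dbar (unit j) F (h z) * dbar v (\<lambda>z. cnj (h z $ j)) z)"
      by (intro smooth_on_add smooth_on_mult S sm sm2 sm3)
  qed
  then have "flat_bar m (dbar v (\<lambda>z. F (h z)))" for v
    using dbar2_compose[OF Suc.prems(1) h(1) _ inT] by (subst flat_bar_cong[OF S]) auto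
  then show ?case using Suc.prems h(2) by simp
qed simp

end

section \<open>Conjugation of the coordinates\<close>

definition vcnj :: "complex ^ 'n::finite \<Rightarrow> complex ^ 'n"
  where "vcnj z = (\<chi> i. cnj (z $ i))"

lemma vcnj_nth [simp]: "vcnj z $ i = cnj (z $ i)"
  by (simp add: vcnj_def)

lemma vcnj_simps [simp]: "vcnj (vcnj z) = z" "vcnj (c *s z) = cnj c *s vcnj z" "vcnj 0 = 0"
  "vcnj (- z) = - vcnj z" "vcnj (z + w) = vcnj z + vcnj w"
  by (simp_all add: vec_eq_iff)

lemma vcnj_eq_0_iff [simp]: "vcnj z = 0 \<longleftrightarrow> z = 0"
  by (simp add: vec_eq_iff)

lemma bounded_linear_vcnj: "bounded_linear vcnj"
  by (intro linear_conv_bounded_linear[THEN iffD1] linearI) (simp_all add: vec_eq_iff)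

text \<open>Conjugation of the source and conjugation of the target each exchange the two types of
  derivatives, so together they preserve the type.\<close>

lemma dbar_vcnj:
  assumes "smooth_on T F" "vcnj z \<in> T"
  shows "dbar v (\<lambda>z. cnj (F (vcnj z))) z = cnj (dbar (vcnj v) F (vcnj z))"
proof -
  note F = smooth_on_has_derivative[OF assms]
  have "((\<lambda>z. cnj (F (vcnj z))) has_derivative
      (\<lambda>v. cnj (frechet_derivative F (at (vcnj z)) (vcnj v)))) (at z)"
    by (intro bounded_linear.has_derivative[OF bounded_linear_cnj]
        has_derivative_compose[OF bounded_linear_imp_has_derivative[OF bounded_linear_vcnj] F])
  from dbar2_eqI[OF this] show ?thesis
    by (simp add: dbar2_def linear_neg[OF has_derivative_linear[OF F]])
qed

lemma flat_bar_vcnj: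
  assumes "open T" "0 \<in> T" "smooth_on T F" "flat_bar m F"
  shows "flat_bar m (\<lambda>z. cnj (F (vcnj z)))"
  using assms(3,4)
proof (induction m arbitrary: F)
  case (Suc m)
  have "open (vcnj -` T)"
    by (rule open_vimage[OF assms(1) linear_continuous_on[OF bounded_linear_vcnj]])
  moreover have "0 \<in> vcnj -` T" using assms(2) by simp
  ultimately have "flat_bar m (dbar v (\<lambda>z. cnj (F (vcnj z)))) \<longleftrightarrow> flat_bar m (\<lambda>z. cnj (dbar (vcnj v) F (vcnj z)))" for v
    by (rule flat_bar_cong) (rule dbar_vcnj[OF Suc.prems(1)], simp)
  moreover have "flat_bar m (\<lambda>z. cnj (dbar (vcnj v) F (vcnj z)))" for v
    using Suc.prems by (intro Suc.IH smooth_on_dbar2[OF assms(1)]) auto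
  ultimately show ?case using Suc.prems(2) by simp
qed simp

subsection \<open>Polarization\<close>

lemma funpow_dbar2_smooth:
  "open S \<Longrightarrow> smooth_on S F \<Longrightarrow> smooth_on S ((dbar2 a b ^^ k) F)"
  by (induction k) (auto intro: smooth_on_dbar2)

lemma funpow_dbar2_cong:
  assumes "open S" "\<And>x. x \<in> S \<Longrightarrow> F x = G x"
  shows "x \<in> S \<Longrightarrow> (dbar2 a b ^^ k) F x = (dbar2 a b ^^ k) G x"
proof (induction k arbitrary: x)
  case (Suc k)
  then show ?case using dbar2_cong[OF assms(1) Suc.prems Suc.IH] by simp
qed (use assms in simp)

lemma funpow_dbar2_sum:
  assumes "open S" "\<And>j. j \<in> I \<Longrightarrow> smooth_on S (F j)" "x \<in> S"
  shows "(dbar2 a b ^^ k) (\<lambda>x. \<Sum>j\<in>I. c j * F j x) x = (\<Sum>j\<in>I. c j * (dbar2 a b ^^ k) (F j) x)"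
  using assms(3)
proof (induction k arbitrary: x)
  case (Suc k)
  have sm: "smooth_on S (\<lambda>x. c j * (dbar2 a b ^^ k) (F j) x)" if "j \<in> I" for j
    using that by (intro smooth_on_mult smooth_on_const funpow_dbar2_smooth assms(1,2))
  have "(dbar2 a b ^^ Suc k) (\<lambda>x. \<Sum>j\<in>I. c j * F j x) x
      = dbar2 a b (\<lambda>x. \<Sum>j\<in>I. c j * (dbar2 a b ^^ k) (F j) x) x"
    using dbar2_cong[OF assms(1) Suc.prems Suc.IH] by simp
  also have "\<dots> = (\<Sum>j\<in>I. dbar2 a b (\<lambda>x. c j * (dbar2 a b ^^ k) (F j) x) x)"
    by (rule dbar2_sum[OF assms(1) sm Suc.prems])
  also have "\<dots> = (\<Sum>j\<in>I. c j * (dbar2 a b ^^ Suc k) (F j) x)"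
    using dbar2_mult[OF smooth_on_const funpow_dbar2_smooth[OF assms(1,2)] Suc.prems] by simp
  finally show ?case .
qed simp

context
  fixes S :: "(complex ^ 'n::finite) set"
  assumes S: "open S" "0 \<in> S"
begin

lemma funpow_dbar_expand:
  assumes "smooth_on S F"
  shows "(dbar w ^^ k) (dbar v F) 0 = (\<Sum>j\<in>UNIV. cnj (v $ j) * (dbar w ^^ k) (dbar (unit j) F) 0)"
proof -
  have "(dbar w ^^ k) (dbar v F) 0 = (dbar w ^^ k) (\<lambda>z. \<Sum>j\<in>UNIV. cnj (v $ j) * dbar (unit j) F z) 0"
    by (rule funpow_dbar2_cong[OF S(1) dbar_expand[OF assms] S(2)])
  also have "\<dots> = (\<Sum>j\<in>UNIV. cnj (v $ j) * (dbar w ^^ k) (dbar (unit j) F) 0)"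
    by (rule funpow_dbar2_sum[OF S(1) smooth_on_dbar2[OF S(1) assms] S(2)])
  finally show ?thesis .
qed

text \<open>As the operators \<open>dbar v\<close> commute, \<open>(dbar w ^^ k) F 0\<close> is a
  homogeneous polynomial of degree \<open>k\<close> in the conjugate of \<open>w\<close>, and its
  derivative is \<open>k\<close> times the polar form with one argument replaced by
  \<open>v\<close>. For \<open>k = 0\<close> the truncated exponent \<open>k - 1\<close> is harmless
  because of the factor 0.\<close>

lemma has_derivative_funpow_dbar:
  assumes "smooth_on S F"
  shows "((\<lambda>w. (dbar w ^^ k) F 0) has_derivative
    (\<lambda>v. of_nat k * (dbar w ^^ (k - 1)) (dbar v F) 0)) (at w)"
  using assms
proof (induction k arbitrary: F)
  case (Suc k)
  have sm: "smooth_on S (dbar v F)" for v by (rule smooth_on_dbar2[OF S(1) Suc.prems])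
  have eq: "(\<lambda>w. (dbar w ^^ Suc k) F 0)
      = (\<lambda>w. \<Sum>j\<in>UNIV. cnj (w $ j) * (dbar w ^^ k) (dbar (unit j) F) 0)"
    by (rule ext) (simp only: funpow_Suc_right o_apply, rule funpow_dbar_expand[OF Suc.prems])
  have "((\<lambda>w. \<Sum>j\<in>UNIV. cnj (w $ j) * (dbar w ^^ k) (dbar (unit j) F) 0) has_derivative
    (\<lambda>v. \<Sum>j\<in>UNIV. cnj (w $ j) * (of_nat k * (dbar w ^^ (k - 1)) (dbar v (dbar (unit j) F)) 0)
        + cnj (v $ j) * (dbar w ^^ k) (dbar (unit j) F) 0)) (at w)"
    by (intro has_derivative_sum has_derivative_mult Suc.IH sm
        bounded_linear_imp_has_derivative bounded_linear_compose[OF bounded_linear_cnj bounded_linear_vec_nth])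
  moreover have "(\<Sum>j\<in>UNIV. cnj (w $ j) * (of_nat k * (dbar w ^^ (k - 1)) (dbar v (dbar (unit j) F)) 0)
        + cnj (v $ j) * (dbar w ^^ k) (dbar (unit j) F) 0) = of_nat (Suc k) * (dbar w ^^ k) (dbar v F) 0" for v
  proof -
    have "(\<Sum>j\<in>UNIV. cnj (w $ j) * (of_nat k * (dbar w ^^ (k - 1)) (dbar v (dbar (unit j) F)) 0))
      = of_nat k * (dbar w ^^ k) (dbar v F) 0"
    proof (cases k)
      case (Suc l)
      have "(dbar w ^^ l) (dbar v (dbar (unit j) F)) 0 = (dbar w ^^ l) (dbar (unit j) (dbar v F)) 0" for j
        by (rule funpow_dbar2_cong[OF S(1) dbar_commute[OF S(1) _ Suc.prems] S(2)])
      then have "(\<Sum>j\<in>UNIV. cnj (w $ j) * (of_nat k * (dbar w ^^ l) (dbar v (dbar (unit j) F)) 0))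
        = of_nat k * (\<Sum>j\<in>UNIV. cnj (w $ j) * (dbar w ^^ l) (dbar (unit j) (dbar v F)) 0)"
        by (simp add: sum_distrib_left mult_ac)
      then show ?thesis
        using funpow_dbar_expand[OF sm, where w=w and k=l and v=w] Suc by (simp add: funpow_Suc_right o_def del: funpow.simps)
    qed simp
    then show ?thesis
      using funpow_dbar_expand[OF Suc.prems, where w=w and k=k and v=v] by (simp add: sum.distrib algebra_simps)
  qed
  ultimately show ?case unfolding eq by simp
qed simp

lemma has_vector_derivative_funpow_dbar:
  assumes "smooth_on S F"
  shows "((\<lambda>r. (dbar (w + r *\<^sub>R v) ^^ k) F 0) has_vector_derivative
    of_nat k * (dbar w ^^ (k - 1)) (dbar v F) 0) (at 0)"
proof -
  note D = has_derivative_funpow_dbar[OF assms, of k w]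
  have "((\<lambda>r. (dbar (w + r *\<^sub>R v) ^^ k) F 0) has_vector_derivative
    frechet_derivative (\<lambda>w. (dbar w ^^ k) F 0) (at (w + 0 *\<^sub>R v)) v) (at 0)"
    using D differentiableI by (intro has_vector_derivative_along_line) auto
  then show ?thesis by (simp add: frechet_derivative_at[OF D, symmetric])
qed

text \<open>By \<open>has_derivative_funpow_dbar\<close>, differentiating \<open>(dbar w ^^ Suc k) F 0\<close> in \<open>w\<close> yields
  \<open>(dbar w ^^ k) (dbar v F) 0\<close> up to a constant, for \<open>v\<close> tangent to the hyperplane \<open>w\<^sub>i = 1\<close>.\<close>
lemma flat_bar_polarization:
  assumes "smooth_on S F" "\<And>k w. w $ i = 1 \<Longrightarrow> (dbar w ^^ k) F 0 = 0"
  shows "flat_bar m F"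
  using assms
proof (induction m arbitrary: F)
  case (Suc m)
  have sm: "smooth_on S (dbar v F)" for v by (rule smooth_on_dbar2[OF S(1) Suc.prems(1)])
  have tangent: "(dbar w ^^ k) (dbar v F) 0 = 0" if "v $ i = 0" "w $ i = 1"
    for v w :: "complex ^ 'n" and k
  proof -
    have "(\<lambda>r. (dbar (w + r *\<^sub>R v) ^^ Suc k) F 0) = (\<lambda>r. 0)"
    proof
      fix r show "(dbar (w + r *\<^sub>R v) ^^ Suc k) F 0 = 0" by (rule Suc.prems(2)) (use that in simp)
    qed
    with has_vector_derivative_funpow_dbar[OF Suc.prems(1), where w=w and v=v and k="Suc k"]
    have "((\<lambda>r. 0) has_vector_derivative of_nat (Suc k) * (dbar w ^^ k) (dbar v F) 0) (at (0::real))"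
      by (simp del: funpow.simps of_nat_Suc)
    from vector_derivative_unique_at[OF this has_vector_derivative_const]
    show ?thesis by (simp del: funpow.simps of_nat_Suc)
  qed
  have "flat_bar m (dbar v F)" for v
  proof (rule Suc.IH[OF sm])
    fix k and w :: "complex ^ 'n" assume w: "w $ i = 1"
    \<comment> \<open>Split \<open>v\<close> into a multiple of \<open>w\<close> and a remainder
      whose \<open>i\<close>-th entry vanishes. The sum over the two booleans brings the two terms
      into the form of \<open>funpow_dbar2_sum\<close>.\<close>
    have "(dbar w ^^ k) (dbar v F) 0 = (dbar w ^^ k) (\<lambda>z. \<Sum>b\<in>UNIV. (if b then cnj (v $ i) else 1) *
        dbar (if b then w else v - (v $ i) *s w) F z) 0"
    proof (rule funpow_dbar2_cong[OF S(1) _ S(2)])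
      fix z assume "z \<in> S"
      note Fz = Suc.prems(1) this
      have "dbar v F z = dbar ((v $ i) *s w + (v - (v $ i) *s w)) F z" by simp
      also have "\<dots> = cnj (v $ i) * dbar w F z + dbar (v - (v $ i) *s w) F z"
        by (simp only: dbar_add_dir[OF Fz] dbar_smult[OF Fz])
      finally show "dbar v F z = (\<Sum>b\<in>UNIV. (if b then cnj (v $ i) else 1) *
        dbar (if b then w else v - (v $ i) *s w) F z)" by (simp add: UNIV_bool)
    qed
    also have "\<dots> = (\<Sum>b\<in>UNIV. (if b then cnj (v $ i) else 1) *
        (dbar w ^^ k) (dbar (if b then w else v - (v $ i) *s w) F) 0)"
      by (rule funpow_dbar2_sum[OF S(1) sm S(2)])
    also have "\<dots> = cnj (v $ i) * (dbar w ^^ Suc k) F 0 + (dbar w ^^ k) (dbar (v - (v $ i) *s w) F) 0"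
      by (simp add: UNIV_bool funpow_Suc_right del: funpow.simps)
    also have "\<dots> = 0" using tangent[of "v - (v $ i) *s w" w k] Suc.prems(2)[OF w, of "Suc k"] w
      by (simp del: funpow.simps)
    finally show "(dbar w ^^ k) (dbar v F) 0 = 0" .
  qed
  then show ?case using Suc.prems(2)[of "unit i" 0] by simp
qed simp

text \<open>\<open>(dbar w ^^ k) F 0\<close> is antiholomorphic in \<open>w\<close>, hence cannot be the product of such a function and the
  coordinate \<open>w\<^sub>j\<close>, unless it vanishes.\<close>
lemma flat_bar_of_proportional:
  assumes F: "smooth_on S F" "smooth_on S G" and ij: "j \<noteq> i"
    and eq: "\<And>k w. w $ i = 1 \<Longrightarrow> (dbar w ^^ k) F 0 = w $ j * (dbar w ^^ k) G 0"
  shows "flat_bar m F" "flat_bar m G"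
proof -
  have G0: "(dbar w ^^ k) G 0 = 0" if w: "w $ i = 1" for k w
  proof -
    \<comment> \<open>The derivative, in the direction \<open>v\<close>, of the polynomial in
      \<open>w\<close> that \<open>H\<close> defines at order \<open>k\<close>.\<close>
    define A where "A H v = of_nat k * (dbar w ^^ (k - 1)) (dbar v H) 0" for H v
    have dir: "A F v = w $ j * A G v + v $ j * (dbar w ^^ k) G 0" if "v $ i = 0" for v
    proof -
      have "((\<lambda>r. ((w + r *\<^sub>R v) $ j) * (dbar (w + r *\<^sub>R v) ^^ k) G 0) has_vector_derivative
         ((w + 0 *\<^sub>R v) $ j) * A G v + v $ j * (dbar (w + 0 *\<^sub>R v) ^^ k) G 0) (at 0)"
        unfolding A_def
        by (intro has_vector_derivative_mult has_vector_derivative_funpow_dbar F)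
           (auto simp: has_vector_derivative_def intro!: derivative_eq_intros)
      moreover have "(\<lambda>r. ((w + r *\<^sub>R v) $ j) * (dbar (w + r *\<^sub>R v) ^^ k) G 0)
          = (\<lambda>r. (dbar (w + r *\<^sub>R v) ^^ k) F 0)"
      proof
        fix r :: real
        show "((w + r *\<^sub>R v) $ j) * (dbar (w + r *\<^sub>R v) ^^ k) G 0 = (dbar (w + r *\<^sub>R v) ^^ k) F 0"
          by (rule eq[symmetric]) (use that w in simp)
      qed
      moreover have "((\<lambda>r. (dbar (w + r *\<^sub>R v) ^^ k) F 0) has_vector_derivative A F v) (at 0)"
        unfolding A_def by (rule has_vector_derivative_funpow_dbar[OF F(1)])
      ultimately show ?thesis using vector_derivative_unique_at by fastforce
    qed
    \<comment> \<open>Antilinearity in the direction. The sum over one element brings the scalar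
      multiple into the form of \<open>funpow_dbar2_sum\<close>.\<close>
    have A_i: "A H (\<i> *s unit j) = - \<i> * A H (unit j)" if H: "smooth_on S H" for H
    proof -
      have "(dbar w ^^ (k - 1)) (dbar (\<i> *s unit j) H) 0
        = (dbar w ^^ (k - 1)) (\<lambda>z. \<Sum>b\<in>{()}. (- \<i>) * dbar (unit j) H z) 0"
      proof (rule funpow_dbar2_cong[OF S(1) _ S(2)])
        fix z assume "z \<in> S"
        from dbar_smult[OF H this, of \<i> "unit j"]
        show "dbar (\<i> *s unit j) H z = (\<Sum>b\<in>{()}. (- \<i>) * dbar (unit j) H z)" by simp
      qed
      also have "\<dots> = (\<Sum>b\<in>{()}. (- \<i>) * (dbar w ^^ (k - 1)) (dbar (unit j) H) 0)"
        by (rule funpow_dbar2_sum[OF S(1) smooth_on_dbar2[OF S(1) H] S(2)])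
      finally show ?thesis by (simp add: A_def)
    qed
    have 1: "A F (unit j) = w $ j * A G (unit j) + (dbar w ^^ k) G 0"
      using dir[of "unit j"] ij by (simp add: axis_def)
    have 2: "- \<i> * A F (unit j) = w $ j * (- \<i> * A G (unit j)) + \<i> * (dbar w ^^ k) G 0"
      using dir[of "\<i> *s unit j"] ij unfolding A_i[OF F(1)] A_i[OF F(2)] by (simp add: axis_def)
    \<comment> \<open>From the direction \<open>unit j\<close> to \<open>\<i> *s unit j\<close> the
      derivatives of the polynomials pick up the factor \<open>- \<i>\<close>, but that of the
      coordinate \<open>w $ j\<close> the factor \<open>\<i>\<close>. Multiplying the first relation
      by \<open>- \<i>\<close> and subtracting the second isolates the value of
      \<open>G\<close>.\<close>
    have "2 * \<i> * (dbar w ^^ k) G 0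
      = - \<i> * (A F (unit j) - (w $ j * A G (unit j) + (dbar w ^^ k) G 0))
        - (- \<i> * A F (unit j) - (w $ j * (- \<i> * A G (unit j)) + \<i> * (dbar w ^^ k) G 0))"
      by (simp add: algebra_simps)
    then show ?thesis using 1 2 by simp
  qed
  show "flat_bar m G" by (rule flat_bar_polarization[OF F(2) G0])
  show "flat_bar m F" using eq G0 by (intro flat_bar_polarization[OF F(1), of i]) simp
qed

end

text \<open>Differentiating the equation \<open>k\<close> times with respect to the conjugate of
  \<open>s\<close> turns the left side into \<open>k\<close> times the derivative of
  \<open>g\<close> of order \<open>k - 1\<close> plus a multiple of \<open>cnj s\<close>, and the
  right side into a multiple of \<open>s\<close>. At \<open>s = 0\<close> only the first term
  survives.\<close>

lemma funpow_dbar2_eq_0: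
  fixes g \<gamma> :: "complex \<Rightarrow> complex"
  assumes D: "open D" "0 \<in> D" and g: "smooth_on D g" and \<gamma>: "smooth_on D \<gamma>"
    and eq: "\<And>s. s \<in> D \<Longrightarrow> cnj s * g s = s * \<gamma> s"
  shows "(dbar2 1 \<i> ^^ k) g 0 = 0"
proof -
  let ?d = "dbar2 (1::complex) \<i>"
  have dcnj: "?d cnj s = 1" and did: "?d (\<lambda>s. s) s = 0" for s
    using dbar2_eqI[OF bounded_linear_imp_has_derivative[OF bounded_linear_cnj], of 1 \<i>]
      dbar2_eqI[OF has_derivative_ident, of 1 \<i>] by simp_all
  have smc: "smooth_on D cnj" by (rule smooth_on_bounded_linear[OF bounded_linear_cnj])
  have rec: "of_nat k * (?d ^^ (k - 1)) g s + cnj s * (?d ^^ k) g s = s * (?d ^^ k) \<gamma> s" if "s \<in> D" for k s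
    using that
  proof (induction k arbitrary: s)
    case (Suc k)
    let ?gk = "(?d ^^ k) g" and ?\<gamma>k = "(?d ^^ k) \<gamma>" and ?gl = "(?d ^^ (k - 1)) g"
    have sm: "smooth_on D ?gk" "smooth_on D ?gl" "smooth_on D ?\<gamma>k"
      by (intro funpow_dbar2_smooth D g \<gamma>)+
    have sm2: "smooth_on D (\<lambda>s. of_nat k * ?gl s)" "smooth_on D (\<lambda>s. cnj s * ?gk s)"
      by (intro smooth_on_mult smooth_on_const sm smc D)+
    have "?d (\<lambda>s. of_nat k * ?gl s + cnj s * ?gk s) s = ?d (\<lambda>s. s * ?\<gamma>k s) s"
      by (rule dbar2_cong[OF D(1) Suc.prems Suc.IH])
    also have "?d (\<lambda>s. of_nat k * ?gl s + cnj s * ?gk s) s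
        = of_nat k * ?d ?gl s + (?gk s + cnj s * ?d ?gk s)"
      by (simp add: dbar2_add[OF sm2 Suc.prems] dbar2_mult[OF smooth_on_const sm(2) Suc.prems]
          dbar2_mult[OF smc sm(1) Suc.prems] dcnj del: One_nat_def)
    also have "?d (\<lambda>s. s * ?\<gamma>k s) s = s * ?d ?\<gamma>k s"
      by (simp add: dbar2_mult[OF smooth_on_id sm(3) Suc.prems] did)
    also have "of_nat k * ?d ?gl s = of_nat k * ?gk s" by (cases k) auto
    finally show ?case by (simp add: algebra_simps)
  qed (simp add: eq)
  from rec[OF D(2), of "Suc k"] show ?thesis by (simp del: of_nat_Suc)
qed

lemma funpow_dbar2_line:
  fixes F :: "complex ^ 'n::finite \<Rightarrow> complex"
  assumes S: "open S" and F: "smooth_on S F" and s: "s *s w \<in> S"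
  shows "(dbar2 1 \<i> ^^ k) (\<lambda>s. F (s *s w)) s = (dbar w ^^ k) F (s *s w)"
  using s
proof (induction k arbitrary: s)
  case (Suc k)
  note bl = bounded_linear_vector_smult_left[of w]
  have op: "open ((\<lambda>s. s *s w) -` S)" by (rule open_vimage[OF S linear_continuous_on[OF bl]])
  note sm = funpow_dbar2_smooth[OF S F, where a=w and b="\<i> *s w" and k=k]
  have "(dbar2 1 \<i> ^^ Suc k) (\<lambda>s. F (s *s w)) s = dbar2 1 \<i> (\<lambda>s. (dbar w ^^ k) F (s *s w)) s"
    using dbar2_cong[OF op _ Suc.IH, of s] Suc.prems by simp
  also have "\<dots> = dbar w ((dbar w ^^ k) F) (s *s w)"
    using dbar2_eqI[OF has_derivative_compose[OF bounded_linear_imp_has_derivative[OF bl] smooth_on_has_derivative[OF sm Suc.prems]]]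
    by (simp add: dbar2_def)
  finally show ?case by simp
qed simp

subsection \<open>Division by the equation of the exceptional divisor\<close>

text \<open>The weight \<open>t ^ k\<close> is present because every derivative of
  \<open>H (t *\<^sub>R z)\<close> in \<open>z\<close> produces a factor \<open>t\<close>.\<close>

lemma dbar2_parametric_integral:
  fixes G :: "complex ^ 'n::finite \<Rightarrow> complex"
  assumes G: "smooth_on (ball 0 r) G" and z: "z \<in> ball 0 r"
  defines "I \<equiv> \<lambda>k (H :: complex ^ 'n \<Rightarrow> complex) z. integral {0..1} (\<lambda>t. of_real (t ^ k) * H (t *\<^sub>R z))"
  shows "smooth_on (ball 0 r) (I k G)"
    and "dbar v (I k G) z = I (Suc k) (dbar v G) z"
proof -
  let ?B = "ball (0 :: complex ^ 'n) r"
  define \<Omega> where "\<Omega> = {p :: (complex ^ 'n) \<times> real. snd p *\<^sub>R fst p \<in> ?B}"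
  have "open ((\<lambda>p :: (complex ^ 'n) \<times> real. snd p *\<^sub>R fst p) -` ?B)"
    by (intro open_vimage open_ball continuous_intros)
  then have \<Omega>: "open \<Omega>" by (simp add: \<Omega>_def vimage_def)
  have seg: "t *\<^sub>R y \<in> ?B" if "y \<in> ?B" "t \<in> {0..1}" for y t
  proof -
    have "\<bar>t\<bar> * norm y \<le> 1 * norm y" using that by (intro mult_right_mono) auto
    then show ?thesis using that by simp
  qed
  then have sub: "?B \<times> {0..1} \<subseteq> \<Omega>" by (auto simp: \<Omega>_def)
  define f where "f p = of_real (snd p ^ k) * G (snd p *\<^sub>R fst p)" for p :: "(complex ^ 'n) \<times> real"
  have sm1: "smooth_on \<Omega> (\<lambda>p. G (snd p *\<^sub>R fst p))"
    by (rule smooth_on_compose[OF \<Omega> open_ball G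
          smooth_on_scaleR[OF \<Omega> smooth_on_bounded_linear[OF bounded_linear_snd]
            smooth_on_bounded_linear[OF bounded_linear_fst]]]) (auto simp: \<Omega>_def)
  have "smooth_on \<Omega> (\<lambda>p. complex_of_real (snd p))"
    by (rule smooth_on_bounded_linear[OF bounded_linear_compose[OF bounded_linear_of_real bounded_linear_snd]])
  then have sm2: "smooth_on \<Omega> f"
    unfolding f_def of_real_power by (intro smooth_on_mult smooth_on_pow \<Omega> sm1)
  have If: "I k G = (\<lambda>z. integral {0..1} (\<lambda>t. f (z, t)))"
    by (simp add: I_def f_def)
  show "smooth_on ?B (I k G)"
    unfolding If smooth_on_def
    using ck_on_parametric_integral[OF \<Omega> open_ball sub, where f=f] sm2 by (simp add: smooth_on_def)
  have D: "(I k G has_derivative (\<lambda>v. integral {0..1} (\<lambda>t. frechet_derivative f (at (z, t)) (v, 0)))) (at z)"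
    unfolding If
    using has_derivative_parametric_integral[OF \<Omega> open_ball sub _ z, of f] sm2 unfolding smooth_on_def by blast
  have inner: "frechet_derivative f (at (z, t)) (v, 0) = of_real (t ^ Suc k) * frechet_derivative G (at (t *\<^sub>R z)) v"
    if t: "t \<in> {0..1}" for t v
  proof -
    note Gd = smooth_on_has_derivative[OF G seg[OF z t]]
    have d1: "((\<lambda>z. f (z, t)) has_derivative (\<lambda>v. of_real (t ^ k) * frechet_derivative G (at (t *\<^sub>R z)) (t *\<^sub>R v))) (at z)"
      unfolding f_def fst_conv snd_conv
      by (intro bounded_linear.has_derivative[OF bounded_linear_mult_right]
          has_derivative_compose[OF bounded_linear_imp_has_derivative[OF bounded_linear_scaleR_right] Gd])
    have d2: "((\<lambda>z. f (z, t)) has_derivative (\<lambda>v. frechet_derivative f (at (z, t)) (v, 0))) (at z)"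
    proof -
      have "((\<lambda>x. (x, t)) has_derivative (\<lambda>v. (v, 0))) (at z)"
        by (intro derivative_eq_intros) auto
      moreover have "(z, t) \<in> \<Omega>" using sub z t by blast
      ultimately show ?thesis
        using has_derivative_compose smooth_on_has_derivative[OF sm2] by blast
    qed
    have "frechet_derivative f (at (z, t)) (v, 0) = of_real (t ^ k) * frechet_derivative G (at (t *\<^sub>R z)) (t *\<^sub>R v)"
      by (rule fun_cong[OF has_derivative_unique[OF d2 d1]])
    then show ?thesis
      by (simp add: linear_scale[OF has_derivative_linear[OF Gd]] scaleR_conv_of_real[where 'a=complex] mult_ac)
  qed
  have int: "(\<lambda>t. of_real (t ^ Suc k) * frechet_derivative G (at (t *\<^sub>R z)) v) integrable_on {0..1}" for v
  proof (rule integrable_continuous_real)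
    have "continuous_on {0..1} (\<lambda>t. frechet_derivative G (at (t *\<^sub>R z)) v)"
      by (rule continuous_on_compose2[OF smooth_on_continuous[OF smooth_on_frechet_derivative[OF G]]])
         (use seg[OF z] in \<open>auto intro!: continuous_intros\<close>)
    then show "continuous_on {0..1} (\<lambda>t. of_real (t ^ Suc k) * frechet_derivative G (at (t *\<^sub>R z)) v)"
      by (intro continuous_intros)
  qed
  have D': "frechet_derivative (I k G) (at z) v = integral {0..1} (\<lambda>t. of_real (t ^ Suc k) * frechet_derivative G (at (t *\<^sub>R z)) v)" for v
    unfolding frechet_derivative_at[OF D, symmetric] by (intro integral_cong inner)
  have "I (Suc k) (dbar v G) z = integral {0..1} (\<lambda>t. (of_real (t ^ Suc k) * frechet_derivative G (at (t *\<^sub>R z)) v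
      + \<i> * (of_real (t ^ Suc k) * frechet_derivative G (at (t *\<^sub>R z)) (\<i> *s v))) / 2)"
    unfolding I_def dbar2_def by (intro integral_cong) (simp add: field_simps)
  also have "\<dots> = dbar v (I k G) z"
    unfolding dbar2_def D'
    by (simp only: integral_divide integral_mult_right integral_add[OF int integrable_on_mult_right[OF int]])
  finally show "dbar v (I k G) z = I (Suc k) (dbar v G) z" ..
qed

text \<open>Differentiation raises the exponent of the weight, so the induction runs over all
  exponents at once.\<close>

lemma flat_bar_parametric_integral:
  fixes G :: "complex ^ 'n::finite \<Rightarrow> complex"
  assumes "r > 0" "smooth_on (ball 0 r) G" "flat_bar m G"
  shows "flat_bar m (\<lambda>z. integral {0..1} (\<lambda>t. of_real (t ^ k) * G (t *\<^sub>R z)))"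
  using assms(2,3)
proof (induction m arbitrary: G k)
  case (Suc m)
  have "flat_bar m (\<lambda>z. integral {0..1} (\<lambda>t. of_real (t ^ Suc k) * dbar v G (t *\<^sub>R z)))" for v
    using Suc.prems by (intro Suc.IH smooth_on_dbar2 open_ball) auto
  moreover have "flat_bar m (dbar v (\<lambda>z. integral {0..1} (\<lambda>t. of_real (t ^ k) * G (t *\<^sub>R z)))) \<longleftrightarrow>
      flat_bar m (\<lambda>z. integral {0..1} (\<lambda>t. of_real (t ^ Suc k) * dbar v G (t *\<^sub>R z)))" for v
    using assms(1) by (intro flat_bar_cong[where S="ball 0 r"] dbar2_parametric_integral(2)[OF Suc.prems(1)]) auto
  ultimately have "\<forall>v. flat_bar m (dbar v (\<lambda>z. integral {0..1} (\<lambda>t. of_real (t ^ k) * G (t *\<^sub>R z))))" by blast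
  then show ?case using Suc.prems(2) by simp
qed simp

text \<open>Integrate the derivative of \<open>F\<close> along the segment from 0 to
  \<open>z\<close> and split it by type. The coefficient \<open>b j\<close> is the integral of an
  antiholomorphic derivative of \<open>F\<close> and hence flat to every order again; this permits
  iteration.\<close>

lemma hadamard_flat_bar:
  fixes F :: "complex ^ 'n::finite \<Rightarrow> complex"
  assumes r: "r > 0" and F: "smooth_on (ball 0 r) F" and pz: "\<And>m. flat_bar m F"
  shows "\<exists>a b. (\<forall>j. smooth_on (ball 0 r) (a j)) \<and> (\<forall>j. smooth_on (ball 0 r) (b j)) \<and> (\<forall>j m. flat_bar m (b j)) \<and>
    (\<forall>z\<in>ball 0 r. F z = (\<Sum>j\<in>UNIV. z $ j * a j z + cnj (z $ j) * b j z))"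
proof -
  let ?B = "ball (0 :: complex ^ 'n) r"
  define I where "I H z = integral {0..1} (\<lambda>t. of_real (t ^ 0) * H (t *\<^sub>R z))" for H :: "complex ^ 'n \<Rightarrow> complex" and z
  have smd: "smooth_on ?B (dbar2 u v F)" for u v by (rule smooth_on_dbar2[OF open_ball F])
  have smI: "smooth_on ?B (I (dbar2 u v F))" for u v
    using dbar2_parametric_integral(1)[OF smd, of 0 0] r unfolding I_def by simp
  have "flat_bar m (dbar (unit j) F)" for m j using pz[of "Suc m"] by simp
  then have pzI: "flat_bar m (I (dbar (unit j) F))" for j m
    unfolding I_def by (intro flat_bar_parametric_integral[OF r smd])
  have "F z = (\<Sum>j\<in>UNIV. z $ j * I (ddel (unit j) F) z + cnj (z $ j) * I (dbar (unit j) F) z)"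
    if z: "z \<in> ?B" for z
  proof -
    have seg: "t *\<^sub>R z \<in> ?B" if "t \<in> {0..1}" for t
    proof -
      have "\<bar>t\<bar> * norm z \<le> 1 * norm z" using that by (intro mult_right_mono) auto
      then show ?thesis using z by simp
    qed
    have int: "(\<lambda>t. dbar2 u v F (t *\<^sub>R z)) integrable_on {0..1}" for u v
      by (intro integrable_continuous_real continuous_on_compose2[OF smooth_on_continuous[OF smd]])
         (use seg in \<open>auto intro!: continuous_intros\<close>)
    have "F z = F (0 + z) - F 0" using pz[of 1] by simp
    also have "\<dots> = integral {0..1} (\<lambda>t. frechet_derivative F (at (0 + t *\<^sub>R z)) z)"
      using seg by (intro integral_along_segment[symmetric, of ?B] smooth_on_differentiable[OF F]) auto
    also have "\<dots> = integral {0..1} (\<lambda>t. \<Sum>j\<in>UNIV. z $ j * ddel (unit j) F (t *\<^sub>R z) + cnj (z $ j) * dbar (unit j) F (t *\<^sub>R z))"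
      by (intro integral_cong) (use seg dbar_decompose[OF F] in simp)
    also have "\<dots> = (\<Sum>j\<in>UNIV. z $ j * I (ddel (unit j) F) z + cnj (z $ j) * I (dbar (unit j) F) z)"
      by (simp add: I_def integral_sum integral_add integrable_add integrable_on_mult_right int)
    finally show ?thesis .
  qed
  with smI pzI show ?thesis by (intro exI[of _ "\<lambda>j. I (ddel (unit j) F)"] exI[of _ "\<lambda>j. I (dbar (unit j) F)"]) auto
qed

section \<open>Functions in the affine charts of the blow-up\<close>

lemma smooth_on_aff_dir: "open S \<Longrightarrow> smooth_on S (aff_dir i)"
proof -
  assume S: "open S"
  have "smooth_on S (\<lambda>u. if j = i then 1 else u $ j)" for j
    using S by (cases "j = i") (auto intro: smooth_on_const smooth_on_vec_nth smooth_on_id)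
  then show ?thesis unfolding aff_dir_def[abs_def] by (intro smooth_on_vec_lambda S)
qed

lemma smooth_on_aff_base: "open S \<Longrightarrow> smooth_on S (aff_base i)"
  unfolding aff_base_def[abs_def]
  by (intro smooth_on_vector_smult smooth_on_vec_nth smooth_on_id smooth_on_aff_dir)

lemma open_aff_base_vimage: "open S \<Longrightarrow> open (aff_base i -` S)"
  by (intro open_vimage smooth_on_continuous smooth_on_aff_base open_UNIV)

lemma smooth_on_aff_base_compose:
  fixes F :: "complex ^ 'n::finite \<Rightarrow> 'b::real_normed_vector"
  shows "open S \<Longrightarrow> smooth_on S F \<Longrightarrow> smooth_on (aff_base i -` S) (\<lambda>u. F (aff_base i u))"
  by (rule smooth_on_compose[OF open_aff_base_vimage _ _ smooth_on_aff_base[OF open_aff_base_vimage]]) auto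

lemma aff_dir_nth [simp]: "aff_dir i u $ i = 1"
  by (simp add: aff_dir_def)

lemma aff_dir_nonzero [simp]: "aff_dir i u \<noteq> 0"
  by (metis aff_dir_nth zero_index zero_neq_one)

lemma aff_base_nth: "aff_base i u $ j = u $ i * aff_dir i u $ j"
  by (simp add: aff_base_def)

lemma aff_base_eq_0_iff: "aff_base i u = 0 \<longleftrightarrow> u $ i = 0"
  by (simp add: aff_base_def)

text \<open>Each use of the Hadamard lemma absorbs the terms with a factor
  \<open>z $ j = u $ i * aff_dir i u $ j\<close> into the multiple of \<open>u $ i\<close>. The
  other terms carry one conjugate coordinate in front of a function that is flat again, so the power
  of \<open>cnj (u $ i)\<close> grows by one.\<close>

lemma flat_bar_expansion:
  fixes F :: "complex ^ 'n::finite \<Rightarrow> complex"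
  assumes r: "r > 0" and F: "smooth_on (ball 0 r) F" "\<And>m. flat_bar m F"
  shows "\<exists>G K. smooth_on (aff_base i -` ball 0 r) G \<and> smooth_on (aff_base i -` ball 0 r) K \<and>
    (\<forall>u\<in>aff_base i -` ball 0 r. F (aff_base i u) = u $ i * G u + cnj (u $ i) ^ m * K u)"
  using F
proof (induction m arbitrary: F)
  case 0
  show ?case
    using smooth_on_const[of _ 0] smooth_on_aff_base_compose[OF open_ball 0(1), of i]
    by (intro exI[of _ "\<lambda>_. 0"] exI[of _ "\<lambda>u. F (aff_base i u)"]) auto
next
  case (Suc m)
  let ?W = "aff_base i -` ball 0 r"
  have W: "open ?W" by (rule open_aff_base_vimage[OF open_ball])
  obtain a b where *: "\<forall>j. smooth_on (ball 0 r) (a j)" "\<forall>j. smooth_on (ball 0 r) (b j)" "\<forall>j m. flat_bar m (b j)"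
    and eq: "\<forall>z\<in>ball 0 r. F z = (\<Sum>j\<in>UNIV. z $ j * a j z + cnj (z $ j) * b j z)"
    using hadamard_flat_bar[OF r Suc.prems] by (elim exE conjE) blast
  note ab = *[rule_format]
  have "\<forall>j. \<exists>G K. smooth_on ?W G \<and> smooth_on ?W K \<and>
    (\<forall>u\<in>?W. b j (aff_base i u) = u $ i * G u + cnj (u $ i) ^ m * K u)"
    using Suc.IH[OF ab(2,3)] by blast
  then obtain G K where GK: "\<And>j. smooth_on ?W (G j)" "\<And>j. smooth_on ?W (K j)"
    "\<And>j u. u \<in> ?W \<Longrightarrow> b j (aff_base i u) = u $ i * G j u + cnj (u $ i) ^ m * K j u"
    by metis
  let ?G = "\<lambda>u. \<Sum>j\<in>UNIV. aff_dir i u $ j * a j (aff_base i u) + cnj (aff_base i u $ j) * G j u"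
  let ?K = "\<lambda>u. \<Sum>j\<in>UNIV. cnj (aff_dir i u $ j) * K j u"
  have a: "smooth_on ?W (\<lambda>u. a j (aff_base i u))" for j
    by (rule smooth_on_aff_base_compose[OF open_ball ab(1)])
  have dir: "smooth_on ?W (\<lambda>u. aff_dir i u $ j)" "smooth_on ?W (\<lambda>u. aff_base i u $ j)" for j
    by (rule smooth_on_vec_nth[OF W smooth_on_aff_dir[OF W]], rule smooth_on_vec_nth[OF W smooth_on_aff_base[OF W]])
  have "smooth_on ?W ?G" "smooth_on ?W ?K"
    by (intro smooth_on_sum smooth_on_add smooth_on_mult smooth_on_cnj W GK a dir)+
  moreover have "F (aff_base i u) = u $ i * ?G u + cnj (u $ i) ^ Suc m * ?K u" if u: "u \<in> ?W" for u
  proof -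
    have "F (aff_base i u) = (\<Sum>j\<in>UNIV. aff_base i u $ j * a j (aff_base i u) + cnj (aff_base i u $ j) * b j (aff_base i u))"
      using eq u by simp
    also have "\<dots> = u $ i * ?G u + cnj (u $ i) ^ Suc m * ?K u"
      unfolding sum_distrib_left sum.distrib[symmetric] GK(3)[OF u]
      by (intro sum.cong refl) (simp add: aff_base_nth algebra_simps)
    finally show ?thesis .
  qed
  ultimately show ?case by blast
qed

text \<open>At \<open>s = 0\<close> the quotient is \<open>0 / 0 = 0\<close>, which is its continuous extension.\<close>
lemma ck_on_cnj_power_divide:
  "a \<ge> b + k + 1 \<Longrightarrow> b \<ge> 1 \<Longrightarrow> ck_on k UNIV (\<lambda>s. cnj s ^ a / s ^ b)"
proof (induction k arbitrary: a b)
  case 0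
  have "isCont (\<lambda>s. cnj s ^ a / s ^ b) s" for s :: complex
  proof (cases "s = 0")
    case True
    have "((\<lambda>s. cnj s ^ a / s ^ b) \<longlongrightarrow> 0) (at 0)"
    proof (rule tendsto_norm_zero_cancel, rule Lim_transform_eventually)
      have "((\<lambda>s::complex. norm s ^ (a - b)) \<longlongrightarrow> norm (0::complex) ^ (a - b)) (at 0)"
        by (intro tendsto_intros)
      moreover have "norm (0::complex) ^ (a - b) = 0" using 0 by (simp add: zero_power)
      ultimately show "((\<lambda>s::complex. norm s ^ (a - b)) \<longlongrightarrow> 0) (at 0)" by (simp only:)
      show "\<forall>\<^sub>F s in at 0. norm s ^ (a - b) = norm (cnj s ^ a / s ^ b)"
        using 0 by (auto simp: eventually_at_filter norm_divide norm_power power_diff)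
    qed
    moreover have "(0::complex) ^ a / 0 ^ b = 0" using 0 by (cases a) auto
    ultimately show ?thesis unfolding isCont_def True complex_cnj_zero by (simp only:)
  qed (auto intro!: continuous_intros)
  then show ?case by (simp add: continuous_at_imp_continuous_on)
next
  case (Suc k)
  \<comment> \<open>The formula also serves at the origin, where its quotients are
    \<open>0 / 0 = 0\<close> and the true derivative is 0. In both quotients the difference of the
    exponents has dropped by one, matching the loss of one class.\<close>
  define D where "D s v = of_nat a * (cnj s ^ (a - 1) / s ^ b) * cnj v - of_nat b * (cnj s ^ a / s ^ Suc b) * v" for s v
  show ?case
  proof (rule ck_on_SucI[OF open_UNIV, where f'=D])
    fix s :: complex
    show "((\<lambda>s. cnj s ^ a / s ^ b) has_derivative D s) (at s)"
    proof (cases "s = 0")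
      case True
      have "((\<lambda>s. norm (cnj s ^ a / s ^ b) / norm s) \<longlongrightarrow> 0) (at 0)"
      proof (rule Lim_transform_eventually)
        have "((\<lambda>s::complex. norm s ^ (a - Suc b)) \<longlongrightarrow> norm (0::complex) ^ (a - Suc b)) (at 0)"
          by (intro tendsto_intros)
        moreover have "norm (0::complex) ^ (a - Suc b) = 0" using Suc.prems by (simp add: zero_power)
        ultimately show "((\<lambda>s::complex. norm s ^ (a - Suc b)) \<longlongrightarrow> 0) (at 0)" by (simp only:)
        show "\<forall>\<^sub>F s in at 0. norm s ^ (a - Suc b) = norm (cnj s ^ a / s ^ b) / norm s"
          using Suc.prems by (auto simp: eventually_at_filter norm_divide norm_power power_diff mult.commute)
      qed
      moreover have "D 0 = (\<lambda>v. 0)" using Suc.prems by (auto simp: D_def)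
      moreover have "(0::complex) ^ a / 0 ^ b = 0" using Suc.prems by (cases a) auto
      ultimately show ?thesis
        unfolding True has_derivative_iff_norm by (simp only: complex_cnj_zero diff_zero bounded_linear_zero simp_thms)
    next
      case False
      have "((\<lambda>s. cnj s) has_derivative cnj) (at s)"
        by (rule bounded_linear_imp_has_derivative[OF bounded_linear_cnj])
      from has_derivative_divide[OF has_derivative_power[OF this, of a] has_derivative_power[OF has_derivative_ident, of b], of ] False
      have "((\<lambda>s. cnj s ^ a / s ^ b) has_derivative
        (\<lambda>v. - (cnj s ^ a) * (inverse (s ^ b) * (of_nat b * v * s ^ (b - 1)) * inverse (s ^ b))
           + (of_nat a * cnj v * cnj s ^ (a - 1)) / s ^ b)) (at s)"
        by simp
      moreover have "- (cnj s ^ a) * (inverse (s ^ b) * (of_nat b * v * s ^ (b - 1)) * inverse (s ^ b))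
           + (of_nat a * cnj v * cnj s ^ (a - 1)) / s ^ b = D s v" for v
      proof -
        have "inverse (s ^ b) * s ^ (b - 1) * inverse (s ^ b) = 1 / s ^ Suc b"
          using False Suc.prems by (cases b) (simp_all add: field_simps)
        then have "- (cnj s ^ a) * (inverse (s ^ b) * (of_nat b * v * s ^ (b - 1)) * inverse (s ^ b))
          = - (of_nat b * (cnj s ^ a / s ^ Suc b) * v)"
          by (metis (no_types, opaque_lifting) mult.assoc mult.commute mult_minus_left times_divide_eq_right mult.right_neutral)
        then show ?thesis by (simp add: D_def)
      qed
      ultimately show ?thesis by simp
    qed
  next
    fix v
    have c: "ck_on k UNIV (\<lambda>s. c * (cnj s ^ a' / s ^ b') * d)" if "a' \<ge> b' + k + 1" "b' \<ge> 1" for a' b' c d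
      by (intro ck_on_bilinear[OF bounded_bilinear_mult open_UNIV] ck_on_const Suc.IH that)
    have "ck_on k UNIV (\<lambda>s. of_nat a * (cnj s ^ (a - 1) / s ^ b) * cnj v + (- of_nat b) * (cnj s ^ a / s ^ Suc b) * v)"
      using Suc.prems by (intro ck_on_add[OF open_UNIV] c) auto
    then show "ck_on k UNIV (\<lambda>s. D s v)" by (simp add: D_def)
  qed
qed

lemma smooth_on_divide_exceptional:
  fixes F :: "complex ^ 'n::finite \<Rightarrow> complex"
  assumes S: "open S" "0 \<in> S" and F: "smooth_on S F" "\<And>m. flat_bar m F"
  shows "smooth_on (aff_base i -` S)
    (\<lambda>u. if u $ i = 0 then frechet_derivative F (at 0) (aff_dir i u) else F (aff_base i u) / u $ i)"
    (is "smooth_on ?WS ?H")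
proof (rule smooth_on_local)
  fix u assume u: "u \<in> ?WS"
  have WS: "open ?WS" by (rule open_aff_base_vimage[OF S(1)])
  obtain r where r: "r > 0" "ball 0 r \<subseteq> S" using S openE by blast
  let ?W = "aff_base i -` ball 0 r"
  have W: "open ?W" by (rule open_aff_base_vimage[OF open_ball])
  show "\<exists>T. open T \<and> u \<in> T \<and> smooth_on T ?H"
  proof (cases "u $ i = 0")
    case False
    let ?T = "?WS \<inter> {u. u $ i \<noteq> 0}"
    have T: "open ?T" by (intro open_Int WS open_Collect_neq continuous_intros)
    have "smooth_on ?T (\<lambda>u. F (aff_base i u) / u $ i)"
      by (intro smooth_on_divide T smooth_on_vec_nth smooth_on_id
          smooth_on_subset[OF smooth_on_aff_base_compose[OF S(1) F(1)]]) auto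
    then have "smooth_on ?T ?H" by (subst smooth_on_open_cong[OF T]) auto
    then show ?thesis using T u False by blast
  next
    case True
    have "ck_on k ?W ?H" for k
    proof -
      \<comment> \<open>This is the least exponent for which \<open>ck_on_cnj_power_divide\<close>
        makes the quotient of the power by \<open>u $ i\<close> of class C^k. The functions
        \<open>G\<close> and \<open>K\<close> depend on \<open>k\<close>, the neighbourhood
        \<open>?W\<close> does not.\<close>
      let ?m = "Suc (Suc k)"
      have F': "smooth_on (ball 0 r) F" using F(1) r(2) by (rule smooth_on_subset)
      obtain G K where GK: "smooth_on ?W G" "smooth_on ?W K"
        "\<And>u. u \<in> ?W \<Longrightarrow> F (aff_base i u) = u $ i * G u + cnj (u $ i) ^ ?m * K u"
        using flat_bar_expansion[OF r(1) F' F(2), of i ?m] by blast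
      have "ck_on k ?W (\<lambda>u. cnj (u $ i) ^ ?m / (u $ i) ^ 1)"
        using ck_on_compose[OF W open_UNIV ck_on_cnj_power_divide[of 1 k ?m] ck_on_bounded_linear[OF bounded_linear_vec_nth]]
        by simp
      then have ck: "ck_on k ?W (\<lambda>u. G u + (cnj (u $ i) ^ ?m / u $ i) * K u)"
        using GK by (intro ck_on_add W ck_on_bilinear[OF bounded_bilinear_mult]) (auto simp: smooth_on_def)
      have "?H u = G u + (cnj (u $ i) ^ ?m / u $ i) * K u" if u: "u \<in> ?W" for u
      proof (cases "u $ i = 0")
        case False
        then show ?thesis using GK(3)[OF u] by (simp add: field_simps)
      next
        case True
        \<comment> \<open>On the divisor the prescribed value has to be recognized as
          \<open>G u\<close>. The path \<open>?u\<close> is mapped by \<open>aff_base i\<close> to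
          the real line \<open>t *\<^sub>R ?w\<close>, and both values are the derivative of
          \<open>F\<close> along that line at 0.\<close>
        let ?u = "\<lambda>r::real. u + r *\<^sub>R unit i" and ?w = "aff_dir i u"
        have ab: "aff_base i (?u t) = t *\<^sub>R ?w" for t
          using True by (simp add: vec_eq_iff aff_base_def aff_dir_def axis_def scaleR_conv_of_real[where 'a=complex])
        have ui: "?u t $ i = of_real t" for t using True by (simp add: axis_def scaleR_conv_of_real[where 'a=complex])
        have "((\<lambda>t. F (0 + t *\<^sub>R ?w)) has_vector_derivative frechet_derivative F (at (0 + 0 *\<^sub>R ?w)) ?w) (at 0)"
          using S F by (intro has_vector_derivative_along_line) (simp add: smooth_on_differentiable)
        then have 1: "((\<lambda>t. F (t *\<^sub>R ?w)) has_vector_derivative frechet_derivative F (at 0) ?w) (at 0)" by simp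
        have Gd: "((\<lambda>t. H (?u t)) has_vector_derivative frechet_derivative H (at (?u 0)) (unit i)) (at 0)"
          if "smooth_on ?W H" for H :: "complex ^ 'n \<Rightarrow> complex"
          using u that by (intro has_vector_derivative_along_line) (simp add: smooth_on_differentiable)
        have cr: "(complex_of_real has_vector_derivative 1) (at 0)"
          unfolding has_vector_derivative_def by (auto intro!: derivative_eq_intros simp: scaleR_conv_of_real)
        have "((\<lambda>t. of_real t * (G (?u t) + of_real t * (of_real t ^ k * K (?u t)))) has_vector_derivative G u) (at 0)"
        proof -
          define P where "P t = G (?u t) + of_real t * (of_real t ^ k * K (?u t))" for t
          have "(P has_vector_derivative vector_derivative P (at 0)) (at 0)"
          proof (rule vector_derivative_works[THEN iffD1])
            have "(\<lambda>t. complex_of_real t) differentiable (at 0)" using cr by (rule differentiableI_vector)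
            moreover have "(\<lambda>t. G (?u t)) differentiable (at 0)" "(\<lambda>t. K (?u t)) differentiable (at 0)"
              using differentiableI_vector[OF Gd[OF GK(1)]] differentiableI_vector[OF Gd[OF GK(2)]] by auto
            ultimately show "P differentiable (at 0)"
              unfolding P_def[abs_def] by (intro derivative_intros)
          qed
          from has_vector_derivative_mult[OF cr this]
          show ?thesis by (simp add: P_def)
        qed
        moreover have "open (?u -` ?W)" by (intro open_vimage W continuous_intros)
        moreover have "of_real t * (G (?u t) + of_real t * (of_real t ^ k * K (?u t))) = F (t *\<^sub>R ?w)"
          if "t \<in> ?u -` ?W" for t
          using GK(3)[of "?u t"] that unfolding ui ab by (simp add: algebra_simps)
        ultimately have "((\<lambda>t. F (t *\<^sub>R ?w)) has_vector_derivative G u) (at 0)"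
          using u unfolding has_vector_derivative_def
          by (elim has_derivative_transform_within_open) auto
        with 1 have "frechet_derivative F (at 0) ?w = G u" by (rule vector_derivative_unique_at)
        then show ?thesis using True by simp
      qed
      then have "ck_on k ?W ?H \<longleftrightarrow> ck_on k ?W (\<lambda>u. G u + (cnj (u $ i) ^ ?m / u $ i) * K u)"
        by (intro ck_on_cong[OF W])
      with ck show ?thesis by (simp only: simp_thms)
    qed
    moreover have "u \<in> ?W" using True r by (simp add: aff_base_eq_0_iff[THEN iffD2])
    ultimately show ?thesis using W unfolding smooth_on_def by (intro exI[of _ ?W]) simp
  qed
qed

subsection \<open>Almost complex structures that lift to the blow-up\<close>

lemma has_derivative_vec_lambda:
  fixes f :: "'n::finite \<Rightarrow> 'a::real_normed_vector \<Rightarrow> complex"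
  assumes "\<And>i. (f i has_derivative f' i) (at x)"
  shows "((\<lambda>x. \<chi> i. f i x) has_derivative (\<lambda>v. \<chi> i. f' i v)) (at x)"
proof -
  have eq: "(\<chi> i. g i) = (\<Sum>i\<in>UNIV. axis i (g i))" for g :: "'n \<Rightarrow> complex"
    by (simp add: vec_eq_iff axis_def if_distrib sum.delta cong: if_cong)
  show ?thesis
    unfolding eq by (intro has_derivative_sum bounded_linear.has_derivative[OF bounded_linear_axis] assms)
qed

text \<open>On the divisor \<open>u $ i = 0\<close> the image of the derivative shrinks to the
  complex line of \<open>aff_dir i u\<close>. This drop of rank is the source of the constraints on
  structures that lift.\<close>

lemma has_derivative_aff_base:
  "(aff_base i has_derivative (\<lambda>v. (v $ i) *s aff_dir i u + (u $ i) *s (v - (v $ i) *s unit i))) (at u)"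
proof -
  have nth: "((\<lambda>u. u $ j) has_derivative (\<lambda>v. v $ j)) (at u)" for j
    by (rule bounded_linear_imp_has_derivative[OF bounded_linear_vec_nth])
  have "((\<lambda>u. u $ i * (if j = i then 1 else u $ j)) has_derivative
      (\<lambda>v. v $ i * aff_dir i u $ j + u $ i * (v $ j - v $ i * unit i $ j))) (at u)" for j
    using nth has_derivative_mult[OF nth[of i] nth[of j]]
    by (cases "j = i") (auto simp: aff_dir_def axis_def add.commute)
  then have "((\<lambda>u. \<chi> j. u $ i * (if j = i then 1 else u $ j)) has_derivative
      (\<lambda>v. \<chi> j. v $ i * aff_dir i u $ j + u $ i * (v $ j - v $ i * unit i $ j))) (at u)"
    by (rule has_derivative_vec_lambda)
  moreover have "(\<lambda>u. \<chi> j. u $ i * (if j = i then 1 else u $ j)) = aff_base i"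
    by (auto simp: aff_base_def aff_dir_def vec_eq_iff)
  moreover have "(\<chi> j. v $ i * aff_dir i u $ j + u $ i * (v $ j - v $ i * unit i $ j))
      = (v $ i) *s aff_dir i u + (u $ i) *s (v - (v $ i) *s unit i)" for v
    by (simp add: vec_eq_iff right_diff_distrib)
  ultimately show ?thesis by simp
qed

lemma frechet_derivative_aff_base:
  "frechet_derivative (aff_base i) (at u) v = (v $ i) *s aff_dir i u + (u $ i) *s (v - (v $ i) *s unit i)"
  by (rule fun_cong[OF frechet_derivative_at[OF has_derivative_aff_base, symmetric]])

text \<open>Along the line \<open>s *s w\<close> with \<open>w $ i = 1\<close> the equation says
  that \<open>cnj s\<close> times \<open>g\<close> is a smooth multiple of \<open>s\<close>, where
  \<open>g\<close> is \<open>F - w $ j * G\<close> on the line. So the antiholomorphic derivatives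
  of \<open>g\<close> at 0 vanish, which is the hypothesis of
  \<open>flat_bar_of_proportional\<close>.\<close>

lemma flat_bar_of_lift:
  fixes F G \<gamma> :: "complex ^ 'n::finite \<Rightarrow> complex"
  assumes S: "open S" "0 \<in> S" and F: "smooth_on S F" "smooth_on S G"
    and \<gamma>: "smooth_on (aff_base i -` S) \<gamma>" and ij: "j \<noteq> i"
    and eq: "\<And>u. u \<in> aff_base i -` S \<Longrightarrow>
      cnj (u $ i) * (F (aff_base i u) - u $ j * G (aff_base i u)) = u $ i * \<gamma> u"
  shows "flat_bar m F" "flat_bar m G"
proof -
  have prp: "(dbar w ^^ k) F 0 = w $ j * (dbar w ^^ k) G 0" if w: "w $ i = 1" for k w
  proof -
    \<comment> \<open>The affine coordinates of \<open>s *s w\<close>.\<close>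
    define L where "L s = (\<chi> l. if l = i then s else w $ l)" for s :: complex
    have Lw: "aff_base i (L s) = s *s w" for s
      using w by (auto simp: aff_base_def aff_dir_def L_def vec_eq_iff)
    define D where "D = (\<lambda>s. s *s w) -` S"
    note bl = bounded_linear_vector_smult_left[of w]
    have D: "open D" "0 \<in> D"
      unfolding D_def using open_vimage[OF S(1) linear_continuous_on[OF bl]] S by auto
    have sm_line: "smooth_on D (\<lambda>s. H (s *s w))" if "smooth_on S H" for H :: "complex ^ 'n \<Rightarrow> complex"
      by (rule smooth_on_compose[OF D(1) S(1) that smooth_on_bounded_linear[OF bl]]) (auto simp: D_def)
    have smL: "smooth_on D L"
      unfolding L_def[abs_def]
    proof (rule smooth_on_vec_lambda[OF D(1)])
      show "smooth_on D (\<lambda>s. if l = i then s else w $ l)" for l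
        by (cases "l = i") (simp_all add: smooth_on_const smooth_on_id)
    qed
    have sm\<gamma>: "smooth_on D (\<lambda>s. \<gamma> (L s))"
      by (rule smooth_on_compose[OF D(1) open_aff_base_vimage[OF S(1)] \<gamma> smL]) (auto simp: D_def Lw)
    let ?c = "\<lambda>b. if b then 1 else - (w $ j)" and ?F = "\<lambda>b s. (if b then F (s *s w) else G (s *s w))"
    let ?g = "\<lambda>s. \<Sum>b\<in>UNIV. ?c b * ?F b s"
    have smF: "smooth_on D (?F b)" for b
      using sm_line[OF F(1)] sm_line[OF F(2)] by (cases b) auto
    have "(dbar2 1 \<i> ^^ k) ?g 0 = 0"
    proof (rule funpow_dbar2_eq_0[OF D _ sm\<gamma>])
      show "smooth_on D ?g" by (intro smooth_on_sum smooth_on_mult smooth_on_const smF D)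
      fix s assume "s \<in> D"
      then have "L s \<in> aff_base i -` S" by (simp add: D_def Lw)
      from eq[OF this] show "cnj s * ?g s = s * \<gamma> (L s)"
        unfolding Lw using ij by (simp add: L_def UNIV_bool algebra_simps)
    qed
    also have "(dbar2 1 \<i> ^^ k) ?g 0 = (\<Sum>b\<in>UNIV. ?c b * (dbar2 1 \<i> ^^ k) (?F b) 0)"
      by (rule funpow_dbar2_sum[OF D(1) smF D(2)])
    also have "\<dots> = (dbar w ^^ k) F 0 - w $ j * (dbar w ^^ k) G 0"
      using funpow_dbar2_line[OF S(1) F(1), of 0 w k] funpow_dbar2_line[OF S(1) F(2), of 0 w k] S(2)
      by (simp add: UNIV_bool)
    finally show ?thesis by simp
  qed
  show "flat_bar m F" by (rule flat_bar_of_proportional(1)[OF S F ij prp])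
  show "flat_bar m G" by (rule flat_bar_of_proportional(2)[OF S F ij prp])
qed

text \<open>The components of the complex linear and of the antilinear part of a real linear map.\<close>
definition clin :: "(complex ^ 'n::finite \<Rightarrow> complex ^ 'n) \<Rightarrow> complex ^ 'n \<Rightarrow> 'n \<Rightarrow> complex"
  where "clin M v l = (M v $ l + \<i> * (M (- (\<i> *s v)) $ l)) / 2"

definition alin :: "(complex ^ 'n::finite \<Rightarrow> complex ^ 'n) \<Rightarrow> complex ^ 'n \<Rightarrow> 'n \<Rightarrow> complex"
  where "alin M v l = (M v $ l + \<i> * (M (\<i> *s v) $ l)) / 2"

lemma clin_alin_decompose:
  assumes "linear M"
  shows "M x $ l = (\<Sum>p\<in>UNIV. x $ p * clin M (unit p) l + cnj (x $ p) * alin M (unit p) l)"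
proof -
  have "linear (\<lambda>x. M x $ l)"
    using linear_compose[OF assms bounded_linear.linear[OF bounded_linear_vec_nth]] by (simp add: o_def)
  from linear_complex_decompose[OF this] show ?thesis unfolding clin_def alin_def .
qed

text \<open>The antilinear part of a composite comes from linear after antilinear and from
  antilinear after linear, the latter conjugating the coefficients.\<close>

lemma alin_compose:
  assumes "linear M" "linear D"
  shows "alin (\<lambda>v. M (D v)) v l =
    (\<Sum>p\<in>UNIV. clin M (unit p) l * alin D v p + alin M (unit p) l * cnj (clin D v p))"
proof -
  have "alin (\<lambda>v. M (D v)) v l = (M (D v) $ l + \<i> * M (D (\<i> *s v)) $ l) / 2"
    by (simp add: alin_def)
  also have "\<dots> = (\<Sum>p\<in>UNIV. clin M (unit p) l * alin D v p + alin M (unit p) l * cnj (clin D v p))"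
    unfolding clin_alin_decompose[OF assms(1), of "D _"] sum_distrib_left sum.distrib[symmetric] sum_divide_distrib
    by (intro sum.cong refl) (simp add: alin_def[of D] clin_def[of D] linear_neg[OF assms(2)] field_simps)
  finally show ?thesis .
qed

lemma alin_smult:
  assumes "linear M"
  shows "alin M (c *s v) l = cnj c * alin M v l"
proof -
  have 1: "c *s v = Re c *\<^sub>R v + Im c *\<^sub>R (\<i> *s v)"
    by (simp add: vec_eq_iff complex_eq_iff)
  have 2: "\<i> *s (c *s v) = Re c *\<^sub>R (\<i> *s v) + Im c *\<^sub>R (- v)"
    by (simp add: vec_eq_iff complex_eq_iff)
  have 3: "M (c *s v) $ l = Re c * M v $ l + Im c * M (\<i> *s v) $ l"
    "M (\<i> *s (c *s v)) $ l = Re c * M (\<i> *s v) $ l - Im c * M v $ l"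
    unfolding 2 linear_add[OF assms] linear_scale[OF assms] linear_neg[OF assms]
    by (subst 1, simp add: linear_add[OF assms] linear_scale[OF assms] scaleR_conv_of_real[where 'a=complex])
       (simp add: scaleR_conv_of_real[where 'a=complex])
  have "cnj c = of_real (Re c) - \<i> * of_real (Im c)" by (simp add: complex_eq_iff)
  then have "cnj c * alin M v l = (of_real (Re c) - \<i> * of_real (Im c)) * alin M v l" by simp
  then show ?thesis unfolding alin_def 3 by (simp add: field_simps)
qed

lemma alin_eq_0_imp_smult:
  assumes "linear M" "\<And>v l. alin M v l = 0"
  shows "M (c *s v) = c *s M v"
proof -
  have "M v $ l + \<i> * M (\<i> *s v) $ l = 0" for l using assms(2)[of v l] by (simp add: alin_def)
  then have "\<i> * (M v $ l + \<i> * M (\<i> *s v) $ l) = 0" for l by simp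
  then have iM: "M (\<i> *s v) $ l = \<i> * M v $ l" for l by (simp add: algebra_simps)
  have 1: "c *s v = Re c *\<^sub>R v + Im c *\<^sub>R (\<i> *s v)"
    by (simp add: vec_eq_iff complex_eq_iff)
  show ?thesis
    unfolding 1 linear_add[OF assms(1)] linear_scale[OF assms(1)]
    by (simp add: vec_eq_iff iM complex_eq_iff)
qed

definition smooth_field :: "(complex ^ 'n::finite) set \<Rightarrow> (complex ^ 'n \<Rightarrow> complex ^ 'n \<Rightarrow> complex ^ 'n) \<Rightarrow> bool"
  where "smooth_field S J \<longleftrightarrow> (\<forall>z\<in>S. linear (J z)) \<and> (\<forall>e. smooth_on S (\<lambda>z. J z e))"

lemma smooth_field_alin:
  assumes "open S" "smooth_field S J"
  shows "smooth_on S (\<lambda>z. alin (J z) v l)" "smooth_on S (\<lambda>z. clin (J z) v l)"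
proof -
  have sm: "smooth_on S (\<lambda>z. J z e $ l)" for e
    by (rule smooth_on_vec_nth[OF assms(1)]) (use assms(2) in \<open>simp add: smooth_field_def\<close>)
  show "smooth_on S (\<lambda>z. alin (J z) v l)" "smooth_on S (\<lambda>z. clin (J z) v l)"
    unfolding alin_def clin_def
    by (rule smooth_on_divide[OF assms(1) smooth_on_add[OF assms(1) sm
            smooth_on_mult[OF assms(1) smooth_on_const sm]] smooth_on_const], simp)+
qed

lemma smooth_field_apply:
  assumes "open S" "smooth_field S J" "smooth_on S f"
  shows "smooth_on S (\<lambda>z. J z (f z))"
  by (rule smooth_on_linear_apply[where L=J, OF assms(1) _ _ assms(3)])
     (use assms(2) in \<open>auto simp: smooth_field_def\<close>)

text \<open>The constraints at the origin already follow from one affine chart, hence the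
  index.\<close>

definition lifts_to_blowup :: "'n \<Rightarrow> (complex ^ 'n::finite) set \<Rightarrow> (complex ^ 'n \<Rightarrow> complex ^ 'n \<Rightarrow> complex ^ 'n) \<Rightarrow> bool"
  where "lifts_to_blowup i S J \<longleftrightarrow> (\<exists>J'. smooth_field (aff_base i -` S) J' \<and>
    (\<forall>u\<in>aff_base i -` S. \<forall>v. J (aff_base i u) (frechet_derivative (aff_base i) (at u) v)
      = frechet_derivative (aff_base i) (at u) (J' u v)))"

text \<open>In the affine chart \<open>z = s w\<close>, the vector \<open>s e\<close> is the image under the derivative of \<open>aff_base i\<close> of the
  smooth vector field \<open>x\<close> below. So \<open>s\<^sup>*\<close> times the antilinear part of \<open>J\<close> at \<open>e\<close> is a multiple of \<open>w\<close> up to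
  a multiple of \<open>s\<close>.\<close>
lemma flat_bar_alin_of_lift:
  fixes J :: "complex ^ 'n::finite \<Rightarrow> complex ^ 'n \<Rightarrow> complex ^ 'n"
  assumes S: "open S" "0 \<in> S" and J: "smooth_field S J" "lifts_to_blowup i S J" and ij: "j \<noteq> i"
  shows "flat_bar m (\<lambda>z. alin (J z) e l)"
proof -
  let ?W = "aff_base i -` S"
  have W: "open ?W" by (rule open_aff_base_vimage[OF S(1)])
  obtain J' where J': "smooth_field ?W J'"
    and eq: "\<And>u v. u \<in> ?W \<Longrightarrow> J (aff_base i u) (frechet_derivative (aff_base i) (at u) v)
      = frechet_derivative (aff_base i) (at u) (J' u v)"
    using J(2) unfolding lifts_to_blowup_def by blast
  \<comment> \<open>The solution of \<open>d(aff_base i) x = (u $ i) *s e\<close>: its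
    \<open>i\<close>-th entry is \<open>u $ i * e $ i\<close>, its other entries are those of
    \<open>e - (e $ i) *s aff_dir i u\<close>.\<close>
  define x where "x u = (u $ i * e $ i) *s unit i + e - (e $ i) *s aff_dir i u" for u
  define y where "y u l = alin (J' u) (x u) l" for u l
  have smx: "smooth_on ?W x"
    unfolding x_def[abs_def]
    by (intro smooth_on_diff smooth_on_add smooth_on_vector_smult smooth_on_mult smooth_on_vec_nth
        smooth_on_const smooth_on_id smooth_on_aff_dir W)
  have smix: "smooth_on ?W (\<lambda>u. \<i> *s x u)"
    by (intro smooth_on_vector_smult smooth_on_const smx W)
  have smy: "smooth_on ?W (\<lambda>u. y u l)" for l
    unfolding y_def alin_def
    using smooth_field_apply[OF W J' smx] smooth_field_apply[OF W J' smix]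
    by (intro smooth_on_divide smooth_on_add smooth_on_mult smooth_on_vec_nth smooth_on_const W) auto
  have Dx: "frechet_derivative (aff_base i) (at u) (x u) = (u $ i) *s e"
    "frechet_derivative (aff_base i) (at u) (\<i> *s x u) = \<i> *s ((u $ i) *s e)" for u
    by (simp_all add: frechet_derivative_aff_base x_def vec_eq_iff axis_def algebra_simps)
  have key: "cnj (u $ i) * alin (J (aff_base i u)) e l
      = y u i * aff_dir i u $ l + u $ i * (y u l - y u i * unit i $ l)" if u: "u \<in> ?W" for u l
  proof -
    have lin: "linear (J (aff_base i u))" using J(1) u by (auto simp: smooth_field_def)
    have "cnj (u $ i) * alin (J (aff_base i u)) e l = alin (J (aff_base i u)) ((u $ i) *s e) l"
      by (simp add: alin_smult[OF lin])
    also have "\<dots> = (frechet_derivative (aff_base i) (at u) (J' u (x u)) $ l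
       + \<i> * frechet_derivative (aff_base i) (at u) (J' u (\<i> *s x u)) $ l) / 2"
      using eq[OF u, of "x u"] eq[OF u, of "\<i> *s x u"] unfolding Dx by (simp only: alin_def)
    also have "\<dots> = y u i * aff_dir i u $ l + u $ i * (y u l - y u i * unit i $ l)"
      by (simp add: frechet_derivative_aff_base y_def alin_def field_simps)
    finally show ?thesis .
  qed
  have sm: "smooth_on S (\<lambda>z. alin (J z) e l)" for l by (rule smooth_field_alin[OF S(1) J(1)])
  \<comment> \<open>The \<open>i\<close>-th component of \<open>key\<close> gives
    \<open>y u i\<close>. Substituted into the \<open>k\<close>-th component it leaves a multiple of
    \<open>u $ i\<close>.\<close>
  have eq2: "cnj (u $ i) * (alin (J (aff_base i u)) e k - u $ k * alin (J (aff_base i u)) e i) = u $ i * y u k"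
    if u: "u \<in> ?W" and k: "k \<noteq> i" for u k
    using key[OF u, of k] key[OF u, of i] k by (simp add: right_diff_distrib aff_dir_def axis_def mult.left_commute)
  show ?thesis
  proof (cases "l = i")
    case True
    then show ?thesis using flat_bar_of_lift(2)[OF S sm sm smy ij eq2[OF _ ij]] by simp
  next
    case False
    from flat_bar_of_lift(1)[OF S sm sm smy False eq2[OF _ False]] show ?thesis .
  qed
qed

text \<open>At the point of the divisor given by the line of \<open>w\<close>, the derivative of
  \<open>aff_base\<close> has this line as its image, so \<open>J 0\<close> preserves it. As
  \<open>J 0\<close> is complex linear, the invariance of all these lines makes it a scalar, whose
  square is -1.\<close>

lemma lift_at_origin:
  fixes J :: "complex ^ 'n::finite \<Rightarrow> complex ^ 'n \<Rightarrow> complex ^ 'n"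
  assumes S: "open S" "0 \<in> S" and J: "smooth_field S J" "lifts_to_blowup i S J" and ij: "j \<noteq> i"
    and JJ: "\<And>v. J 0 (J 0 v) = - v"
  shows "\<exists>a\<in>{\<i>, - \<i>}. \<forall>v. J 0 v = a *s v"
proof -
  have lin: "linear (J 0)" using J(1) S(2) by (auto simp: smooth_field_def)
  have "alin (J 0) e l = 0" for e l using flat_bar_alin_of_lift[OF S J ij, of 1 e l] by simp
  note clin = alin_eq_0_imp_smult[OF lin this]
  have line: "\<exists>a. J 0 w = a *s w" if w: "w $ i = 1" for w
  proof -
    define u where "u = w - unit i"
    have u: "aff_base i u = 0" "aff_dir i u = w" "u $ i = 0"
      using w by (auto simp: u_def aff_base_def aff_dir_def vec_eq_iff axis_def)
    obtain J' where "\<And>v. J (aff_base i u) (frechet_derivative (aff_base i) (at u) v)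
      = frechet_derivative (aff_base i) (at u) (J' u v)"
      using J(2) u S(2) unfolding lifts_to_blowup_def by force
    from this[of "unit i"] show ?thesis by (auto simp: frechet_derivative_aff_base u)
  qed
  obtain a where a: "J 0 (unit i) = a *s unit i" using line[of "unit i"] by auto
  \<comment> \<open>Compare the eigenvalues at \<open>unit i + t\<close> and
    \<open>unit i + 2 *s t\<close>: the entry \<open>l\<close> shows that they agree, the entry
    \<open>i\<close> that they equal \<open>a\<close>.\<close>
  have *: "J 0 (unit i + t) = a *s (unit i + t)" if t: "t $ i = 0" for t
  proof (cases "t = 0")
    case False
    then obtain l where l: "t $ l \<noteq> 0" by (auto simp: vec_eq_iff)
    obtain a1 a2 where a12: "J 0 (unit i + t) = a1 *s (unit i + t)" "J 0 (unit i + 2 *s t) = a2 *s (unit i + 2 *s t)"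
      using line[of "unit i + t"] line[of "unit i + 2 *s t"] t by auto
    have "a *s unit i + 2 *s J 0 t = a2 *s (unit i + 2 *s t)" "a *s unit i + J 0 t = a1 *s (unit i + t)"
      using a12 by (simp_all add: linear_add[OF lin] a clin)
    then have e: "a * unit i $ m + 2 * J 0 t $ m = a2 * (unit i $ m + 2 * t $ m)"
        "a * unit i $ m + J 0 t $ m = a1 * (unit i $ m + t $ m)" for m
      by (metis vector_add_component vector_smult_component)+
    have li: "l \<noteq> i" using l t by auto
    from e(1)[of l] e(2)[of l] li l have "a1 = a2" by (simp add: axis_def)
    moreover have "a + 2 * J 0 t $ i = a2" "a + J 0 t $ i = a1"
      using e(1)[of i] e(2)[of i] t by simp_all
    moreover have "a = 2 * (a + J 0 t $ i) - (a + 2 * J 0 t $ i)" by simp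
    ultimately have "a1 = a" by simp
    then show ?thesis using a12 by simp
  qed (simp add: a)
  have Ja: "J 0 v = a *s v" for v
  proof -
    have "v = (unit i + (v - (v $ i) *s unit i)) + (v $ i - 1) *s unit i"
      by (simp add: vec_eq_iff algebra_simps)
    then have "J 0 v = J 0 ((unit i + (v - (v $ i) *s unit i)) + (v $ i - 1) *s unit i)" by simp
    also have "\<dots> = a *s (unit i + (v - (v $ i) *s unit i)) + (v $ i - 1) *s (a *s unit i)"
      unfolding linear_add[OF lin, of "unit i + (v - (v $ i) *s unit i)"] clin a by (subst *) simp_all
    also have "\<dots> = a *s v" by (simp add: vec_eq_iff algebra_simps)
    finally show ?thesis .
  qed
  have "a *s (a *s unit i) = - unit i" using JJ[of "unit i"] Ja by simp
  then have "(a *s (a *s unit i)) $ i = (- unit i) $ i" by simp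
  then have "a * a = -1" by simp
  then have "(a - \<i>) * (a + \<i>) = 0" by (simp add: algebra_simps)
  then have "a = \<i> \<or> a = - \<i>" by (simp add: eq_neg_iff_add_eq_0)
  then show ?thesis using Ja by blast
qed

lemma alin_frechet:
  assumes "smooth_on S \<psi>" "z \<in> S"
  shows "alin (frechet_derivative \<psi> (at z)) v l = dbar v (\<lambda>z. \<psi> z $ l) z"
    and "clin (frechet_derivative \<psi> (at z)) v l = ddel v (\<lambda>z. \<psi> z $ l) z"
  using dbar2_eqI[OF bounded_linear.has_derivative[OF bounded_linear_vec_nth smooth_on_has_derivative[OF assms]]]
  by (simp_all add: alin_def clin_def)

text \<open>The antilinear part of the equation \<open>J2 \<circ> d\<psi> = d\<psi> \<circ> J1\<close> expresses \<open>dbar v \<psi>\<close> through terms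
  vanishing to higher order in the pure antiholomorphic directions, so the order of vanishing improves
  step by step.\<close>
lemma flat_bar_pseudoholomorphic:
  fixes \<psi> :: "complex ^ 'n::finite \<Rightarrow> complex ^ 'n"
  assumes S: "open S" "0 \<in> S" and \<psi>: "smooth_on S \<psi>" "\<psi> 0 = 0"
    and U: "open U" "\<psi> ` S \<subseteq> U"
    and J1: "smooth_field S J1" "\<And>v. J1 0 v = a *s v" "\<And>m v l. flat_bar m (\<lambda>z. alin (J1 z) v l)"
    and J2: "smooth_field U J2" "\<And>v. J2 0 v = a *s v" "\<And>m v l. flat_bar m (\<lambda>z. alin (J2 z) v l)"
    and a: "a \<noteq> 0" "cnj a = - a"
    and eq: "\<And>z v. z \<in> S \<Longrightarrow> J2 (\<psi> z) (frechet_derivative \<psi> (at z) v) = frechet_derivative \<psi> (at z) (J1 z v)"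
  shows "flat_bar m (\<lambda>z. \<psi> z $ l)"
proof (induction m arbitrary: l)
  case (Suc m)
  note cI = Suc
  define A where "A v l = dbar v (\<lambda>z. \<psi> z $ l)" for v l
  define C where "C v l = ddel v (\<lambda>z. \<psi> z $ l)" for v l
  \<comment> \<open>\<open>K\<close> and \<open>M\<close> measure how far the complex linear parts
    of the structures are from the scalar \<open>a\<close>. They vanish at the origin, so products
    with \<open>A\<close> gain an order.\<close>
  define K where "K v p z = clin (J1 z) v p - a * v $ p" for v p z
  define M where "M p l z = clin (J2 (\<psi> z)) (unit p) l - a * unit p $ l" for p l z
  define N where "N p l z = alin (J2 (\<psi> z)) (unit p) l" for p l z
  define B where "B v p z = alin (J1 z) v p" for v p z
  have sm\<psi>: "smooth_on S (\<lambda>z. \<psi> z $ l)" for l by (rule smooth_on_vec_nth[OF S(1) \<psi>(1)])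
  have smA: "smooth_on S (A v l)" and smC: "smooth_on S (C v l)" for v l
    unfolding A_def C_def by (intro smooth_on_dbar2 S sm\<psi>)+
  have smB: "smooth_on S (B v p)" for v p
    unfolding B_def[abs_def] by (rule smooth_field_alin[OF S(1) J1(1)])
  have smK: "smooth_on S (K v p)" for v p
    unfolding K_def[abs_def] by (rule smooth_on_diff[OF S(1) smooth_field_alin(2)[OF S(1) J1(1)] smooth_on_const])
  have smN: "smooth_on S (N p l)" for p l
    unfolding N_def[abs_def] by (rule smooth_on_compose[OF S(1) U(1) smooth_field_alin(1)[OF U(1) J2(1)] \<psi>(1) U(2)])
  have smM: "smooth_on S (M p l)" for p l
    unfolding M_def[abs_def]
    by (rule smooth_on_diff[OF S(1) smooth_on_compose[OF S(1) U(1) smooth_field_alin(2)[OF U(1) J2(1)] \<psi>(1) U(2)] smooth_on_const])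
  have K0: "K v p 0 = 0" for v p by (simp add: K_def clin_def J1(2) algebra_simps)
  have M0: "M p l 0 = 0" for p l by (simp add: M_def clin_def J2(2) \<psi>(2) algebra_simps)
  have pzN: "flat_bar m (N p l)" for p l
    unfolding N_def[abs_def]
    by (rule flat_bar_compose[OF S U smooth_field_alin(1)[OF U(1) J2(1)] \<psi> J2(3) cI])
  let ?X = "\<lambda>v l p z. C (unit p) l z * B v p z + A (unit p) l z * cnj (K v p z)
        + (- (1 :: complex)) * (M p l z * A v p z) + (- (1 :: complex)) * (N p l z * cnj (C v p z))"
  \<comment> \<open>The scalar parts contribute \<open>a\<close> times \<open>A\<close> on the left
    and \<open>cnj a = - a\<close> times \<open>A\<close> on the right. They add up instead of
    cancelling, so the equation can be solved for \<open>A\<close>; with opposite scalars at the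
    origin they would cancel.\<close>
  have rec: "A v l z = (1 / (2 * a)) * (\<Sum>p\<in>UNIV. ?X v l p z)" if z: "z \<in> S" for v l z
  proof -
    have lin: "linear (J1 z)" "linear (J2 (\<psi> z))" "linear (frechet_derivative \<psi> (at z))"
      using J1(1) J2(1) z U(2) linear_frechet_derivative[OF smooth_on_differentiable[OF \<psi>(1) z]]
      by (auto simp: smooth_field_def)
    note parts = alin_frechet[OF \<psi>(1) z, folded A_def C_def]
    have "(\<Sum>p\<in>UNIV. (M p l z + a * unit p $ l) * A v p z + N p l z * cnj (C v p z))
        = alin (\<lambda>v. J2 (\<psi> z) (frechet_derivative \<psi> (at z) v)) v l"
      unfolding alin_compose[OF lin(2,3)] parts by (simp add: M_def N_def)
    also have "\<dots> = alin (\<lambda>v. frechet_derivative \<psi> (at z) (J1 z v)) v l"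
      by (simp add: eq[OF z])
    also have "\<dots> = (\<Sum>p\<in>UNIV. C (unit p) l z * B v p z + A (unit p) l z * cnj (K v p z + a * v $ p))"
      unfolding alin_compose[OF lin(3,1)] parts by (simp add: K_def B_def)
    finally have 1: "(\<Sum>p\<in>UNIV. (M p l z + a * unit p $ l) * A v p z + N p l z * cnj (C v p z))
      = (\<Sum>p\<in>UNIV. C (unit p) l z * B v p z + A (unit p) l z * cnj (K v p z + a * v $ p))" .
    have 2: "(\<Sum>p\<in>UNIV. a * unit p $ l * A v p z) = a * A v l z"
      by (simp add: axis_def if_distrib if_distribR sum.delta cong: if_cong)
    have 3: "(\<Sum>p\<in>UNIV. A (unit p) l z * cnj (a * v $ p)) = - a * A v l z"
      unfolding A_def dbar_expand[OF sm\<psi> z, of v l] sum_distrib_left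
      by (intro sum.cong refl) (simp add: a(2))
    have "2 * a * A v l z = (\<Sum>p\<in>UNIV. ?X v l p z)"
      using 1 2 3 by (simp add: sum.distrib sum_subtractf algebra_simps)
    then show ?thesis using a(1) by (simp add: field_simps)
  qed
  \<comment> \<open>With \<open>\<psi>\<close> flat to order \<open>m\<close>, the flatness of
    \<open>A\<close> climbs one order at a time up to \<open>m\<close>: the term with
    \<open>B\<close> is flat to every order, those with \<open>K\<close> and \<open>M\<close> gain
    an order, and \<open>N\<close> is flat to order \<open>m\<close> by composition. Flatness of
    \<open>A\<close> to order \<open>m\<close> is flatness of \<open>\<psi>\<close> to order
    \<open>m + 1\<close>.\<close>
  have step: "flat_bar k (A v l)" if "k \<le> m" for k v l
    using that
  proof (induction k arbitrary: v l)
    case (Suc k)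
    have smX: "smooth_on S (?X v l p)" for p
      by (intro smooth_on_add smooth_on_mult smooth_on_cnj smooth_on_const smA smB smC smK smM smN S)
    have "flat_bar (Suc k) (?X v l p)" for p
    proof (intro flat_bar_add[OF S] smooth_on_add smooth_on_mult smooth_on_cnj smooth_on_const smA smB smC smK smM smN S)
      show "flat_bar (Suc k) (\<lambda>z. C (unit p) l z * B v p z)"
        using J1(3) by (intro flat_bar_mult(2)[OF S smB smC]) (simp add: B_def[abs_def])
      have "flat_bar (Suc k) (\<lambda>z. cnj (K v p z) * A (unit p) l z)"
        using Suc by (intro flat_bar_mult_vanishing[OF S smooth_on_cnj[OF S(1) smK] smA]) (simp_all add: K0)
      then show "flat_bar (Suc k) (\<lambda>z. A (unit p) l z * cnj (K v p z))" by (simp add: mult.commute)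
      have "flat_bar (Suc k) (\<lambda>z. M p l z * A v p z)"
        using Suc by (intro flat_bar_mult_vanishing[OF S smM smA]) (simp_all add: M0)
      then show "flat_bar (Suc k) (\<lambda>z. (- 1) * (M p l z * A v p z))"
        by (rule flat_bar_mult(2)[OF S smooth_on_mult[OF S(1) smM smA] smooth_on_const])
      have "flat_bar (Suc k) (\<lambda>z. N p l z * cnj (C v p z))"
        by (rule flat_bar_mult(1)[OF S smN smooth_on_cnj[OF S(1) smC] flat_bar_mono[OF pzN Suc.prems]])
      then show "flat_bar (Suc k) (\<lambda>z. (- 1) * (N p l z * cnj (C v p z)))"
        by (rule flat_bar_mult(2)[OF S smooth_on_mult[OF S(1) smN smooth_on_cnj[OF S(1) smC]] smooth_on_const])
    qed
    then have "flat_bar (Suc k) (\<lambda>z. \<Sum>p\<in>UNIV. ?X v l p z)"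
      by (rule flat_bar_sum[OF S smX])
    then have "flat_bar (Suc k) (\<lambda>z. (1 / (2 * a)) * (\<Sum>p\<in>UNIV. ?X v l p z))"
      by (rule flat_bar_mult(2)[OF S smooth_on_sum[OF S(1) smX] smooth_on_const])
    moreover have "flat_bar (Suc k) (A v l) \<longleftrightarrow> flat_bar (Suc k) (\<lambda>z. (1 / (2 * a)) * (\<Sum>p\<in>UNIV. ?X v l p z))"
      by (rule flat_bar_cong[OF S rec])
    ultimately show ?case by (rule iffD2[rotated])
  qed simp
  show ?case using step[of m] \<psi>(2) by (simp add: A_def)
qed simp

text \<open>The division is carried out in each component. Complex linearity of the derivative at
  the origin is flatness to order two.\<close>

lemma lift_holomorphic_direction:
  fixes \<psi> :: "complex ^ 'n::finite \<Rightarrow> complex ^ 'n"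
  assumes S: "open S" "0 \<in> S" and \<psi>: "smooth_on S \<psi>" and pz: "\<And>m l. flat_bar m (\<lambda>z. \<psi> z $ l)"
  shows "\<exists>H. smooth_on (aff_base i -` S) H \<and>
      (\<forall>u\<in>aff_base i -` S. \<psi> (aff_base i u) = (u $ i) *s H u \<and>
        (u $ i = 0 \<longrightarrow> H u = frechet_derivative \<psi> (at 0) (aff_dir i u)))"
    and "frechet_derivative \<psi> (at 0) (t *s v) = t *s frechet_derivative \<psi> (at 0) v"
proof -
  note D = smooth_on_has_derivative[OF \<psi> S(2)]
  have sm: "smooth_on S (\<lambda>z. \<psi> z $ l)" for l by (rule smooth_on_vec_nth[OF S(1) \<psi>])
  have Dl: "frechet_derivative (\<lambda>z. \<psi> z $ l) (at 0) v = frechet_derivative \<psi> (at 0) v $ l" for l v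
    using fun_cong[OF frechet_derivative_at[OF bounded_linear.has_derivative[OF bounded_linear_vec_nth D]]] by simp
  define H where "H u = (\<chi> l. if u $ i = 0 then frechet_derivative (\<lambda>z. \<psi> z $ l) (at 0) (aff_dir i u)
     else \<psi> (aff_base i u) $ l / u $ i)" for u
  have "smooth_on (aff_base i -` S) H"
    unfolding H_def[abs_def]
    by (intro smooth_on_vec_lambda open_aff_base_vimage S smooth_on_divide_exceptional[OF S sm pz])
  moreover have "\<psi> 0 = 0" using pz[of 1] by (simp add: vec_eq_iff)
  then have "\<psi> (aff_base i u) = (u $ i) *s H u \<and>
      (u $ i = 0 \<longrightarrow> H u = frechet_derivative \<psi> (at 0) (aff_dir i u))" for u
    by (auto simp: H_def vec_eq_iff Dl aff_base_eq_0_iff[THEN iffD2])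
  ultimately show "\<exists>H. smooth_on (aff_base i -` S) H \<and>
      (\<forall>u\<in>aff_base i -` S. \<psi> (aff_base i u) = (u $ i) *s H u \<and>
        (u $ i = 0 \<longrightarrow> H u = frechet_derivative \<psi> (at 0) (aff_dir i u)))" by blast
  have "alin (frechet_derivative \<psi> (at 0)) v l = 0" for v l
    using pz[of "Suc (Suc 0)" l] alin_frechet(1)[OF \<psi> S(2)] by simp
  from alin_eq_0_imp_smult[OF has_derivative_linear[OF D] this]
  show "frechet_derivative \<psi> (at 0) (t *s v) = t *s frechet_derivative \<psi> (at 0) v" .
qed

section \<open>The line through which the lifted map passes\<close>

lemma cline_one_dim:
  fixes v :: "complex ^ 'n::finite"
  assumes "\<And>i j :: 'n. i = j" "v \<noteq> 0"
  shows "cline v = UNIV"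
proof -
  obtain i where i: "v $ i \<noteq> 0" using assms(2) by (auto simp: vec_eq_iff)
  have "w = (w $ i / v $ i) *s v" for w
    using i by (simp add: vec_eq_iff) (metis assms(1) nonzero_eq_divide_eq)
  then show ?thesis unfolding cline_def by blast
qed

text \<open>Only the line of \<open>K i u\<close> is prescribed, so \<open>K\<close> is determined
  up to a scalar function. This freedom accommodates dimension one and opposite signs in the same
  statement.\<close>

lemma lift_direction:
  fixes \<psi> :: "complex ^ 'n::finite \<Rightarrow> complex ^ 'n"
  assumes S: "open S" "0 \<in> S" and \<psi>: "smooth_on S \<psi>" "\<psi> 0 = 0" "inj_on \<psi> S"
    and d\<psi>: "\<And>v. frechet_derivative \<psi> (at 0) v = 0 \<Longrightarrow> v = 0"
    and U: "open U" "\<psi> ` S \<subseteq> U"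
    and J1: "smooth_field S J1" "\<And>i. lifts_to_blowup i S J1" "\<And>v. J1 0 (J1 0 v) = - v"
    and J2: "smooth_field U J2" "\<And>i. lifts_to_blowup i U J2" "\<And>v. J2 0 (J2 0 v) = - v"
    and eq: "\<And>z v. z \<in> S \<Longrightarrow> J2 (\<psi> z) (frechet_derivative \<psi> (at z) v) = frechet_derivative \<psi> (at z) (J1 z v)"
  shows "\<exists>K. \<forall>i. smooth_on (aff_base i -` S) (K i) \<and> (\<forall>u\<in>aff_base i -` S. K i u \<noteq> 0 \<and>
      cline (K i u) = cline (if u $ i = 0 then frechet_derivative \<psi> (at 0) (aff_dir i u) else \<psi> (aff_base i u)))"
    and "t \<noteq> 0 \<Longrightarrow> cline (frechet_derivative \<psi> (at 0) (t *s v)) = cline (frechet_derivative \<psi> (at 0) v)"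
proof -
  let ?D = "frechet_derivative \<psi> (at 0)"
  have "(\<exists>K. \<forall>i. smooth_on (aff_base i -` S) (K i) \<and> (\<forall>u\<in>aff_base i -` S. K i u \<noteq> 0 \<and>
      cline (K i u) = cline (if u $ i = 0 then ?D (aff_dir i u) else \<psi> (aff_base i u)))) \<and>
    (\<forall>t v. t \<noteq> 0 \<longrightarrow> cline (?D (t *s v)) = cline (?D v))"
  proof (cases "\<forall>i j :: 'n. i = j")
    case True
    then have one: "\<And>i j :: 'n. i = j" by blast
    have nz: "(if u $ i = 0 then ?D (aff_dir i u) else \<psi> (aff_base i u)) \<noteq> 0"
      if "u \<in> aff_base i -` S" for i u
      using d\<psi>[of "aff_dir i u"] inj_onD[OF \<psi>(3), of "aff_base i u" 0] that \<psi>(2) S(2) aff_base_eq_0_iff[of i u] by auto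
    have "cline (?D (t *s v)) = cline (?D v)" if "t \<noteq> 0" for t v
    proof (cases "v = 0")
      case False
      then show ?thesis using d\<psi>[of v] d\<psi>[of "t *s v"] that cline_one_dim[OF one] by force
    qed simp
    \<comment> \<open>In dimension one every nonzero vector spans the only line, so
      \<open>aff_dir i\<close> will do.\<close>
    moreover have "\<forall>i. smooth_on (aff_base i -` S) (aff_dir i) \<and> (\<forall>u\<in>aff_base i -` S. aff_dir i u \<noteq> 0 \<and>
      cline (aff_dir i u) = cline (if u $ i = 0 then ?D (aff_dir i u) else \<psi> (aff_base i u)))"
      using nz cline_one_dim[OF one] by (auto intro!: smooth_on_aff_dir open_aff_base_vimage S simp del: if_split)
    ultimately show ?thesis by blast
  next
    case False
    then obtain i0 j0 :: 'n where ij: "j0 \<noteq> i0" by blast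
    have other: "\<exists>j. j \<noteq> i" for i :: 'n using ij by metis
    have U0: "0 \<in> U" using U(2) S(2) \<psi>(2) by force
    obtain a1 where a1: "a1 \<in> {\<i>, - \<i>}" "\<And>v. J1 0 v = a1 *s v"
      using lift_at_origin[OF S J1(1,2) ij J1(3)] by blast
    obtain a2 where a2: "a2 \<in> {\<i>, - \<i>}" "\<And>v. J2 0 v = a2 *s v"
      using lift_at_origin[OF U(1) U0 J2(1,2) ij J2(3)] by blast
    have pz1: "flat_bar m (\<lambda>z. alin (J1 z) e l)" for m e l by (rule flat_bar_alin_of_lift[OF S J1(1,2) ij])
    have pz2: "flat_bar m (\<lambda>z. alin (J2 z) e l)" for m e l by (rule flat_bar_alin_of_lift[OF U(1) U0 J2(1,2) ij])
    have a: "a1 \<noteq> 0" "cnj a1 = - a1" using a1(1) by auto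
    have cline_smult: "cline (c *s w) = cline w" if "c \<noteq> 0" for c and w :: "complex ^ 'n" by (rule cline_scale[OF that])
    have nz\<psi>: "\<psi> (aff_base i u) \<noteq> 0" if "u \<in> aff_base i -` S" "u $ i \<noteq> 0" for i u
      using inj_onD[OF \<psi>(3), of "aff_base i u" 0] that \<psi>(2) S(2) aff_base_eq_0_iff[of i u] by auto
    show ?thesis
    proof (cases "a1 = a2")
      case True
      have pz: "flat_bar m (\<lambda>z. \<psi> z $ l)" for m l
        by (rule flat_bar_pseudoholomorphic[OF S \<psi>(1,2) U J1(1) a1(2) pz1 J2(1) _ pz2 a eq]) (simp add: a2 True)
      note lift = lift_holomorphic_direction[OF S \<psi>(1) pz]
      obtain K where K: "\<And>i. smooth_on (aff_base i -` S) (K i)"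
        "\<And>i u. u \<in> aff_base i -` S \<Longrightarrow> \<psi> (aff_base i u) = (u $ i) *s K i u"
        "\<And>i u. u \<in> aff_base i -` S \<Longrightarrow> u $ i = 0 \<Longrightarrow> K i u = ?D (aff_dir i u)"
        using lift(1) by metis
      have "K i u \<noteq> 0 \<and> cline (K i u) = cline (if u $ i = 0 then ?D (aff_dir i u) else \<psi> (aff_base i u))"
        if u: "u \<in> aff_base i -` S" for i u
        using K(2,3)[OF u] nz\<psi>[OF u] d\<psi>[of "aff_dir i u"] by (cases "u $ i = 0") (auto simp: cline_smult)
      then show ?thesis using K(1) lift(2) cline_smult by metis
    next
      case False
      then have a2': "a2 = - a1" using a1(1) a2(1) by auto
      \<comment> \<open>For opposite signs, the conjugate of \<open>\<psi>\<close> intertwines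
        \<open>J1\<close> with the conjugated structure, whose scalar at the origin is
        \<open>cnj a2 = a1\<close>.\<close>
      define \<psi>c where "\<psi>c z = vcnj (\<psi> z)" for z
      define J2c where "J2c z v = vcnj (J2 (vcnj z) (vcnj v))" for z v
      let ?U = "vcnj -` U"
      have cont: "continuous_on A vcnj" for A by (rule linear_continuous_on[OF bounded_linear_vcnj])
      have Uc: "open ?U" "\<psi>c ` S \<subseteq> ?U"
        using open_vimage[OF U(1) cont] U(2) by (auto simp: \<psi>c_def)
      have \<psi>c: "smooth_on S \<psi>c" "\<psi>c 0 = 0"
        unfolding \<psi>c_def[abs_def] using smooth_on_bounded_linear_compose[OF bounded_linear_vcnj S(1) \<psi>(1)] \<psi>(2) by auto
      have Dc: "frechet_derivative \<psi>c (at z) v = vcnj (frechet_derivative \<psi> (at z) v)" if "z \<in> S" for z v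
        unfolding \<psi>c_def[abs_def]
        using fun_cong[OF frechet_derivative_at[OF bounded_linear.has_derivative[OF bounded_linear_vcnj smooth_on_has_derivative[OF \<psi>(1) that]]]]
        by simp
      have linc: "linear vcnj" by (rule bounded_linear.linear[OF bounded_linear_vcnj])
      have J2c: "smooth_field ?U J2c"
        unfolding smooth_field_def
      proof (intro conjI ballI allI)
        fix z assume "z \<in> ?U"
        then have "linear (J2 (vcnj z))" using J2(1) by (simp add: smooth_field_def)
        from linear_compose[OF linear_compose[OF linc this] linc] show "linear (J2c z)"
          by (simp add: J2c_def[abs_def] o_def)
      next
        fix e
        have "smooth_on U (\<lambda>z. J2 z (vcnj e))" using J2(1) by (simp add: smooth_field_def)
        from smooth_on_compose[OF Uc(1) U(1) this smooth_on_bounded_linear[OF bounded_linear_vcnj]]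
        have "smooth_on ?U (\<lambda>z. J2 (vcnj z) (vcnj e))" by auto
        from smooth_on_bounded_linear_compose[OF bounded_linear_vcnj Uc(1) this]
        show "smooth_on ?U (\<lambda>z. J2c z e)" by (simp add: J2c_def)
      qed
      have pz2c: "flat_bar m (\<lambda>z. alin (J2c z) e l)" for m e l
      proof -
        have alin_c: "alin (J2c z) e l = cnj (alin (J2 (vcnj z)) (vcnj e) l)" if "z \<in> ?U" for z
        proof -
          have "linear (J2 (vcnj z))" using J2(1) that by (simp add: smooth_field_def)
          from linear_neg[OF this] show ?thesis by (simp add: alin_def J2c_def)
        qed
        have "flat_bar m (\<lambda>z. cnj (alin (J2 (vcnj z)) (vcnj e) l))"
          by (rule flat_bar_vcnj[OF U(1) U0 smooth_field_alin(1)[OF U(1) J2(1)] pz2])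
        moreover have "0 \<in> ?U" using U0 by simp
        then have "flat_bar m (\<lambda>z. alin (J2c z) e l) \<longleftrightarrow> flat_bar m (\<lambda>z. cnj (alin (J2 (vcnj z)) (vcnj e) l))"
          by (rule flat_bar_cong[OF Uc(1) _ alin_c])
        ultimately show ?thesis by (rule iffD2[rotated])
      qed
      have eqc: "J2c (\<psi>c z) (frechet_derivative \<psi>c (at z) v) = frechet_derivative \<psi>c (at z) (J1 z v)"
        if "z \<in> S" for z v
        unfolding Dc[OF that] J2c_def \<psi>c_def by (simp add: eq[OF that])
      have J2c0: "J2c 0 v = a1 *s v" for v using a by (simp add: J2c_def a2 a2')
      have pz: "flat_bar m (\<lambda>z. \<psi>c z $ l)" for m l
        by (rule flat_bar_pseudoholomorphic[OF S \<psi>c Uc J1(1) a1(2) pz1 J2c J2c0 pz2c a eqc])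
      note lift = lift_holomorphic_direction[OF S \<psi>c(1) pz]
      have "\<forall>i. \<exists>H. smooth_on (aff_base i -` S) H \<and>
        (\<forall>u\<in>aff_base i -` S. \<psi>c (aff_base i u) = (u $ i) *s H u \<and>
          (u $ i = 0 \<longrightarrow> H u = frechet_derivative \<psi>c (at 0) (aff_dir i u)))"
        by (intro allI lift(1))
      from choice[OF this] obtain K where "\<forall>i. smooth_on (aff_base i -` S) (K i) \<and>
        (\<forall>u\<in>aff_base i -` S. \<psi>c (aff_base i u) = (u $ i) *s K i u \<and>
          (u $ i = 0 \<longrightarrow> K i u = frechet_derivative \<psi>c (at 0) (aff_dir i u)))"
        by (elim exE)
      then have K: "\<And>i. smooth_on (aff_base i -` S) (K i)"
        "\<And>i u. u \<in> aff_base i -` S \<Longrightarrow> \<psi>c (aff_base i u) = (u $ i) *s K i u"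
        "\<And>i u. u \<in> aff_base i -` S \<Longrightarrow> u $ i = 0 \<Longrightarrow> K i u = vcnj (?D (aff_dir i u))"
        using Dc[OF S(2)] by auto
      have smK: "smooth_on (aff_base i -` S) (\<lambda>u. vcnj (K i u))" for i
        by (rule smooth_on_bounded_linear_compose[OF bounded_linear_vcnj open_aff_base_vimage[OF S(1)] K(1)])
      have "vcnj (K i u) \<noteq> 0 \<and> cline (vcnj (K i u)) = cline (if u $ i = 0 then ?D (aff_dir i u) else \<psi> (aff_base i u))"
        if u: "u \<in> aff_base i -` S" for i u
      proof -
        have "\<psi> (aff_base i u) = vcnj (\<psi>c (aff_base i u))" by (simp add: \<psi>c_def)
        \<comment> \<open>Here \<open>\<psi>\<close> is divisible by the conjugate of
          \<open>u $ i\<close>. Off the divisor this is a nonzero scalar too, so the line is that of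
          \<open>vcnj (K i u)\<close>.\<close>
        then have "\<psi> (aff_base i u) = cnj (u $ i) *s vcnj (K i u)" by (simp add: K(2)[OF u])
        then show ?thesis
          using K(3)[OF u] nz\<psi>[OF u] d\<psi>[of "aff_dir i u"] by (cases "u $ i = 0") (auto simp: cline_smult)
      qed
      moreover have "?D (t *s v) = cnj t *s ?D v" for t v
      proof -
        have "vcnj (?D (t *s v)) = t *s vcnj (?D v)" using lift(2)[of t v] by (simp only: Dc[OF S(2)])
        then have "vcnj (vcnj (?D (t *s v))) = vcnj (t *s vcnj (?D v))" by simp
        then show ?thesis by simp
      qed
      then have "\<forall>t v. t \<noteq> 0 \<longrightarrow> cline (?D (t *s v)) = cline (?D v)" by (simp add: cline_smult)
      ultimately show ?thesis using smK by (intro conjI exI[of _ "\<lambda>i u. vcnj (K i u)"]) auto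
    qed
  qed
  then show "\<exists>K. \<forall>i. smooth_on (aff_base i -` S) (K i) \<and> (\<forall>u\<in>aff_base i -` S. K i u \<noteq> 0 \<and>
      cline (K i u) = cline (if u $ i = 0 then ?D (aff_dir i u) else \<psi> (aff_base i u)))"
    and "t \<noteq> 0 \<Longrightarrow> cline (?D (t *s v)) = cline (?D v)" by blast+
qed

subsection \<open>Local representatives and differentials\<close>

definition lrep :: "('a, 'n::finite) chart \<Rightarrow> ('b, 'm::finite) chart \<Rightarrow> ('a \<Rightarrow> 'b) \<Rightarrow> complex ^ 'n \<Rightarrow> complex ^ 'm"
  where "lrep c d f z = coord d (f (snd c z))"

definition ldom :: "('a, 'n::finite) chart \<Rightarrow> ('b, 'm::finite) chart \<Rightarrow> ('a \<Rightarrow> 'b) \<Rightarrow> (complex ^ 'n) set"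
  where "ldom c d f = {z \<in> fst c. f (snd c z) \<in> cdom d}"

abbreviation dlrep where "dlrep c d f z \<equiv> frechet_derivative (lrep c d f) (at z)"

text \<open>The compatibility of charts in \<open>smooth_manifold\<close>, separated so that it can
  be established for the blow-up.\<close>

definition smooth_atlas :: "('a, 'n::finite) atlas \<Rightarrow> bool"
  where "smooth_atlas A \<longleftrightarrow> (\<forall>c\<in>A. smooth_chart A c)"

lemma lrep_eq: "coord d \<circ> f \<circ> snd c = lrep c d f" "fst c \<inter> (f \<circ> snd c) -` cdom d = ldom c d f"
  by (auto simp: lrep_def ldom_def)

lemma lrep_id_eq: "coord d \<circ> snd c = lrep c d (\<lambda>x. x)" "fst c \<inter> snd c -` cdom d = ldom c d (\<lambda>x. x)"
  by (auto simp: lrep_def ldom_def)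

lemmas lrep_eqs = lrep_eq lrep_id_eq

lemma smooth_chartD:
  assumes "smooth_chart A c"
  shows "open (fst c)" "inj_on (snd c) (fst c)" "cdom c \<subseteq> points A"
    "d \<in> A \<Longrightarrow> open (ldom c d (\<lambda>x. x))" "d \<in> A \<Longrightarrow> smooth_on (ldom c d (\<lambda>x. x)) (lrep c d (\<lambda>x. x))"
    "d \<in> A \<Longrightarrow> open (ldom d c (\<lambda>x. x))" "d \<in> A \<Longrightarrow> smooth_on (ldom d c (\<lambda>x. x)) (lrep d c (\<lambda>x. x))"
  using assms unfolding smooth_chart_def smooth_transition_def lrep_eqs by auto

lemma coord_snd: "inj_on (snd c) (fst c) \<Longrightarrow> z \<in> fst c \<Longrightarrow> coord c (snd c z) = z"
  by (simp add: coord_def the_inv_into_f_f)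

lemma snd_coord:
  assumes "inj_on (snd c) (fst c)" "p \<in> cdom c"
  shows "snd c (coord c p) = p" "coord c p \<in> fst c"
  using assms by (auto simp: cdom_def coord_snd)

lemma snd_in_cdom [intro]: "z \<in> fst c \<Longrightarrow> snd c z \<in> cdom c"
  by (simp add: cdom_def)

lemma pointsE:
  assumes "p \<in> points A" obtains c where "c \<in> A" "p \<in> cdom c"
  using assms by (auto simp: points_def)

lemma smooth_map_iff:
  "smooth_map A B f \<longleftrightarrow> f ` points A \<subseteq> points B \<and>
    (\<forall>c\<in>A. \<forall>d\<in>B. open (ldom c d f) \<and> smooth_on (ldom c d f) (lrep c d f))"
  unfolding smooth_map_def lrep_eqs ..

lemma smooth_map_id: "smooth_atlas A \<Longrightarrow> smooth_map A A (\<lambda>x. x)"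
  using smooth_chartD(4,5) by (fastforce simp: smooth_map_iff smooth_atlas_def)

lemma open_Int_vimage_smooth: "open S \<Longrightarrow> smooth_on S h \<Longrightarrow> open T \<Longrightarrow> open (S \<inter> h -` T)"
  by (rule continuous_open_preimage[OF smooth_on_continuous])

text \<open>\<open>smooth_map\<close> tests the charts of the two atlases. Near each point, a
  representative in charts of the maximal atlases factors through charts \<open>a\<close> and
  \<open>b\<close> of the given ones.\<close>

lemma smooth_map_charts:
  assumes A: "smooth_atlas A" and B: "smooth_atlas B" and f: "smooth_map A B f"
    and c: "smooth_chart A c" and d: "smooth_chart B d"
  shows "open (ldom c d f)" "smooth_on (ldom c d f) (lrep c d f)"
proof -
  have nbhd: "\<exists>N. open N \<and> z \<in> N \<and> N \<subseteq> ldom c d f \<and> smooth_on N (lrep c d f)" if z: "z \<in> ldom c d f" for z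
  proof -
    have "snd c z \<in> points A" "f (snd c z) \<in> points B"
      using z smooth_chartD(3)[OF c] smooth_chartD(3)[OF d] by (auto simp: ldom_def)
    then obtain a b where a: "a \<in> A" "snd c z \<in> cdom a" and b: "b \<in> B" "f (snd c z) \<in> cdom b"
      by (meson pointsE)
    have sa: "smooth_chart A a" and sb: "smooth_chart B b"
      using A B a b by (auto simp: smooth_atlas_def)
    note inj = smooth_chartD(2)[OF sa] smooth_chartD(2)[OF sb]
    have fab: "open (ldom a b f)" "smooth_on (ldom a b f) (lrep a b f)"
      using f a b by (auto simp: smooth_map_iff)
    let ?id = "\<lambda>x. x"
    define M where "M = ldom a b f \<inter> lrep a b f -` ldom b d ?id"
    define N where "N = ldom c a ?id \<inter> lrep c a ?id -` M"
    have M: "open M" unfolding M_def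
      by (rule open_Int_vimage_smooth[OF fab smooth_chartD(6)[OF d b(1)]])
    have N: "open N" unfolding N_def
      by (rule open_Int_vimage_smooth[OF smooth_chartD(4,5)[OF c a(1)] M])
    have eq: "lrep b d ?id (lrep a b f y) = lrep a d f y" if "y \<in> M" for y
      using that snd_coord[OF inj(2)] by (auto simp: M_def ldom_def lrep_def)
    have smM: "smooth_on M (\<lambda>y. lrep b d ?id (lrep a b f y))"
      by (rule smooth_on_compose[OF M smooth_chartD(6,7)[OF d b(1)] smooth_on_subset[OF fab(2)]])
         (auto simp: M_def)
    have smN: "smooth_on N (\<lambda>y. lrep b d ?id (lrep a b f (lrep c a ?id y)))"
      by (rule smooth_on_compose[OF N M smM smooth_on_subset[OF smooth_chartD(5)[OF c a(1)]]])
         (auto simp: N_def)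
    have eq2: "lrep c d f y = lrep b d ?id (lrep a b f (lrep c a ?id y))" if "y \<in> N" for y
    proof -
      have "lrep c a ?id y \<in> M" "snd a (lrep c a ?id y) = snd c y"
        using that snd_coord[OF inj(1)] by (auto simp: N_def ldom_def lrep_def)
      then show ?thesis using eq by (simp add: lrep_def[of c d] lrep_def[of a d])
    qed
    have "smooth_on N (lrep c d f)"
      using smN by (subst smooth_on_open_cong[OF N eq2])
    moreover have "N \<subseteq> ldom c d f"
      using snd_coord[OF inj(1)] snd_coord[OF inj(2)]
      by (auto simp: N_def M_def ldom_def lrep_def)
    moreover have "z \<in> N"
      using z a b snd_coord[OF inj(1)] snd_coord[OF inj(2)] by (auto simp: N_def M_def ldom_def lrep_def)
    ultimately show ?thesis using N by blast
  qed
  show "open (ldom c d f)" using nbhd by (subst open_subopen) blast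
  show "smooth_on (ldom c d f) (lrep c d f)" using nbhd by (intro smooth_on_local) blast
qed

lemma chain_dlrep:
  assumes atl: "smooth_atlas A" "smooth_atlas B" "smooth_atlas C"
    and h: "smooth_map A B h" and k: "smooth_map B C k"
    and c: "smooth_chart A c" and d: "smooth_chart B d" and e: "smooth_chart C e"
    and z: "z \<in> ldom c d h" "lrep c d h z \<in> ldom d e k"
  shows "dlrep c e (\<lambda>x. k (h x)) z v = dlrep d e k (lrep c d h z) (dlrep c d h z v)"
proof -
  note hh = smooth_map_charts[OF atl(1,2) h c d] and kk = smooth_map_charts[OF atl(2,3) k d e]
  let ?N = "ldom c d h \<inter> lrep c d h -` ldom d e k"
  have N: "open ?N" by (rule open_Int_vimage_smooth[OF hh kk(1)])
  have eq: "lrep d e k (lrep c d h y) = lrep c e (\<lambda>x. k (h x)) y" if "y \<in> ?N" for y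
    using that snd_coord[OF smooth_chartD(2)[OF d]] by (auto simp: ldom_def lrep_def)
  have "((\<lambda>y. lrep d e k (lrep c d h y)) has_derivative
      (\<lambda>v. dlrep d e k (lrep c d h z) (dlrep c d h z v))) (at z)"
    by (rule has_derivative_compose[OF smooth_on_has_derivative[OF hh(2) z(1)] smooth_on_has_derivative[OF kk(2) z(2)]])
  then have "(lrep c e (\<lambda>x. k (h x)) has_derivative
      (\<lambda>v. dlrep d e k (lrep c d h z) (dlrep c d h z v))) (at z)"
    by (rule has_derivative_transform_within_open[OF _ N _ eq]) (use z in auto)
  from frechet_derivative_at[OF this] show ?thesis by (metis (no_types))
qed

lemma dlrep_id:
  assumes "smooth_chart A c" "z \<in> fst c"
  shows "dlrep c c (\<lambda>x. x) z v = v"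
proof -
  have "((\<lambda>y. y) has_derivative (\<lambda>v. v)) (at z)" by (rule has_derivative_ident)
  then have "(lrep c c (\<lambda>x. x) has_derivative (\<lambda>v. v)) (at z)"
    by (rule has_derivative_transform_within_open[OF _ smooth_chartD(1)[OF assms(1)] assms(2)])
       (simp add: lrep_def coord_snd[OF smooth_chartD(2)[OF assms(1)]])
  from frechet_derivative_at[OF this] show ?thesis by metis
qed

lemma lrep_in_ldom:
  assumes "smooth_chart B d" "z \<in> ldom c d h" "k (h (snd c z)) \<in> cdom e"
  shows "lrep c d h z \<in> ldom d e k" "snd d (lrep c d h z) = h (snd c z)" "lrep c d h z \<in> fst d"
  using assms snd_coord[OF smooth_chartD(2)[OF assms(1)]] by (auto simp: ldom_def lrep_def)

context
  fixes A :: "('a, 'n::finite) atlas"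
  assumes A: "smooth_atlas A"
begin

lemma atlas_chart: "c \<in> A \<Longrightarrow> smooth_chart A c"
  using A by (simp add: smooth_atlas_def)

lemma dchart_eq:
  "dchart A c z e = (\<lambda>d. if d \<in> charts_at A (snd c z) then dlrep c d (\<lambda>x. x) z e else 0)"
  unfolding dchart_def lrep_eqs ..

lemma dchart_self: "c \<in> A \<Longrightarrow> z \<in> fst c \<Longrightarrow> dchart A c z e c = e"
  using dlrep_id[OF atlas_chart] by (auto simp: dchart_eq charts_at_def)

lemma dchart_chart:
  assumes c: "smooth_chart A c" and d: "smooth_chart A d" and z: "z \<in> ldom c d (\<lambda>x. x)"
  shows "dchart A d (lrep c d (\<lambda>x. x) z) (dlrep c d (\<lambda>x. x) z e) = dchart A c z e"
proof
  fix a
  have sz: "snd d (lrep c d (\<lambda>x. x) z) = snd c z"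
    using z snd_coord[OF smooth_chartD(2)[OF d]] by (simp add: ldom_def lrep_def)
  show "dchart A d (lrep c d (\<lambda>x. x) z) (dlrep c d (\<lambda>x. x) z e) a = dchart A c z e a"
  proof (cases "a \<in> charts_at A (snd c z)")
    case True
    then have a: "a \<in> A" "snd c z \<in> cdom a" by (auto simp: charts_at_def)
    have "lrep c d (\<lambda>x. x) z \<in> ldom d a (\<lambda>x. x)"
      using lrep_in_ldom(1)[OF d z, of "\<lambda>x. x" a] a by simp
    from chain_dlrep[OF A A A smooth_map_id[OF A] smooth_map_id[OF A] c d atlas_chart[OF a(1)] z this]
    show ?thesis by (simp add: dchart_eq sz True)
  qed (simp add: dchart_eq sz)
qed

lemma dchart_in_tangent_space:
  assumes c: "smooth_chart A c" and z: "z \<in> fst c"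
  shows "dchart A c z e \<in> tangent_space A (snd c z)"
proof -
  have trans: "dchart A c z e b = frechet_derivative (coord b \<circ> snd a) (at (coord a (snd c z))) (dchart A c z e a)"
    if ab: "a \<in> charts_at A (snd c z)" "b \<in> charts_at A (snd c z)" for a b
  proof -
    have a: "a \<in> A" "smooth_chart A a" "z \<in> ldom c a (\<lambda>x. x)"
      using ab z atlas_chart by (auto simp: charts_at_def ldom_def)
    have "snd a (lrep c a (\<lambda>x. x) z) = snd c z"
      using a(3) snd_coord[OF smooth_chartD(2)[OF a(2)]] by (simp add: ldom_def lrep_def)
    with fun_cong[OF dchart_chart[OF c a(2,3), of e], of b] ab show ?thesis
      unfolding lrep_eqs by (simp add: dchart_eq lrep_def[of c a])
  qed
  have "dchart A c z e b = 0" if "b \<notin> charts_at A (snd c z)" for b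
    using that by (simp add: dchart_eq)
  then show ?thesis unfolding tangent_space_def using trans by blast
qed

text \<open>Together with \<open>dchart_in_tangent_space\<close> and \<open>dchart_inj\<close> this
  makes \<open>dchart A c z\<close> a bijection from coordinate vectors onto the tangent space, by
  which pointwise statements are reduced to coordinates.\<close>

lemma tangent_space_dchart:
  assumes c: "smooth_chart A c" and z: "z \<in> fst c" and v: "v \<in> tangent_space A (snd c z)"
  shows "\<exists>e. v = dchart A c z e"
proof -
  have "snd c z \<in> points A" using smooth_chartD(3)[OF c] z by auto
  then obtain a where a: "a \<in> A" "snd c z \<in> cdom a" by (rule pointsE)
  then have aa: "a \<in> charts_at A (snd c z)" by (simp add: charts_at_def)
  note sa = atlas_chart[OF a(1)]
  let ?y = "coord a (snd c z)"
  have y: "?y \<in> fst a" "snd a ?y = snd c z" using snd_coord[OF smooth_chartD(2)[OF sa] a(2)] by auto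
  have v_eq: "v = dchart A a ?y (v a)"
  proof
    fix b
    show "v b = dchart A a ?y (v a) b"
    proof (cases "b \<in> charts_at A (snd c z)")
      case True
      have "v b = frechet_derivative (coord b \<circ> snd a) (at ?y) (v a)"
        using v aa True unfolding tangent_space_def by blast
      with True show ?thesis unfolding lrep_id_eq by (simp only: dchart_eq y(2) if_True)
    next
      case False
      then have "v b = 0" using v unfolding tangent_space_def by blast
      with False show ?thesis by (simp only: dchart_eq y(2) if_False)
    qed
  qed
  have "?y \<in> ldom a c (\<lambda>x. x)" using y z by (auto simp: ldom_def)
  from dchart_chart[OF sa c this] have "v = dchart A c (lrep a c (\<lambda>x. x) ?y) (dlrep a c (\<lambda>x. x) ?y (v a))"
    using v_eq by simp
  moreover have "lrep a c (\<lambda>x. x) ?y = z"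
    using y z coord_snd[OF smooth_chartD(2)[OF c]] by (simp add: lrep_def)
  ultimately show ?thesis by auto
qed

lemma dchart_inj:
  assumes c: "smooth_chart A c" and z: "z \<in> fst c" and eq: "dchart A c z e = dchart A c z e'"
  shows "e = e'"
proof -
  have "snd c z \<in> points A" using smooth_chartD(3)[OF c] z by auto
  then obtain a where a: "a \<in> A" "snd c z \<in> cdom a" by (rule pointsE)
  note sa = atlas_chart[OF a(1)]
  have za: "z \<in> ldom c a (\<lambda>x. x)" using a z by (simp add: ldom_def)
  have zc: "lrep c a (\<lambda>x. x) z \<in> ldom a c (\<lambda>x. x)" using lrep_in_ldom(1)[OF sa za, of "\<lambda>x. x" c] z by auto
  have "e = dlrep a c (\<lambda>x. x) (lrep c a (\<lambda>x. x) z) (dchart A c z e a)" for e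
    using chain_dlrep[OF A A A smooth_map_id[OF A] smooth_map_id[OF A] c sa c za zc, of e] a
    by (simp add: dchart_eq charts_at_def dlrep_id[OF c z])
  then show ?thesis using eq by metis
qed

lemma linear_dlrep_id:
  assumes "smooth_chart A c" "smooth_chart A d" "z \<in> ldom c d (\<lambda>x. x)"
  shows "linear (dlrep c d (\<lambda>x. x) z)"
  using smooth_on_has_derivative[OF smooth_map_charts(2)[OF A A smooth_map_id[OF A] assms(1,2)] assms(3)]
  by (rule has_derivative_linear)

lemma lincomb_dchart:
  assumes c: "smooth_chart A c" and z: "z \<in> fst c"
  shows "lincomb a (dchart A c z e) b (dchart A c z e') = dchart A c z (a *\<^sub>R e + b *\<^sub>R e')"
proof
  fix d
  show "lincomb a (dchart A c z e) b (dchart A c z e') d = dchart A c z (a *\<^sub>R e + b *\<^sub>R e') d"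
  proof (cases "d \<in> charts_at A (snd c z)")
    case True
    then have "linear (dlrep c d (\<lambda>x. x) z)"
      using z by (intro linear_dlrep_id[OF c atlas_chart]) (auto simp: charts_at_def ldom_def)
    from linear_add[OF this] linear_scale[OF this] True show ?thesis by (simp add: lincomb_def dchart_eq)
  qed (simp add: lincomb_def dchart_eq)
qed

end

text \<open>The chain rule, applied through the chart \<open>c0\<close> selected inside
  \<open>differential\<close> and through \<open>d\<close>, removes the dependence on that
  selection.\<close>

lemma differential_dchart:
  assumes A: "smooth_atlas A" and B: "smooth_atlas B" and f: "smooth_map A B f"
    and c: "smooth_chart A c" and d: "smooth_chart B d" and z: "z \<in> ldom c d f"
  shows "differential A B f (snd c z) (dchart A c z e) = dchart B d (lrep c d f z) (dlrep c d f z e)"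
proof
  fix b
  have zc: "z \<in> fst c" using z by (simp add: ldom_def)
  have "snd c z \<in> points A" using smooth_chartD(3)[OF c] zc by auto
  then obtain a where "a \<in> A" "snd c z \<in> cdom a" by (rule pointsE)
  then have ex: "a \<in> charts_at A (snd c z)" by (simp add: charts_at_def)
  define c0 where "c0 = (SOME c0. c0 \<in> charts_at A (snd c z))"
  have "c0 \<in> charts_at A (snd c z)" unfolding c0_def by (rule someI[of "\<lambda>a. a \<in> charts_at A (snd c z)", OF ex])
  then have c0: "c0 \<in> A" "smooth_chart A c0" "z \<in> ldom c c0 (\<lambda>x. x)" "c0 \<in> charts_at A (snd c z)"
    using zc atlas_chart[OF A] by (auto simp: charts_at_def ldom_def)
  have sz: "snd d (lrep c d f z) = f (snd c z)" 
    using z snd_coord[OF smooth_chartD(2)[OF d]] by (simp add: ldom_def lrep_def)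
  show "differential A B f (snd c z) (dchart A c z e) b = dchart B d (lrep c d f z) (dlrep c d f z e) b"
  proof (cases "b \<in> charts_at B (f (snd c z))")
    case True
    then have b: "b \<in> B" "smooth_chart B b" "f (snd c z) \<in> cdom b"
      using atlas_chart[OF B] by (auto simp: charts_at_def)
    have 1: "lrep c c0 (\<lambda>x. x) z \<in> ldom c0 b f" "lrep c c0 (\<lambda>x. x) z = coord c0 (snd c z)"
      using lrep_in_ldom(1)[OF c0(2,3), of f b] b(3) by (auto simp: lrep_def)
    have 2: "lrep c d f z \<in> ldom d b (\<lambda>x. x)"
      using lrep_in_ldom(1)[OF d z, of "\<lambda>x. x" b] b(3) by auto
    have "differential A B f (snd c z) (dchart A c z e) b
      = dlrep c0 b f (coord c0 (snd c z)) (dlrep c c0 (\<lambda>x. x) z e)"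
      using True c0(4) unfolding differential_def lrep_eqs
      by (simp add: c0_def[symmetric] dchart_eq[OF A] Let_def)
    also have "\<dots> = dlrep c b f z e"
      using chain_dlrep[OF A A B smooth_map_id[OF A] f c c0(2) b(2) c0(3) 1(1), of e] 1(2) by simp
    also have "\<dots> = dlrep d b (\<lambda>x. x) (lrep c d f z) (dlrep c d f z e)"
      using chain_dlrep[OF A B B f smooth_map_id[OF B] c d b(2) z 2] .
    finally show ?thesis using True by (simp add: dchart_eq[OF B] sz)
  qed (simp add: differential_def dchart_eq[OF B] sz)
qed

lemma chart_point:
  assumes A: "smooth_atlas A" and p: "p \<in> points A"
  obtains c z where "c \<in> A" "smooth_chart A c" "z \<in> fst c" "snd c z = p"
proof -
  from p obtain c where c: "c \<in> A" "p \<in> cdom c" by (rule pointsE)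
  with snd_coord[OF smooth_chartD(2)[OF atlas_chart[OF A c(1)]] c(2)] atlas_chart[OF A c(1)]
  show thesis by (intro that[of c "coord c p"]) auto
qed

lemma smooth_map_points: "smooth_map A B f \<Longrightarrow> p \<in> points A \<Longrightarrow> f p \<in> points B"
  by (auto simp: smooth_map_def)

lemma differential_in_tangent_space:
  assumes A: "smooth_atlas A" and B: "smooth_atlas B" and f: "smooth_map A B f"
    and p: "p \<in> points A" and v: "v \<in> tangent_space A p"
  shows "differential A B f p v \<in> tangent_space B (f p)"
proof -
  obtain c z where c: "smooth_chart A c" "z \<in> fst c" "snd c z = p" by (rule chart_point[OF A p])
  obtain d y where d: "smooth_chart B d" "y \<in> fst d" "snd d y = f p"
    by (rule chart_point[OF B smooth_map_points[OF f p]])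
  obtain e where e: "v = dchart A c z e" using tangent_space_dchart[OF A c(1,2)] v c(3) by auto
  have z: "z \<in> ldom c d f" using c d by (auto simp: ldom_def cdom_def intro: image_eqI[of _ _ y])
  have "lrep c d f z = y" using c(3) d coord_snd[OF smooth_chartD(2)[OF d(1)]] by (metis lrep_def)
  with differential_dchart[OF A B f c(1) d(1) z, of e] dchart_in_tangent_space[OF B d(1,2)] d(3) c(3) e
  show ?thesis by metis
qed

lemma differential_compose:
  assumes A: "smooth_atlas A" and B: "smooth_atlas B" and C: "smooth_atlas C"
    and h: "smooth_map A B h" and k: "smooth_map B C k" and kh: "smooth_map A C (\<lambda>x. k (h x))"
    and p: "p \<in> points A" and v: "v \<in> tangent_space A p"
  shows "differential A C (\<lambda>x. k (h x)) p v = differential B C k (h p) (differential A B h p v)"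
proof -
  obtain c z where c: "smooth_chart A c" "z \<in> fst c" "snd c z = p" by (rule chart_point[OF A p])
  obtain d y where d: "smooth_chart B d" "y \<in> fst d" "snd d y = h p"
    by (rule chart_point[OF B smooth_map_points[OF h p]])
  obtain e x where e: "smooth_chart C e" "x \<in> fst e" "snd e x = k (h p)"
    by (rule chart_point[OF C smooth_map_points[OF k smooth_map_points[OF h p]]])
  obtain w where w: "v = dchart A c z w" using tangent_space_dchart[OF A c(1,2)] v c(3) by auto
  have hz: "h (snd c z) \<in> cdom d" "k (h (snd c z)) \<in> cdom e"
    using c(3) d(2,3) e(2,3) snd_in_cdom[of y d] snd_in_cdom[of x e] by auto
  have z: "z \<in> ldom c d h" "z \<in> ldom c e (\<lambda>x. k (h x))" using c(2) hz by (auto simp: ldom_def)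
  note y = lrep_in_ldom[where h=h and k=k, OF d(1) z(1) hz(2)]
  have "differential B C k (h p) (differential A B h p v)
      = differential B C k (snd d (lrep c d h z)) (dchart B d (lrep c d h z) (dlrep c d h z w))"
    using differential_dchart[OF A B h c(1) d(1) z(1), of w] w c(3) y(2) by simp
  also have "\<dots> = dchart C e (lrep d e k (lrep c d h z)) (dlrep d e k (lrep c d h z) (dlrep c d h z w))"
    by (rule differential_dchart[OF B C k d(1) e(1) y(1)])
  also have "lrep d e k (lrep c d h z) = lrep c e (\<lambda>x. k (h x)) z"
    using y(2) by (simp add: lrep_def[of d] lrep_def[of c e])
  also have "dlrep d e k (lrep c d h z) (dlrep c d h z w) = dlrep c e (\<lambda>x. k (h x)) z w"
    by (rule chain_dlrep[OF A B C h k c(1) d(1) e(1) z(1) y(1), symmetric])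
  also have "dchart C e (lrep c e (\<lambda>x. k (h x)) z) (dlrep c e (\<lambda>x. k (h x)) z w)
      = differential A C (\<lambda>x. k (h x)) p v"
    using differential_dchart[OF A C kh c(1) e(1) z(2), of w] w c(3) by simp
  finally show ?thesis ..
qed

lemma differential_lincomb:
  assumes A: "smooth_atlas A" and B: "smooth_atlas B" and f: "smooth_map A B f" and p: "p \<in> points A"
    and v: "v \<in> tangent_space A p" and w: "w \<in> tangent_space A p"
  shows "differential A B f p (lincomb a v b w) = lincomb a (differential A B f p v) b (differential A B f p w)"
proof -
  obtain c z where c: "smooth_chart A c" "z \<in> fst c" "snd c z = p" by (rule chart_point[OF A p])
  obtain d y where d: "smooth_chart B d" "y \<in> fst d" "snd d y = f p"
    by (rule chart_point[OF B smooth_map_points[OF f p]])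
  have z: "z \<in> ldom c d f" using c(2,3) d(2,3) snd_in_cdom[of y d] by (auto simp: ldom_def)
  have fz: "lrep c d f z \<in> fst d" using lrep_in_ldom(3)[where h=f and k="\<lambda>x. x" and e=d, OF d(1) z] z by (simp add: ldom_def)
  obtain e where e: "v = dchart A c z e" using tangent_space_dchart[OF A c(1,2)] v c(3) by auto
  obtain e' where e': "w = dchart A c z e'" using tangent_space_dchart[OF A c(1,2)] w c(3) by auto
  have lin: "linear (dlrep c d f z)"
    by (rule linear_frechet_derivative[OF smooth_on_differentiable[OF smooth_map_charts(2)[OF A B f c(1) d(1)] z]])
  note dd = differential_dchart[OF A B f c(1) d(1) z, unfolded c(3)]
  show ?thesis
    unfolding e e' dd lincomb_dchart[OF A c(1,2)] lincomb_dchart[OF B d(1) fz]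
    by (simp only: linear_add[OF lin] linear_scale[OF lin])
qed

lemma smooth_map_compose:
  assumes A: "smooth_atlas A" and B: "smooth_atlas B" and C: "smooth_atlas C"
    and h: "smooth_map A B h" and k: "smooth_map B C k"
  shows "smooth_map A C (\<lambda>x. k (h x))"
proof -
  have nbhd: "\<exists>N. open N \<and> z \<in> N \<and> N \<subseteq> ldom c e (\<lambda>x. k (h x)) \<and> smooth_on N (lrep c e (\<lambda>x. k (h x)))"
    if ce: "c \<in> A" "e \<in> C" and z: "z \<in> ldom c e (\<lambda>x. k (h x))" for c e z
  proof -
    have "snd c z \<in> points A" using z smooth_chartD(3)[OF atlas_chart[OF A ce(1)]] by (auto simp: ldom_def)
    then obtain d where d: "d \<in> B" "h (snd c z) \<in> cdom d"
      using pointsE smooth_map_points[OF h] by meson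
    note sc = atlas_chart[OF A ce(1)] and sd = atlas_chart[OF B d(1)] and se = atlas_chart[OF C ce(2)]
    note hh = smooth_map_charts[OF A B h sc sd] and kk = smooth_map_charts[OF B C k sd se]
    let ?N = "ldom c d h \<inter> lrep c d h -` ldom d e k"
    have N: "open ?N" by (rule open_Int_vimage_smooth[OF hh kk(1)])
    have eq: "lrep c e (\<lambda>x. k (h x)) y = lrep d e k (lrep c d h y)" if "y \<in> ?N" for y
      using that snd_coord[OF smooth_chartD(2)[OF sd]] by (auto simp: ldom_def lrep_def)
    have "smooth_on ?N (\<lambda>y. lrep d e k (lrep c d h y))"
      by (rule smooth_on_compose[OF N kk smooth_on_subset[OF hh(2)]]) auto
    then have "smooth_on ?N (lrep c e (\<lambda>x. k (h x)))" by (subst smooth_on_open_cong[OF N eq])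
    moreover have "?N \<subseteq> ldom c e (\<lambda>x. k (h x))" "z \<in> ?N"
      using z d snd_coord[OF smooth_chartD(2)[OF sd]] by (auto simp: ldom_def lrep_def)
    ultimately show ?thesis using N by blast
  qed
  have "open (ldom c e (\<lambda>x. k (h x)))" if "c \<in> A" "e \<in> C" for c e
    using nbhd[OF that] by (subst open_subopen) blast
  moreover have "smooth_on (ldom c e (\<lambda>x. k (h x))) (lrep c e (\<lambda>x. k (h x)))" if "c \<in> A" "e \<in> C" for c e
    using nbhd[OF that] by (intro smooth_on_local) blast
  ultimately show ?thesis
    using smooth_map_points[OF h] smooth_map_points[OF k] by (auto simp: smooth_map_iff)
qed

lemma lrep_cong:
  assumes c: "smooth_chart A c" and eq: "\<And>p. p \<in> points A \<Longrightarrow> f p = g p"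
  shows "ldom c d f = ldom c d g" "z \<in> fst c \<Longrightarrow> lrep c d f z = lrep c d g z"
    "z \<in> fst c \<Longrightarrow> dlrep c d f z = dlrep c d g z"
proof -
  have *: "f (snd c z) = g (snd c z)" if "z \<in> fst c" for z
    using eq smooth_chartD(3)[OF c] that by blast
  then show "ldom c d f = ldom c d g" by (auto simp: ldom_def)
  show 1: "z \<in> fst c \<Longrightarrow> lrep c d f z = lrep c d g z" for z using * by (simp add: lrep_def)
  show "z \<in> fst c \<Longrightarrow> dlrep c d f z = dlrep c d g z"
    by (rule frechet_derivative_eq_on(1)[OF smooth_chartD(1)[OF c] _ 1])
qed

lemma smooth_map_cong:
  assumes A: "smooth_atlas A" and eq: "\<And>p. p \<in> points A \<Longrightarrow> f p = g p" and f: "smooth_map A B f"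
  shows "smooth_map A B g"
  unfolding smooth_map_iff
proof (intro conjI ballI)
  show "g ` points A \<subseteq> points B" using f eq by (auto simp: smooth_map_def)
  fix c d assume cd: "c \<in> A" "d \<in> B"
  note sc = atlas_chart[OF A cd(1)]
  have dom: "ldom c d g = ldom c d f" using lrep_cong(1)[where f=f and g=g and d=d, OF sc eq] by simp
  show op: "open (ldom c d g)" using f cd dom by (simp add: smooth_map_iff)
  have "lrep c d g z = lrep c d f z" if "z \<in> ldom c d g" for z
    using lrep_cong(2)[where f=f and g=g and d=d, OF sc eq, of z] that by (simp add: ldom_def)
  moreover have "smooth_on (ldom c d g) (lrep c d f)" using f cd dom by (simp add: smooth_map_iff)
  ultimately show "smooth_on (ldom c d g) (lrep c d g)" by (subst smooth_on_open_cong[OF op])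
qed

lemma differential_cong:
  assumes A: "smooth_atlas A" and B: "smooth_atlas B" and f: "smooth_map A B f"
    and eq: "\<And>p. p \<in> points A \<Longrightarrow> f p = g p" and p: "p \<in> points A" and v: "v \<in> tangent_space A p"
  shows "differential A B f p v = differential A B g p v"
proof -
  obtain c z where c: "smooth_chart A c" "z \<in> fst c" "snd c z = p" by (rule chart_point[OF A p])
  obtain d y where d: "smooth_chart B d" "y \<in> fst d" "snd d y = f p"
    by (rule chart_point[OF B smooth_map_points[OF f p]])
  obtain w where w: "v = dchart A c z w" using tangent_space_dchart[OF A c(1,2)] v c(3) by auto
  have z: "z \<in> ldom c d f" using c(2,3) d(2,3) snd_in_cdom[of y d] by (auto simp: ldom_def)
  then have z': "z \<in> ldom c d g" using lrep_cong(1)[where f=f and g=g and d=d, OF c(1) eq] by simp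
  show ?thesis
    using differential_dchart[OF A B f c(1) d(1) z, of w]
      differential_dchart[OF A B smooth_map_cong[where f=f and g=g, OF A eq f] c(1) d(1) z', of w]
      lrep_cong(2,3)[where f=f and g=g, OF c(1) eq c(2), of d] w c(3) by simp
qed

lemma differential_id:
  assumes A: "smooth_atlas A" and p: "p \<in> points A" and v: "v \<in> tangent_space A p"
  shows "differential A A (\<lambda>x. x) p v = v"
proof -
  obtain c z where c: "smooth_chart A c" "z \<in> fst c" "snd c z = p" by (rule chart_point[OF A p])
  obtain w where w: "v = dchart A c z w" using tangent_space_dchart[OF A c(1,2)] v c(3) by auto
  have z: "z \<in> ldom c c (\<lambda>x. x)" using c(2) by (auto simp: ldom_def)
  have "lrep c c (\<lambda>x. x) z = z" by (simp add: lrep_def coord_snd[OF smooth_chartD(2)[OF c(1)] c(2)])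
  then show ?thesis
    using differential_dchart[OF A A smooth_map_id[OF A] c(1) c(1) z, of w] w c(3) dlrep_id[OF c(1,2), of w] by simp
qed

subsection \<open>Almost complex structures in charts\<close>

text \<open>The matrix of \<open>J\<close> in a chart of the maximal atlas. For an almost complex structure the choice is unique,
  since \<open>dchart A c z\<close> is a bijection onto the tangent space.\<close>
definition Jrep :: "('a, 'n::finite) atlas \<Rightarrow> ('a \<Rightarrow> ('a, 'n) tvec \<Rightarrow> ('a, 'n) tvec) \<Rightarrow> ('a, 'n) chart \<Rightarrow>
    complex ^ 'n \<Rightarrow> complex ^ 'n \<Rightarrow> complex ^ 'n"
  where "Jrep A J c z e = (SOME e'. dchart A c z e' = J (snd c z) (dchart A c z e))"

context
  fixes A :: "('a, 'n::finite) atlas" and J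
  assumes A: "smooth_atlas A" and J: "almost_complex_structure A J"
begin

lemma J_in_tangent_space: "p \<in> points A \<Longrightarrow> v \<in> tangent_space A p \<Longrightarrow> J p v \<in> tangent_space A p"
  using J unfolding almost_complex_structure_def by blast

lemma dchart_Jrep:
  assumes c: "smooth_chart A c" and z: "z \<in> fst c"
  shows "dchart A c z (Jrep A J c z e) = J (snd c z) (dchart A c z e)"
proof -
  have "snd c z \<in> points A" using smooth_chartD(3)[OF c] z by auto
  from tangent_space_dchart[OF A c z J_in_tangent_space[OF this dchart_in_tangent_space[OF A c z]], of e]
  have "\<exists>e'. dchart A c z e' = J (snd c z) (dchart A c z e)" by metis
  then show ?thesis unfolding Jrep_def by (rule someI_ex)
qed

lemma Jrep_atlas: "c \<in> A \<Longrightarrow> z \<in> fst c \<Longrightarrow> Jrep A J c z e = J (snd c z) (dchart A c z e) c"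
  using dchart_Jrep[OF atlas_chart[OF A]] dchart_self[OF A] by metis

lemma linear_Jrep:
  assumes c: "smooth_chart A c" and z: "z \<in> fst c"
  shows "linear (Jrep A J c z)"
proof -
  let ?D = "dchart A c z"
  have p: "snd c z \<in> points A" using smooth_chartD(3)[OF c] z by auto
  have comb: "Jrep A J c z (a *\<^sub>R e + b *\<^sub>R e') = a *\<^sub>R Jrep A J c z e + b *\<^sub>R Jrep A J c z e'" for a b e e'
  proof (rule dchart_inj[OF A c z])
    have t: "?D e \<in> tangent_space A (snd c z)" for e by (rule dchart_in_tangent_space[OF A c z])
    have "?D (Jrep A J c z (a *\<^sub>R e + b *\<^sub>R e')) = J (snd c z) (lincomb a (?D e) b (?D e'))"
      by (simp add: dchart_Jrep[OF c z] lincomb_dchart[OF A c z])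
    also have "\<dots> = lincomb a (J (snd c z) (?D e)) b (J (snd c z) (?D e'))"
      using J p t unfolding almost_complex_structure_def by blast
    also have "\<dots> = ?D (a *\<^sub>R Jrep A J c z e + b *\<^sub>R Jrep A J c z e')"
      by (simp add: dchart_Jrep[OF c z, symmetric] lincomb_dchart[OF A c z])
    finally show "?D (Jrep A J c z (a *\<^sub>R e + b *\<^sub>R e')) = ?D (a *\<^sub>R Jrep A J c z e + b *\<^sub>R Jrep A J c z e')" .
  qed
  show ?thesis
  proof (rule linearI)
    show "Jrep A J c z (e + e') = Jrep A J c z e + Jrep A J c z e'" for e e'
      using comb[of 1 e 1 e'] by simp
    show "Jrep A J c z (a *\<^sub>R e) = a *\<^sub>R Jrep A J c z e" for a e
      using comb[of a e 0 0] by simp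
  qed
qed

lemma Jrep_Jrep:
  assumes c: "smooth_chart A c" and z: "z \<in> fst c"
  shows "Jrep A J c z (Jrep A J c z e) = - e"
proof (rule dchart_inj[OF A c z])
  have p: "snd c z \<in> points A" using smooth_chartD(3)[OF c] z by auto
  have t: "dchart A c z e \<in> tangent_space A (snd c z)" by (rule dchart_in_tangent_space[OF A c z])
  have "dchart A c z (Jrep A J c z (Jrep A J c z e)) = J (snd c z) (J (snd c z) (dchart A c z e))"
    by (simp add: dchart_Jrep[OF c z])
  also have "\<dots> = lincomb (- 1) (dchart A c z e) 0 (dchart A c z e)"
    using J p t unfolding almost_complex_structure_def lincomb_def by simp
  also have "\<dots> = dchart A c z (- e)" by (simp add: lincomb_dchart[OF A c z])
  finally show "dchart A c z (Jrep A J c z (Jrep A J c z e)) = dchart A c z (- e)" .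
qed

end

text \<open>The bijections \<open>dchart\<close> at the point and at its image carry the equation of
  tangent vectors to an equation of matrices.\<close>

lemma pseudoholomorphic_at_iff:
  assumes A: "smooth_atlas A" "almost_complex_structure A J" and B: "smooth_atlas B" "almost_complex_structure B J'"
    and f: "smooth_map A B f" and c: "smooth_chart A c" and d: "smooth_chart B d" and z: "z \<in> ldom c d f"
  shows "(\<forall>v\<in>tangent_space A (snd c z).
      J' (f (snd c z)) (differential A B f (snd c z) v) = differential A B f (snd c z) (J (snd c z) v)) \<longleftrightarrow>
    (\<forall>e. Jrep B J' d (lrep c d f z) (dlrep c d f z e) = dlrep c d f z (Jrep A J c z e))"
proof -
  have zc: "z \<in> fst c" using z by (simp add: ldom_def)
  have fz: "lrep c d f z \<in> fst d" "snd d (lrep c d f z) = f (snd c z)"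
    using z snd_coord[OF smooth_chartD(2)[OF d]] by (auto simp: ldom_def lrep_def)
  note dd = differential_dchart[OF A(1) B(1) f c d z]
  have "J' (f (snd c z)) (differential A B f (snd c z) (dchart A c z e)) = differential A B f (snd c z) (J (snd c z) (dchart A c z e))
    \<longleftrightarrow> Jrep B J' d (lrep c d f z) (dlrep c d f z e) = dlrep c d f z (Jrep A J c z e)" for e
  proof -
    have "J' (f (snd c z)) (differential A B f (snd c z) (dchart A c z e))
      = dchart B d (lrep c d f z) (Jrep B J' d (lrep c d f z) (dlrep c d f z e))"
      using dchart_Jrep[OF B d fz(1)] by (simp add: dd fz(2))
    moreover have "differential A B f (snd c z) (J (snd c z) (dchart A c z e))
      = dchart B d (lrep c d f z) (dlrep c d f z (Jrep A J c z e))"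
      by (simp add: dchart_Jrep[OF A c zc, symmetric] dd)
    ultimately show ?thesis using dchart_inj[OF B(1) d fz(1)] by metis
  qed
  then show ?thesis
    using tangent_space_dchart[OF A(1) c zc] dchart_in_tangent_space[OF A(1) c zc] by metis
qed

text \<open>By definition the matrix of \<open>J\<close> is smooth in the charts of the atlas. In a
  chart of the maximal atlas it is conjugate to such a matrix by the derivative of a transition map,
  since the identity is pseudoholomorphic.\<close>

lemma smooth_field_Jrep:
  assumes A: "smooth_atlas A" "almost_complex_structure A J" and c: "smooth_chart A c"
  shows "smooth_field (fst c) (Jrep A J c)"
  unfolding smooth_field_def
proof (intro conjI ballI allI smooth_on_local)
  show "linear (Jrep A J c z)" if "z \<in> fst c" for z by (rule linear_Jrep[OF A c that])
  fix e z assume z: "z \<in> fst c"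
  let ?id = "\<lambda>x. x"
  have "snd c z \<in> points A" using smooth_chartD(3)[OF c] z by auto
  then obtain d where d: "d \<in> A" "snd c z \<in> cdom d" by (rule pointsE)
  note sd = atlas_chart[OF A(1) d(1)]
  note cd = smooth_chartD(4,5)[OF c d(1)] and dc = smooth_chartD(6,7)[OF c d(1)]
  have op: "open (fst d)" by (rule smooth_chartD(1)[OF sd])
  let ?N = "ldom c d ?id" and ?t = "lrep c d ?id"
  have tN: "?t ` ?N \<subseteq> ldom d c ?id" "?t ` ?N \<subseteq> fst d"
    using snd_coord[OF smooth_chartD(2)[OF sd]] by (auto simp: ldom_def lrep_def)
  have smd: "smooth_on (fst d) (\<lambda>y. Jrep A J d y w)" for w
  proof -
    have "smooth_on (fst d) (\<lambda>y. J (snd d y) (dchart A d y w) d)"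
      using A(2) d(1) unfolding almost_complex_structure_def by blast
    then show ?thesis by (subst smooth_on_open_cong[OF op Jrep_atlas[OF A d(1)]])
  qed
  have sm1: "smooth_on ?N (\<lambda>y. Jrep A J d (?t y) w)" for w
    by (rule smooth_on_compose[OF cd(1) op smd cd(2) tN(2)])
  have sm2: "smooth_on ?N (\<lambda>y. Jrep A J d (?t y) (dlrep c d ?id y e))"
    using tN linear_Jrep[OF A sd]
    by (intro smooth_on_linear_apply[where L="\<lambda>y. Jrep A J d (?t y)", OF cd(1) _ sm1 smooth_on_frechet_derivative[OF cd(2)]]) auto
  have sm3: "smooth_on ?N (\<lambda>y. dlrep d c ?id (?t y) w)" for w
    by (rule smooth_on_compose[OF cd(1) dc(1) smooth_on_frechet_derivative[OF dc(2)] cd(2) tN(1)])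
  have sm4: "smooth_on ?N (\<lambda>y. dlrep d c ?id (?t y) (Jrep A J d (?t y) (dlrep c d ?id y e)))"
    using tN linear_dlrep_id[OF A(1) sd c]
    by (intro smooth_on_linear_apply[where L="\<lambda>y. dlrep d c ?id (?t y)", OF cd(1) _ sm3 sm2]) auto
  have "Jrep A J c y e = dlrep d c ?id (?t y) (Jrep A J d (?t y) (dlrep c d ?id y e))" if y: "y \<in> ?N" for y
  proof -
    have yc: "y \<in> fst c" using y by (simp add: ldom_def)
    have p: "snd c y \<in> points A" using smooth_chartD(3)[OF c] yc by auto
    have "J (snd c y) (differential A A ?id (snd c y) v) = differential A A ?id (snd c y) (J (snd c y) v)"
      if "v \<in> tangent_space A (snd c y)" for v
      using differential_id[OF A(1) p] that J_in_tangent_space[OF A p that] by simp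
    with pseudoholomorphic_at_iff[OF A A smooth_map_id[OF A(1)] c sd y]
    have "Jrep A J d (?t y) (dlrep c d ?id y e) = dlrep c d ?id y (Jrep A J c y e)" by blast
    moreover have "?t y \<in> ldom d c ?id" using tN y by blast
    ultimately show ?thesis
      using chain_dlrep[OF A(1) A(1) A(1) smooth_map_id[OF A(1)] smooth_map_id[OF A(1)] c sd c y, of "Jrep A J c y e"]
      by (simp add: dlrep_id[OF c yc])
  qed
  then have "smooth_on ?N (\<lambda>y. Jrep A J c y e)" using sm4 by (subst smooth_on_open_cong[OF cd(1)])
  moreover have "z \<in> ?N" using z d by (simp add: ldom_def)
  ultimately show "\<exists>T. open T \<and> z \<in> T \<and> smooth_on T (\<lambda>z. Jrep A J c z e)" using cd(1) by blast
qed

text \<open>Insert the image of \<open>v\<close> under the differential of \<open>g\<close> into the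
  equation for \<open>f\<close>, and apply the differential of \<open>g\<close> to both
  sides.\<close>

lemma pseudoholomorphic_inverse:
  assumes A: "smooth_atlas A" "almost_complex_structure A J" and B: "smooth_atlas B" "almost_complex_structure B J'"
    and f: "pseudoholomorphic A J B J' f" and g: "smooth_map B A g"
    and gf: "\<And>p. p \<in> points A \<Longrightarrow> g (f p) = p" and fg: "\<And>p. p \<in> points B \<Longrightarrow> f (g p) = p"
  shows "pseudoholomorphic B J' A J g"
  unfolding pseudoholomorphic_def
proof (intro conjI g ballI)
  fix p v assume p: "p \<in> points B" and v: "v \<in> tangent_space B p"
  have sf: "smooth_map A B f" using f by (simp add: pseudoholomorphic_def)
  note gp = smooth_map_points[OF g p]
  let ?w = "differential B A g p v"
  have w: "?w \<in> tangent_space A (g p)" by (rule differential_in_tangent_space[OF B(1) A(1) g p v])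
  have fgv: "differential A B f (g p) ?w = v"
    using differential_compose[OF B(1) A(1) B(1) g sf smooth_map_compose[OF B(1) A(1) B(1) g sf] p v]
      differential_cong[OF B(1) B(1) smooth_map_compose[OF B(1) A(1) B(1) g sf], of "\<lambda>x. x" p v] fg p v
      differential_id[OF B(1) p v] by simp
  have gfw: "differential B A g p (differential A B f (g p) u) = u" if u: "u \<in> tangent_space A (g p)" for u
    using differential_compose[OF A(1) B(1) A(1) sf g smooth_map_compose[OF A(1) B(1) A(1) sf g] gp u]
      differential_cong[OF A(1) A(1) smooth_map_compose[OF A(1) B(1) A(1) sf g], of "\<lambda>x. x" "g p" u] gf gp u
      differential_id[OF A(1) gp u] fg[OF p] by simp
  have "J' p v = differential A B f (g p) (J (g p) ?w)"
    using f gp w fgv fg[OF p] unfolding pseudoholomorphic_def by metis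
  then show "J (g p) ?w = differential B A g p (J' p v)"
    using gfw[OF J_in_tangent_space[OF A gp w]] by simp
qed

subsection \<open>Charts of the blow-up\<close>

definition out_chart :: "'a \<Rightarrow> ('a, 'n::finite) chart \<Rightarrow> ('a, 'n) chart \<Rightarrow> (('a, 'n) pre_bl set, 'n) chart"
  where "out_chart x c d = (fst d \<inter> snd d -` (- {x}), \<lambda>u. bl_class c (Inl (snd d u)))"

definition aff_chart :: "('a, 'n::finite) chart \<Rightarrow> 'n \<Rightarrow> (('a, 'n) pre_bl set, 'n) chart"
  where "aff_chart c i = (aff_base i -` fst c, \<lambda>u. bl_class c (Inr (aff_base i u, cline (aff_dir i u))))"

text \<open>The coordinates, in the \<open>j\<close>-th affine chart, of the base point
  \<open>z\<close> together with the line of \<open>k\<close>, provided that \<open>k $ j\<close> is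
  nonzero and \<open>z\<close> lies on that line.\<close>

definition aff_inv :: "'n::finite \<Rightarrow> complex ^ 'n \<Rightarrow> complex ^ 'n \<Rightarrow> complex ^ 'n"
  where "aff_inv j z k = (\<chi> l. if l = j then z $ j else k $ l / k $ j)"

lemma out_chart_simps [simp]:
  "fst (out_chart x c d) = fst d \<inter> snd d -` (- {x})" "snd (out_chart x c d) u = bl_class c (Inl (snd d u))"
  by (simp_all add: out_chart_def)

lemma aff_chart_simps [simp]:
  "fst (aff_chart c i) = aff_base i -` fst c"
  "snd (aff_chart c i) u = bl_class c (Inr (aff_base i u, cline (aff_dir i u)))"
  by (simp_all add: aff_chart_def)

lemma blowup_eq: "blowup A x c = out_chart x c ` A \<union> range (aff_chart c)"
  unfolding blowup_def out_chart_def aff_chart_def by blast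

lemma cline_self [simp]: "v \<in> cline v"
  unfolding cline_def by (metis rangeI vector_smult_lid)

lemma cline_eqD: "cline v = cline w \<Longrightarrow> \<exists>t. v = t *s w"
  using cline_self[of v] by (auto simp: cline_def)

lemma cline_aff_dir_eq:
  assumes "cline (aff_dir j u) = cline k"
  shows "k $ j \<noteq> 0" "aff_dir j u = (1 / k $ j) *s k"
proof -
  obtain t where t: "aff_dir j u = t *s k" using cline_eqD[OF assms] by blast
  then have "t * k $ j = 1" using aff_dir_nth[of j u] by simp
  then show "k $ j \<noteq> 0" by auto
  then have "t = 1 / k $ j" using \<open>t * k $ j = 1\<close> by (simp add: field_simps)
  then show "aff_dir j u = (1 / k $ j) *s k" using t by simp
qed

lemma aff_dir_aff_inv: "k $ j \<noteq> 0 \<Longrightarrow> aff_dir j (aff_inv j z k) = (1 / k $ j) *s k"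
  by (simp add: vec_eq_iff aff_dir_def aff_inv_def)

lemma cline_aff_dir_aff_inv: "k $ j \<noteq> 0 \<Longrightarrow> cline (aff_dir j (aff_inv j z k)) = cline k"
  by (simp add: aff_dir_aff_inv cline_scale)

lemma aff_base_aff_inv:
  assumes "k $ j \<noteq> 0" "z = s *s k"
  shows "aff_base j (aff_inv j z k) = z"
  unfolding aff_base_def aff_dir_aff_inv[OF assms(1)] using assms by (simp add: aff_inv_def vec_eq_iff)

lemma aff_inv_aff_base:
  assumes "cline (aff_dir j u) = cline k" "z = aff_base j u"
  shows "aff_inv j z k = u"
proof -
  have "aff_inv j z k $ l = u $ l" for l
  proof (cases "l = j")
    case False
    then have "u $ l = aff_dir j u $ l" by (simp add: aff_dir_def)
    also have "\<dots> = aff_inv j z k $ l"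
      unfolding cline_aff_dir_eq(2)[OF assms(1)] using False by (simp add: aff_inv_def)
    finally show ?thesis by simp
  qed (use assms in \<open>simp add: aff_inv_def aff_base_nth\<close>)
  then show ?thesis by (simp add: vec_eq_iff)
qed

lemma cline_aff_base: "u $ i \<noteq> 0 \<Longrightarrow> cline (aff_dir i u) = cline (aff_base i u)"
  by (simp add: aff_base_def cline_scale)

lemma smooth_on_aff_inv:
  assumes "open S" "smooth_on S z" "smooth_on S k" "\<And>u. u \<in> S \<Longrightarrow> k u $ j \<noteq> 0"
  shows "smooth_on S (\<lambda>u. aff_inv j (z u) (k u))"
  unfolding aff_inv_def
proof (rule smooth_on_vec_lambda[OF assms(1)])
  show "smooth_on S (\<lambda>u. if l = j then z u $ j else k u $ l / k u $ j)" for l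
    using assms(4) smooth_on_vec_nth[OF assms(1,2)]
      smooth_on_divide[OF assms(1) smooth_on_vec_nth[OF assms(1,3)] smooth_on_vec_nth[OF assms(1,3)], of j l]
    by (cases "l = j") auto
qed

lemma open_chart_minus_point:
  fixes a :: "('a, 'n::finite) chart"
  assumes "open (fst a)" "inj_on (snd a) (fst a)"
  shows "open (fst a \<inter> snd a -` (- {x}))"
proof -
  have "fst a \<inter> snd a -` (- {x}) = fst a - {coord a x} \<or> fst a \<inter> snd a -` (- {x}) = fst a"
  proof (cases "x \<in> cdom a")
    case True
    then show ?thesis using snd_coord[OF assms(2) True] coord_snd[OF assms(2)] by (intro disjI1) auto
  next
    case False
    then show ?thesis by (intro disjI2) auto
  qed
  then show ?thesis using assms(1) by (metis open_delete)
qed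

context
  fixes c :: "('a, 'n::finite) chart"
  assumes inj: "inj_on (snd c) (fst c)"
begin

lemma bl_class_eq_iff: "bl_class c a = bl_class c b \<longleftrightarrow> (a, b) \<in> bl_rel c"
proof -
  have "sym ((bl_glue c \<union> (bl_glue c)\<inverse>)\<^sup>*)" by (intro sym_rtrancl) (auto simp: sym_def)
  then have s: "(a, b) \<in> bl_rel c \<Longrightarrow> (b, a) \<in> bl_rel c" for a b by (auto simp: bl_rel_def sym_def)
  have t: "(a, b) \<in> bl_rel c \<Longrightarrow> (b, e) \<in> bl_rel c \<Longrightarrow> (a, e) \<in> bl_rel c" for a b e by (auto simp: bl_rel_def)
  have r: "(b, b) \<in> bl_rel c" by (simp add: bl_rel_def)
  show ?thesis unfolding bl_class_def using s t r by blast
qed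

lemma bl_class_Inl: "bl_class c (Inl p) = bl_class c (Inl p') \<longleftrightarrow> p = p'"
  unfolding bl_class_eq_iff bl_rel_eq[OF inj] by (auto simp: bl_glue_def)

lemma bl_class_Inr: "bl_class c (Inr (z, L)) = bl_class c (Inr (z', L')) \<longleftrightarrow> z = z' \<and> L = L'"
  unfolding bl_class_eq_iff bl_rel_eq[OF inj] by (auto simp: bl_glue_def)

lemma bl_class_Inl_Inr:
  "bl_class c (Inl p) = bl_class c (Inr (z, L)) \<longleftrightarrow> z \<in> fst c \<and> z \<noteq> 0 \<and> p = snd c z \<and> L = cline z"
  unfolding bl_class_eq_iff bl_rel_eq[OF inj] by (auto simp: bl_glue_def)

lemma inj_on_out_chart: "inj_on (snd d) (fst d) \<Longrightarrow> inj_on (snd (out_chart x c d)) (fst (out_chart x c d))"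
  by (auto simp: inj_on_def bl_class_Inl)

lemma inj_on_aff_chart: "inj_on (snd (aff_chart c i)) (fst (aff_chart c i))"
proof (rule inj_onI)
  fix u u' assume "snd (aff_chart c i) u = snd (aff_chart c i) u'"
  then have *: "aff_base i u' = aff_base i u" "cline (aff_dir i u) = cline (aff_dir i u')"
    by (simp_all add: bl_class_Inr)
  show "u = u'" using aff_inv_aff_base[OF *(2,1)] aff_inv_aff_base[OF refl refl, of i u'] by metis
qed

text \<open>A point of the chart other than its centre is glued to its coordinates paired with the
  line through them, so \<open>coord c p\<close> serves both as base point and as direction.\<close>

lemma Inl_in_aff_chart:
  shows "bl_class c (Inl p) \<in> cdom (aff_chart c j) \<longleftrightarrow> p \<in> cdom c \<and> coord c p $ j \<noteq> 0"
    and "p \<in> cdom c \<Longrightarrow> coord c p $ j \<noteq> 0 \<Longrightarrow> bl_class c (Inl p) = snd (aff_chart c j) (aff_inv j (coord c p) (coord c p))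
      \<and> aff_inv j (coord c p) (coord c p) \<in> fst (aff_chart c j)"
proof -
  show 2: "bl_class c (Inl p) = snd (aff_chart c j) (aff_inv j (coord c p) (coord c p))
      \<and> aff_inv j (coord c p) (coord c p) \<in> fst (aff_chart c j)" if p: "p \<in> cdom c" "coord c p $ j \<noteq> 0"
  proof -
    have "aff_base j (aff_inv j (coord c p) (coord c p)) = coord c p"
      using aff_base_aff_inv[OF p(2), of _ 1] by simp
    moreover have "cline (aff_dir j (aff_inv j (coord c p) (coord c p))) = cline (coord c p)"
      by (rule cline_aff_dir_aff_inv[OF p(2)])
    moreover have "coord c p \<noteq> 0" using p(2) by auto
    ultimately show ?thesis using snd_coord[OF inj p(1)] by (simp add: bl_class_Inl_Inr)
  qed
  show "bl_class c (Inl p) \<in> cdom (aff_chart c j) \<longleftrightarrow> p \<in> cdom c \<and> coord c p $ j \<noteq> 0"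
  proof
    assume "bl_class c (Inl p) \<in> cdom (aff_chart c j)"
    then obtain u where "bl_class c (Inl p) = snd (aff_chart c j) u" unfolding cdom_def by blast
    then have u: "aff_base j u \<in> fst c" "aff_base j u \<noteq> 0" "p = snd c (aff_base j u)"
      by (auto simp: bl_class_Inl_Inr)
    then have "coord c p = aff_base j u" using coord_snd[OF inj] by simp
    then show "p \<in> cdom c \<and> coord c p $ j \<noteq> 0" using u aff_base_eq_0_iff[of j u] by (auto simp: aff_base_nth)
  next
    assume "p \<in> cdom c \<and> coord c p $ j \<noteq> 0"
    then show "bl_class c (Inl p) \<in> cdom (aff_chart c j)" using 2 by (metis snd_in_cdom)
  qed
qed

lemma Inr_in_aff_chart:
  assumes "z = s *s k" "z \<in> fst c"
  shows "bl_class c (Inr (z, cline k)) \<in> cdom (aff_chart c j) \<longleftrightarrow> k $ j \<noteq> 0"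
    and "k $ j \<noteq> 0 \<Longrightarrow> bl_class c (Inr (z, cline k)) = snd (aff_chart c j) (aff_inv j z k) \<and>
       aff_inv j z k \<in> fst (aff_chart c j)"
proof -
  show 2: "bl_class c (Inr (z, cline k)) = snd (aff_chart c j) (aff_inv j z k) \<and>
       aff_inv j z k \<in> fst (aff_chart c j)" if "k $ j \<noteq> 0"
    using aff_base_aff_inv[OF that assms(1)] cline_aff_dir_aff_inv[OF that, of z] assms(2) by simp
  show "bl_class c (Inr (z, cline k)) \<in> cdom (aff_chart c j) \<longleftrightarrow> k $ j \<noteq> 0"
  proof
    assume "bl_class c (Inr (z, cline k)) \<in> cdom (aff_chart c j)"
    then obtain u where "bl_class c (Inr (z, cline k)) = snd (aff_chart c j) u" unfolding cdom_def by blast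
    then have "cline (aff_dir j u) = cline k" by (simp add: bl_class_Inr)
    then show "k $ j \<noteq> 0" by (rule cline_aff_dir_eq)
  next
    assume "k $ j \<noteq> 0"
    with 2 show "bl_class c (Inr (z, cline k)) \<in> cdom (aff_chart c j)" by (metis snd_in_cdom)
  qed
qed

lemma aff_chart_outside: "u \<in> fst (aff_chart c i) \<Longrightarrow> u $ i \<noteq> 0 \<Longrightarrow>
    snd (aff_chart c i) u = bl_class c (Inl (snd c (aff_base i u)))"
  using cline_aff_base[of u i] by (simp add: bl_class_Inl_Inr[THEN iffD2, symmetric] aff_base_eq_0_iff)

lemma Inr_0_in_aff_chart:
  assumes "0 \<in> fst c" "v \<noteq> 0"
  shows "\<exists>i u. u $ i = 0 \<and> u \<in> fst (aff_chart c i) \<and> bl_class c (Inr (0, cline v)) = snd (aff_chart c i) u"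
proof -
  obtain i where i: "v $ i \<noteq> 0" using assms(2) by (auto simp: vec_eq_iff)
  have "aff_inv i 0 v $ i = 0" by (simp add: aff_inv_def)
  then show ?thesis using Inr_in_aff_chart(2)[OF _ assms(1) i, of 0] by fastforce
qed

lemma cdom_out_chart:
  "bl_class c (Inl p) \<in> cdom (out_chart x c d) \<longleftrightarrow> p \<in> cdom d \<and> p \<noteq> x"
  by (auto simp: cdom_def bl_class_Inl)

lemma cdom_out_chart_Inr: "bl_class c (Inr (0, L)) \<notin> cdom (out_chart x c d)"
proof
  assume "bl_class c (Inr (0, L)) \<in> cdom (out_chart x c d)"
  then obtain u where "bl_class c (Inr (0, L)) = bl_class c (Inl (snd d u))" by (auto simp: cdom_def)
  from this[symmetric] show False by (simp add: bl_class_Inl_Inr)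
qed

end

text \<open>The normal form behind the later case distinctions: a point of an affine chart that is
  off the divisor is glued to a point of the manifold.\<close>

lemma points_blowup_cases:
  assumes c: "chart_centred A x c" and q: "q \<in> points (blowup A x c)"
  obtains p where "p \<in> points A" "p \<noteq> x" "q = bl_class c (Inl p)"
  | v where "v \<noteq> 0" "q = bl_class c (Inr (0, cline v))"
proof -
  have sc: "smooth_chart A c" and c0: "0 \<in> fst c" "snd c 0 = x" using c by (auto simp: chart_centred_def)
  note inj = smooth_chartD(2)[OF sc]
  from q obtain e where e: "e \<in> blowup A x c" "q \<in> cdom e" by (rule pointsE)
  from e(1) consider d where "d \<in> A" "e = out_chart x c d" | i where "e = aff_chart c i"
    unfolding blowup_eq by blast
  then show thesis
  proof cases
    case 1
    then obtain u where "u \<in> fst d" "snd d u \<noteq> x" "q = bl_class c (Inl (snd d u))"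
      using e(2) by (auto simp: cdom_def)
    then show thesis using that(1)[of "snd d u"] 1(1) by (auto simp: points_def cdom_def)
  next
    case 2
    then obtain u where u: "u \<in> fst (aff_chart c i)" "q = snd (aff_chart c i) u"
      using e(2) unfolding cdom_def by blast
    show thesis
    proof (cases "u $ i = 0")
      case True
      then show thesis using that(2)[of "aff_dir i u"] u(2) by (simp add: aff_base_eq_0_iff[THEN iffD2])
    next
      case False
      have "snd c (aff_base i u) \<noteq> x"
        using inj_onD[OF inj, of "aff_base i u" 0] c0 u(1) False by (auto simp: aff_base_eq_0_iff)
      then show thesis
        using that(1)[of "snd c (aff_base i u)"] aff_chart_outside[OF inj u(1) False] u
          smooth_chartD(3)[OF sc] by (auto simp: cdom_def)
    qed
  qed
qed

lemma points_blowupI: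
  assumes c: "chart_centred A x c"
  shows "p \<in> points A \<Longrightarrow> p \<noteq> x \<Longrightarrow> bl_class c (Inl p) \<in> points (blowup A x c)"
    and "v \<noteq> 0 \<Longrightarrow> bl_class c (Inr (0, cline v)) \<in> points (blowup A x c)"
proof -
  have inj: "inj_on (snd c) (fst c)" and c0: "0 \<in> fst c"
    using c by (auto simp: chart_centred_def smooth_chart_def)
  show "bl_class c (Inl p) \<in> points (blowup A x c)" if "p \<in> points A" "p \<noteq> x"
    using that(1)
  proof (rule pointsE)
    fix d assume "d \<in> A" "p \<in> cdom d"
    then show ?thesis
      using cdom_out_chart[OF inj, of p x d] that(2) unfolding blowup_eq points_def by blast
  qed
  show "bl_class c (Inr (0, cline v)) \<in> points (blowup A x c)" if v: "v \<noteq> 0"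
  proof -
    obtain i u where "u \<in> fst (aff_chart c i)" "bl_class c (Inr (0, cline v)) = snd (aff_chart c i) u"
      using Inr_0_in_aff_chart[OF inj c0 v] by blast
    then have "bl_class c (Inr (0, cline v)) \<in> cdom (aff_chart c i)" by (simp only: snd_in_cdom)
    then show ?thesis unfolding blowup_eq points_def by blast
  qed
qed

subsection \<open>Lifting a map to the blow-ups\<close>

text \<open>The choice of \<open>v\<close> is immaterial when \<open>D\<close> maps complex lines to complex lines.\<close>
definition blowup_map :: "'a \<Rightarrow> ('a, 'n::finite) chart \<Rightarrow> ('b, 'n) chart \<Rightarrow> (complex ^ 'n \<Rightarrow> complex ^ 'n) \<Rightarrow>
    ('a \<Rightarrow> 'b) \<Rightarrow> ('a, 'n) pre_bl set \<Rightarrow> ('b, 'n) pre_bl set"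
  where "blowup_map x c d D f q =
    (if blow_down c q = x
     then bl_class d (Inr (0, cline (D (SOME v. v \<noteq> 0 \<and> q = bl_class c (Inr (0, cline v))))))
     else bl_class d (Inl (f (blow_down c q))))"

text \<open>\<open>D\<close> is the derivative at the origin, and \<open>K i u\<close> spans the line through which the lift passes at the
  point with coordinates \<open>u\<close> of the \<open>i\<close>-th affine chart.\<close>
locale blowup_lift =
  fixes A :: "('a, 'n::finite) atlas" and B :: "('b, 'n) atlas"
    and x :: 'a and y :: 'b and c :: "('a, 'n) chart" and d :: "('b, 'n) chart"
    and f :: "'a \<Rightarrow> 'b" and D :: "complex ^ 'n \<Rightarrow> complex ^ 'n" and K :: "'n \<Rightarrow> complex ^ 'n \<Rightarrow> complex ^ 'n"
  assumes A: "smooth_atlas A" and B: "smooth_atlas B"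
    and c: "chart_centred A x c" and d: "chart_centred B y d"
    and f: "smooth_map A B f" and fx: "f x = y" and injf: "inj_on f (points A)"
    and D_scale: "t \<noteq> 0 \<Longrightarrow> cline (D (t *s v)) = cline (D v)" and D_nonzero: "v \<noteq> 0 \<Longrightarrow> D v \<noteq> 0"
    and K_smooth: "smooth_on (aff_base i -` ldom c d f) (K i)"
    and K_nonzero: "u \<in> aff_base i -` ldom c d f \<Longrightarrow> K i u \<noteq> 0"
    and K_line: "u \<in> aff_base i -` ldom c d f \<Longrightarrow>
      cline (K i u) = cline (if u $ i = 0 then D (aff_dir i u) else lrep c d f (aff_base i u))"
begin

abbreviation "g \<equiv> blowup_map x c d D f"

lemma charts: "smooth_chart A c" "0 \<in> fst c" "snd c 0 = x" "smooth_chart B d" "0 \<in> fst d" "snd d 0 = y"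
  using c d by (auto simp: chart_centred_def)

lemmas injc = smooth_chartD(2)[OF charts(1)]
lemmas injd = smooth_chartD(2)[OF charts(4)]

lemma x_points: "x \<in> points A"
  using smooth_chartD(3)[OF charts(1)] charts(2,3) by (auto simp: cdom_def)

lemma f_eq_y: "p \<in> points A \<Longrightarrow> f p = y \<longleftrightarrow> p = x"
  using inj_onD[OF injf, of p x] x_points fx by auto

lemma zero_ldom: "0 \<in> ldom c d f" "lrep c d f 0 = 0"
  using charts fx coord_snd[OF injd charts(5)] snd_in_cdom[OF charts(5)] by (auto simp: ldom_def lrep_def)

lemma snd_c_eq_x: "z \<in> fst c \<Longrightarrow> snd c z = x \<longleftrightarrow> z = 0"
  using inj_onD[OF injc, of z 0] charts by auto

lemma g_Inl: "p \<noteq> x \<Longrightarrow> g (bl_class c (Inl p)) = bl_class d (Inl (f p))"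
  by (simp add: blowup_map_def blow_down_class[OF injc])

text \<open>The representative selected in \<open>blowup_map\<close> is a nonzero complex multiple
  of \<open>v\<close>, and \<open>D_scale\<close> makes the factor invisible.\<close>

lemma g_Inr:
  assumes v: "v \<noteq> 0"
  shows "g (bl_class c (Inr (0, cline v))) = bl_class d (Inr (0, cline (D v)))"
proof -
  define w where "w = (SOME w. w \<noteq> 0 \<and> bl_class c (Inr (0, cline v)) = bl_class c (Inr (0, cline w)))"
  have "w \<noteq> 0 \<and> bl_class c (Inr (0, cline v)) = bl_class c (Inr (0, cline w))"
    unfolding w_def by (rule someI[of "\<lambda>w. w \<noteq> 0 \<and> bl_class c (Inr (0, cline v)) = bl_class c (Inr (0, cline w))" v]) (simp add: v)
  then have w: "w \<noteq> 0" "cline w = cline v" by (auto simp: bl_class_Inr[OF injc])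
  obtain t where t: "w = t *s v" using cline_eqD[OF w(2)] by blast
  then have "t \<noteq> 0" using w(1) by auto
  then have "cline (D w) = cline (D v)" unfolding t by (rule D_scale)
  then show ?thesis
    by (simp add: blowup_map_def blow_down_class[OF injc] charts w_def)
qed

lemma K_parallel:
  assumes "u \<in> aff_base i -` ldom c d f"
  shows "\<exists>s. lrep c d f (aff_base i u) = s *s K i u"
proof (cases "u $ i = 0")
  case True
  then show ?thesis using zero_ldom by (intro exI[of _ 0]) (simp add: aff_base_eq_0_iff[THEN iffD2])
next
  case False
  then have "cline (lrep c d f (aff_base i u)) = cline (K i u)" using K_line[OF assms] by simp
  then show ?thesis by (rule cline_eqD)
qed

text \<open>One formula on and off the divisor. Off it, the gluing rewrites the image point as a
  base point with the line through it, and \<open>K_line\<close> identifies that line.\<close>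

lemma g_aff:
  assumes u: "u \<in> aff_base i -` ldom c d f"
  shows "g (snd (aff_chart c i) u) = bl_class d (Inr (lrep c d f (aff_base i u), cline (K i u)))"
proof -
  have uc: "u \<in> fst (aff_chart c i)" using u by (simp add: ldom_def)
  show ?thesis
  proof (cases "u $ i = 0")
    case True
    then show ?thesis
      using g_Inr[of "aff_dir i u"] K_line[OF u] zero_ldom by (simp add: aff_base_eq_0_iff[THEN iffD2])
  next
    case False
    let ?p = "snd c (aff_base i u)"
    have px: "?p \<noteq> x" using snd_c_eq_x uc False by (simp add: aff_base_eq_0_iff)
    have fp: "f ?p \<in> cdom d" using u by (simp add: ldom_def)
    have "?p \<in> points A" using smooth_chartD(3)[OF charts(1)] uc by (auto simp: cdom_def)
    then have "f ?p \<noteq> y" using f_eq_y px by blast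
    then have "lrep c d f (aff_base i u) \<noteq> 0"
      using snd_coord(1)[OF injd fp] charts(6) by (auto simp: lrep_def)
    then have "bl_class d (Inl (f ?p)) = bl_class d (Inr (lrep c d f (aff_base i u), cline (lrep c d f (aff_base i u))))"
      using snd_coord[OF injd fp] by (simp add: bl_class_Inl_Inr[OF injd] lrep_def)
    then show ?thesis
      using g_Inl[OF px] aff_chart_outside[OF injc uc False] K_line[OF u] False by simp
  qed
qed

lemma g_aff_outside:
  assumes "u \<in> fst (aff_chart c i)" "u $ i \<noteq> 0"
  shows "g (snd (aff_chart c i) u) = bl_class d (Inl (f (snd c (aff_base i u))))"
  using aff_chart_outside[OF injc assms] g_Inl snd_c_eq_x[of "aff_base i u"] assms
  by (simp add: aff_base_eq_0_iff)

lemma blow_down_g: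
  assumes "q \<in> points (blowup A x c)"
  shows "blow_down d (g q) = f (blow_down c q)"
proof (cases rule: points_blowup_cases[OF c assms])
  case (1 p)
  then show ?thesis by (simp add: g_Inl blow_down_class[OF injc] blow_down_class[OF injd])
next
  case (2 v)
  then show ?thesis by (simp add: g_Inr blow_down_class[OF injc] blow_down_class[OF injd] charts fx)
qed

lemma g_points:
  assumes "q \<in> points (blowup A x c)"
  shows "g q \<in> points (blowup B y d)"
proof (cases rule: points_blowup_cases[OF c assms])
  case (1 p)
  then show ?thesis using points_blowupI(1)[OF d smooth_map_points[OF f 1(1)]] f_eq_y g_Inl by simp
next
  case (2 v)
  then show ?thesis using points_blowupI(2)[OF d D_nonzero[OF 2(1)]] g_Inr by simp
qed

lemma local_smoothI:
  assumes inj: "inj_on (snd b) (fst b)" and N: "open N" and dom: "ldom a b h = N"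
    and k: "smooth_on N k" and eq: "\<And>u. u \<in> N \<Longrightarrow> h (snd a u) = snd b (k u) \<and> k u \<in> fst b"
  shows "open (ldom a b h) \<and> smooth_on (ldom a b h) (lrep a b h)"
proof -
  have "lrep a b h u = k u" if "u \<in> N" for u
    using eq[OF that] coord_snd[OF inj] by (simp add: lrep_def)
  then have "smooth_on N (lrep a b h)" using k by (subst smooth_on_open_cong[OF N])
  with N show ?thesis unfolding dom ..
qed

text \<open>In three of the four pairings of charts only points off the divisors are involved, and
  smoothness is inherited from \<open>f\<close>. Between two affine charts it rests on the smooth
  direction \<open>K\<close>.\<close>

lemma smooth_map_g: "smooth_map (blowup A x c) (blowup B y d) g"
proof -
  note fcd = smooth_map_charts[OF A B f charts(1,4)]
  have cases: "open (ldom a b g) \<and> smooth_on (ldom a b g) (lrep a b g)"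
    if "a = out_chart x c a' \<and> a' \<in> A \<or> a = aff_chart c i" "b = out_chart y d b' \<and> b' \<in> B \<or> b = aff_chart d j"
    for a b a' b' i j
    using that
  proof (elim disjE conjE)
    assume a: "a = out_chart x c a'" "a' \<in> A" and b: "b = out_chart y d b'" "b' \<in> B"
    note sa = atlas_chart[OF A a(2)] and sb = atlas_chart[OF B b(2)]
    note fab = smooth_map_charts[OF A B f sa sb]
    let ?N = "ldom a' b' f \<inter> (fst a' \<inter> snd a' -` (- {x}))"
    have pts: "snd a' u \<in> points A" if "u \<in> fst a'" for u using smooth_chartD(3)[OF sa] that by auto
    show ?thesis
    proof (rule local_smoothI[where N="?N" and k="lrep a' b' f"])
      show "inj_on (snd b) (fst b)" unfolding b by (rule inj_on_out_chart[OF injd smooth_chartD(2)[OF sb]])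
      show "open ?N" by (intro open_Int fab open_chart_minus_point smooth_chartD(1,2)[OF sa])
      show "smooth_on ?N (lrep a' b' f)" by (rule smooth_on_subset[OF fab(2)]) auto
      show "ldom a b g = ?N"
        unfolding a b using f_eq_y pts by (auto simp: ldom_def g_Inl cdom_out_chart[OF injd])
      show "g (snd a u) = snd b (lrep a' b' f u) \<and> lrep a' b' f u \<in> fst b" if "u \<in> ?N" for u
        using that f_eq_y pts snd_coord[OF smooth_chartD(2)[OF sb]]
        unfolding a b by (auto simp: ldom_def g_Inl lrep_def)
    qed
  next
    assume a: "a = out_chart x c a'" "a' \<in> A" and b: "b = aff_chart d j"
    note sa = atlas_chart[OF A a(2)]
    note fab = smooth_map_charts[OF A B f sa charts(4)]
    let ?N = "ldom a' d f \<inter> lrep a' d f -` {z. z $ j \<noteq> 0}"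
    have opj: "open {z :: complex ^ 'n. z $ j \<noteq> 0}" by (intro open_Collect_neq continuous_intros)
    have N: "open ?N" by (rule open_Int_vimage_smooth[OF fab opj])
    have Nx: "snd a' u \<noteq> x" if "u \<in> ?N" for u
    proof
      assume "snd a' u = x"
      then have "lrep a' d f u = 0" using fx charts(5,6) coord_snd[OF injd charts(5)] by (simp add: lrep_def)
      then show False using that by simp
    qed
    have sm: "smooth_on ?N (lrep a' d f)" by (rule smooth_on_subset[OF fab(2)]) auto
    show ?thesis
    proof (rule local_smoothI[where N="?N" and k="\<lambda>u. aff_inv j (lrep a' d f u) (lrep a' d f u)"])
      show "inj_on (snd b) (fst b)" unfolding b by (rule inj_on_aff_chart[OF injd])
      show "open ?N" by (rule N)
      show "smooth_on ?N (\<lambda>u. aff_inv j (lrep a' d f u) (lrep a' d f u))"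
        by (rule smooth_on_aff_inv[OF N sm sm]) auto
      show "ldom a b g = ?N"
        unfolding a b using Nx Inl_in_aff_chart(1)[OF injd]
        by (auto simp: ldom_def g_Inl lrep_def simp del: aff_chart_simps)
      show "g (snd a u) = snd b (aff_inv j (lrep a' d f u) (lrep a' d f u)) \<and>
          aff_inv j (lrep a' d f u) (lrep a' d f u) \<in> fst b" if u: "u \<in> ?N" for u
        using Inl_in_aff_chart(2)[OF injd, of "f (snd a' u)" j] Nx[OF u] u
        unfolding a b by (simp add: ldom_def g_Inl lrep_def del: aff_chart_simps)
    qed
  next
    assume a: "a = aff_chart c i" and b: "b = out_chart y d b'" "b' \<in> B"
    note sb = atlas_chart[OF B b(2)]
    note fab = smooth_map_charts[OF A B f charts(1) sb]
    let ?N = "aff_base i -` ldom c b' f \<inter> {u. u $ i \<noteq> 0}"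
    have N: "open ?N" by (intro open_Int open_aff_base_vimage fab open_Collect_neq continuous_intros)
    have pts: "snd c (aff_base i u) \<in> points A" if "aff_base i u \<in> fst c" for u using smooth_chartD(3)[OF charts(1)] that by auto
    have Nx: "f (snd c (aff_base i u)) \<noteq> y" if "u $ i \<noteq> 0" "aff_base i u \<in> fst c" for u
      using f_eq_y[OF pts[OF that(2)]] snd_c_eq_x[OF that(2)] that(1) by (simp add: aff_base_eq_0_iff)
    \<comment> \<open>Points of the divisor go to points of the divisor, which the outer charts
      miss; hence the condition \<open>u $ i \<noteq> 0\<close> in \<open>?N\<close>.\<close>
    have zero: "g (snd (aff_chart c i) u) \<notin> cdom (out_chart y d b')" if "u $ i = 0" for u
      using that g_Inr[of "aff_dir i u"] cdom_out_chart_Inr[OF injd] by (simp add: aff_base_eq_0_iff[THEN iffD2])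
    have dom: "ldom a b g = ?N"
    proof (intro set_eqI)
      fix u
      show "u \<in> ldom a b g \<longleftrightarrow> u \<in> ?N"
      proof (cases "u $ i \<noteq> 0 \<and> u \<in> fst (aff_chart c i)")
        case True
        then show ?thesis
          using g_aff_outside[of u i] Nx[of u] cdom_out_chart[OF injd, of "f (snd c (aff_base i u))" y b']
          unfolding a b by (simp add: ldom_def del: aff_chart_simps(2))
      next
        case False
        then show ?thesis using zero[of u] unfolding a b by (auto simp: ldom_def simp del: aff_chart_simps(2))
      qed
    qed
    show ?thesis
    proof (rule local_smoothI[where N="?N" and k="\<lambda>u. lrep c b' f (aff_base i u)"])
      show "inj_on (snd b) (fst b)" unfolding b by (rule inj_on_out_chart[OF injd smooth_chartD(2)[OF sb]])
      show "open ?N" by (rule N)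
      show "ldom a b g = ?N" by (rule dom)
      show "smooth_on ?N (\<lambda>u. lrep c b' f (aff_base i u))"
        by (rule smooth_on_subset[OF smooth_on_aff_base_compose[OF fab]]) auto
      show "g (snd a u) = snd b (lrep c b' f (aff_base i u)) \<and> lrep c b' f (aff_base i u) \<in> fst b" if u: "u \<in> ?N" for u
      proof -
        have uc: "u \<in> fst (aff_chart c i)" "u $ i \<noteq> 0" "f (snd c (aff_base i u)) \<in> cdom b'" using u by (auto simp: ldom_def)
        then show ?thesis
          using g_aff_outside[OF uc(1,2)] Nx[of u] snd_coord[OF smooth_chartD(2)[OF sb] uc(3)]
          unfolding a b by (simp add: lrep_def del: aff_chart_simps(2))
      qed
    qed
  next
    assume a: "a = aff_chart c i" and b: "b = aff_chart d j"
    let ?V = "aff_base i -` ldom c d f"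
    have V: "open ?V" by (rule open_aff_base_vimage[OF fcd(1)])
    let ?N = "?V \<inter> K i -` {k. k $ j \<noteq> 0}"
    have opj: "open {z :: complex ^ 'n. z $ j \<noteq> 0}" by (intro open_Collect_neq continuous_intros)
    have N: "open ?N" by (rule open_Int_vimage_smooth[OF V K_smooth opj])
    have img: "lrep c d f (aff_base i u) \<in> fst d" if "u \<in> ?V" for u
      using that snd_coord[OF injd] by (simp add: ldom_def lrep_def)
    have inV: "g (snd a u) \<in> cdom b \<longleftrightarrow> K i u $ j \<noteq> 0" if u: "u \<in> ?V" for u
    proof -
      obtain s where "lrep c d f (aff_base i u) = s *s K i u" using K_parallel[OF u] by blast
      from Inr_in_aff_chart(1)[OF injd this img[OF u]] show ?thesis unfolding a b g_aff[OF u] .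
    qed
    \<comment> \<open>A point of the affine chart outside \<open>?V\<close> is off the divisor, and
      \<open>f\<close> moves it out of \<open>d\<close>; so its image lies in no affine
      chart.\<close>
    have notV: "g (snd a u) \<notin> cdom b" if u: "u \<in> fst a" "u \<notin> ?V" for u
    proof -
      have "u $ i \<noteq> 0" using u(2) zero_ldom(1) by (auto simp: aff_base_eq_0_iff[THEN iffD2])
      moreover have "f (snd c (aff_base i u)) \<notin> cdom d" using u unfolding a by (simp add: ldom_def)
      ultimately show ?thesis
        using g_aff_outside[of u i] u(1) Inl_in_aff_chart(1)[OF injd] unfolding a b by (simp del: aff_chart_simps(2))
    qed
    have "?V \<subseteq> fst a" unfolding a by (auto simp: ldom_def)
    then have dom: "ldom a b g = ?N" unfolding ldom_def[of a] using inV notV by blast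
    show ?thesis
    proof (rule local_smoothI[where N="?N" and k="\<lambda>u. aff_inv j (lrep c d f (aff_base i u)) (K i u)"])
      show "inj_on (snd b) (fst b)" unfolding b by (rule inj_on_aff_chart[OF injd])
      show "open ?N" by (rule N)
      show "ldom a b g = ?N" by (rule dom)
      show "smooth_on ?N (\<lambda>u. aff_inv j (lrep c d f (aff_base i u)) (K i u))"
        by (rule smooth_on_aff_inv[OF N smooth_on_subset[OF smooth_on_aff_base_compose[OF fcd]] smooth_on_subset[OF K_smooth]]) auto
      show "g (snd a u) = snd b (aff_inv j (lrep c d f (aff_base i u)) (K i u)) \<and>
          aff_inv j (lrep c d f (aff_base i u)) (K i u) \<in> fst b" if u: "u \<in> ?N" for u
      proof -
        have uV: "u \<in> ?V" and kj: "K i u $ j \<noteq> 0" using u by auto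
        obtain s where "lrep c d f (aff_base i u) = s *s K i u" using K_parallel[OF uV] by blast
        from Inr_in_aff_chart(2)[OF injd this img[OF uV] kj] show ?thesis unfolding a b g_aff[OF uV] .
      qed
    qed
  qed
  show ?thesis
    unfolding smooth_map_iff
  proof (intro conjI image_subsetI ballI)
    show "g q \<in> points (blowup B y d)" if "q \<in> points (blowup A x c)" for q by (rule g_points[OF that])
    fix a b assume "a \<in> blowup A x c" "b \<in> blowup B y d"
    then have "open (ldom a b g) \<and> smooth_on (ldom a b g) (lrep a b g)"
      unfolding blowup_eq using cases by blast
    then show "open (ldom a b g)" "smooth_on (ldom a b g) (lrep a b g)" by auto
  qed
qed

end

text \<open>Lifting the identity shows that the transition maps of the blow-up are smooth.\<close>
lemma blowup_lift_id:
  assumes A: "smooth_atlas A" and c: "chart_centred A x c"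
  shows "blowup_lift A A x x c c (\<lambda>p. p) (\<lambda>v. v) aff_dir"
proof -
  have sc: "smooth_chart A c" using c by (simp add: chart_centred_def)
  have dom: "ldom c c (\<lambda>p. p) = fst c" by (auto simp: ldom_def)
  have rep: "lrep c c (\<lambda>p. p) z = z" if "z \<in> fst c" for z
    using coord_snd[OF smooth_chartD(2)[OF sc] that] by (simp add: lrep_def)
  show ?thesis
  proof (unfold_locales)
    show "smooth_on (aff_base i -` ldom c c (\<lambda>p. p)) (aff_dir i)" for i
      unfolding dom by (rule smooth_on_aff_dir[OF open_aff_base_vimage[OF smooth_chartD(1)[OF sc]]])
    show "cline (aff_dir i u) = cline (if u $ i = 0 then aff_dir i u else lrep c c (\<lambda>p. p) (aff_base i u))"
      if "u \<in> aff_base i -` ldom c c (\<lambda>p. p)" for u i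
      using that cline_aff_base[of u i] by (simp add: dom rep)
  qed (simp_all add: A c smooth_map_id[OF A] cline_scale)
qed

text \<open>There is no circle in using the lift: its smoothness was shown for each pair of charts
  of the blow-ups, without the compatibility of these charts.\<close>

lemma smooth_atlas_blowup:
  assumes A: "smooth_atlas A" and c: "chart_centred A x c"
  shows "smooth_atlas (blowup A x c)"
proof -
  interpret I: blowup_lift A A x x c c "\<lambda>p. p" "\<lambda>v. v" aff_dir by (rule blowup_lift_id[OF A c])
  have gid: "I.g q = q" if "q \<in> points (blowup A x c)" for q
    by (cases rule: points_blowup_cases[OF c that]) (simp_all add: I.g_Inl I.g_Inr)
  have "smooth_chart (blowup A x c) a" if a: "a \<in> blowup A x c" for a
  proof -
    have sub: "cdom b \<subseteq> points (blowup A x c)" if "b \<in> blowup A x c" for b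
      using that by (auto simp: points_def)
    have trans: "smooth_transition a b" if a: "a \<in> blowup A x c" and b: "b \<in> blowup A x c" for a b
    proof -
      have g: "I.g (snd a z) = snd a z" if "z \<in> fst a" for z using gid sub[OF a] that by blast
      have dom: "ldom a b I.g = ldom a b (\<lambda>x. x)" using g by (auto simp: ldom_def)
      have op: "open (ldom a b (\<lambda>x. x))" and sm: "smooth_on (ldom a b (\<lambda>x. x)) (lrep a b I.g)"
        using I.smooth_map_g a b unfolding smooth_map_iff dom[symmetric] by auto
      have "lrep a b (\<lambda>x. x) z = lrep a b I.g z" if "z \<in> ldom a b (\<lambda>x. x)" for z
        using g that by (simp add: lrep_def ldom_def)
      then have "smooth_on (ldom a b (\<lambda>x. x)) (lrep a b (\<lambda>x. x))"
        using sm by (subst smooth_on_open_cong[OF op])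
      with op show ?thesis unfolding smooth_transition_def lrep_id_eq ..
    qed
    have "open (fst a) \<and> inj_on (snd a) (fst a)"
      using a unfolding blowup_eq
    proof (elim UnE imageE)
      fix d assume d: "a = out_chart x c d" "d \<in> A"
      note sd = atlas_chart[OF A d(2)]
      show ?thesis
        unfolding d out_chart_simps(1) using inj_on_out_chart[OF I.injc smooth_chartD(2)[OF sd]]
          open_chart_minus_point[OF smooth_chartD(1,2)[OF sd]] by simp
    next
      fix i assume "a = aff_chart c i"
      then show ?thesis
        using inj_on_aff_chart[OF I.injc] open_aff_base_vimage[OF smooth_chartD(1)[OF I.charts(1)]] by simp
    qed
    then show ?thesis using sub[OF a] trans a unfolding smooth_chart_def by blast
  qed
  then show ?thesis by (simp add: smooth_atlas_def)
qed

section \<open>The almost complex structures of the blow-ups\<close>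

lemma aff_chart_in_blowup: "aff_chart c i \<in> blowup A x c"
  by (auto simp: blowup_eq)

lemma blow_down_aff_chart:
  assumes c: "smooth_chart A c" and u: "u \<in> fst (aff_chart c i)"
  shows "blow_down c (snd (aff_chart c i) u) = snd c (aff_base i u)"
    "u \<in> ldom (aff_chart c i) c (blow_down c)" "lrep (aff_chart c i) c (blow_down c) u = aff_base i u"
    "dlrep (aff_chart c i) c (blow_down c) u = frechet_derivative (aff_base i) (at u)"
proof -
  note inj = smooth_chartD(2)[OF c]
  have bd: "blow_down c (snd (aff_chart c i) u) = snd c (aff_base i u)" for u
    by (simp add: blow_down_class[OF inj])
  show "blow_down c (snd (aff_chart c i) u) = snd c (aff_base i u)" by (rule bd)
  show "u \<in> ldom (aff_chart c i) c (blow_down c)" using u snd_in_cdom[of "aff_base i u" c] by (simp add: ldom_def blow_down_class[OF inj])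
  have rep: "lrep (aff_chart c i) c (blow_down c) u = aff_base i u" if "u \<in> fst (aff_chart c i)" for u
    unfolding lrep_def bd using that coord_snd[OF inj] by simp
  show "lrep (aff_chart c i) c (blow_down c) u = aff_base i u" by (rule rep[OF u])
  have "open (fst (aff_chart c i))" using open_aff_base_vimage[OF smooth_chartD(1)[OF c]] by simp
  from frechet_derivative_eq_on(1)[OF this u rep]
  show "dlrep (aff_chart c i) c (blow_down c) u = frechet_derivative (aff_base i) (at u)" .
qed

text \<open>In affine coordinates the blow-down map is \<open>aff_base i\<close>, so the matrix of
  the blown-up structure is the required lift.\<close>

lemma lifts_to_blowup_Jrep:
  assumes A: "smooth_atlas A" "almost_complex_structure A J" and bl: "almost_complex_blowup A J x c J'"
    and S: "S \<subseteq> fst c"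
  shows "lifts_to_blowup i S (Jrep A J c)"
proof -
  have cc: "chart_centred A x c" and J': "almost_complex_structure (blowup A x c) J'"
    and ph: "pseudoholomorphic (blowup A x c) J' A J (blow_down c)"
    using bl by (auto simp: almost_complex_blowup_def)
  have sc: "smooth_chart A c" using cc by (simp add: chart_centred_def)
  let ?B = "blowup A x c" and ?a = "aff_chart c i"
  have B: "smooth_atlas ?B" by (rule smooth_atlas_blowup[OF A(1) cc])
  have sa: "smooth_chart ?B ?a" by (rule atlas_chart[OF B aff_chart_in_blowup])
  have sm: "smooth_map ?B A (blow_down c)" using ph by (simp add: pseudoholomorphic_def)
  have "aff_base i -` S \<subseteq> fst ?a" using S by auto
  then have sub: "\<And>u. u \<in> aff_base i -` S \<Longrightarrow> u \<in> fst ?a" by blast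
  have "smooth_field (aff_base i -` S) (Jrep ?B J' ?a)"
    using smooth_field_Jrep[OF B J' sa] smooth_on_subset[OF _ \<open>aff_base i -` S \<subseteq> fst ?a\<close>] sub
    unfolding smooth_field_def by blast
  moreover have "Jrep A J c (aff_base i u) (frechet_derivative (aff_base i) (at u) v)
      = frechet_derivative (aff_base i) (at u) (Jrep ?B J' ?a u v)" if u: "u \<in> aff_base i -` S" for u v
  proof -
    note bd = blow_down_aff_chart[OF sc sub[OF u]]
    have "snd ?a u \<in> points ?B" using smooth_chartD(3)[OF sa] sub[OF u] by blast
    then have "\<forall>v\<in>tangent_space ?B (snd ?a u). J (blow_down c (snd ?a u)) (differential ?B A (blow_down c) (snd ?a u) v)
      = differential ?B A (blow_down c) (snd ?a u) (J' (snd ?a u) v)"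
      using ph unfolding pseudoholomorphic_def by blast
    with pseudoholomorphic_at_iff[OF B J' A sm sa sc bd(2)] show ?thesis unfolding bd(3,4) by blast
  qed
  ultimately show ?thesis unfolding lifts_to_blowup_def by blast
qed

lemma dlrep_left_inverse:
  assumes A: "smooth_atlas A" and B: "smooth_atlas B" and f: "smooth_map A B f" and h: "smooth_map B A h"
    and hf: "\<And>p. p \<in> points A \<Longrightarrow> h (f p) = p"
    and c: "smooth_chart A c" and d: "smooth_chart B d" and z: "z \<in> ldom c d f"
  shows "dlrep d c h (lrep c d f z) (dlrep c d f z v) = v"
proof -
  have zc: "z \<in> fst c" using z by (simp add: ldom_def)
  then have "h (f (snd c z)) = snd c z" using hf smooth_chartD(3)[OF c] by blast
  then have "lrep c d f z \<in> ldom d c h"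
    using lrep_in_ldom(1)[where h=f and k=h and e=c, OF d z] zc by auto
  from chain_dlrep[OF A B A f h c d c z this, of v]
  show ?thesis
    using lrep_cong(3)[where f="\<lambda>p. h (f p)" and g="\<lambda>p. p" and d=c, OF c hf zc] dlrep_id[OF c zc] by simp
qed

text \<open>The smooth left inverse \<open>h\<close> makes \<open>f\<close> injective on points and
  its derivative injective at the centre.\<close>

lemma ex_blowup_lift:
  fixes A :: "('a, 'n::finite) atlas" and B :: "('b, 'n) atlas"
  assumes A: "smooth_atlas A" "almost_complex_structure A J" and B: "smooth_atlas B" "almost_complex_structure B J'"
    and f: "pseudoholomorphic A J B J' f" and h: "smooth_map B A h" and hf: "\<And>p. p \<in> points A \<Longrightarrow> h (f p) = p"
    and fx: "f x = y"
    and blA: "almost_complex_blowup A J x c JA" and blB: "almost_complex_blowup B J' y d JB"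
  shows "\<exists>K. blowup_lift A B x y c d f (dlrep c d f 0) K"
proof -
  have cc: "chart_centred A x c" and dd: "chart_centred B y d"
    using blA blB by (auto simp: almost_complex_blowup_def)
  have sc: "smooth_chart A c" "0 \<in> fst c" "snd c 0 = x" and sd: "smooth_chart B d" "0 \<in> fst d" "snd d 0 = y"
    using cc dd by (auto simp: chart_centred_def)
  have sf: "smooth_map A B f" using f by (simp add: pseudoholomorphic_def)
  let ?S = "ldom c d f" and ?\<psi> = "lrep c d f"
  note fS = smooth_map_charts[OF A(1) B(1) sf sc(1) sd(1)]
  have injf: "inj_on f (points A)" by (rule inj_on_inverseI[where g=h]) (rule hf)
  have S0: "0 \<in> ?S" using sc sd fx snd_in_cdom[OF sd(2)] by (auto simp: ldom_def)
  have \<psi>0: "?\<psi> 0 = 0" using sc sd fx coord_snd[OF smooth_chartD(2)[OF sd(1)] sd(2)] by (simp add: lrep_def)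
  have \<psi>U: "?\<psi> ` ?S \<subseteq> fst d" using snd_coord[OF smooth_chartD(2)[OF sd(1)]] by (auto simp: ldom_def lrep_def)
  have inj\<psi>: "inj_on ?\<psi> ?S"
  proof (rule inj_onI)
    fix z w assume z: "z \<in> ?S" and w: "w \<in> ?S" and eq: "?\<psi> z = ?\<psi> w"
    have "f (snd c z) = f (snd c w)"
      using z w eq snd_coord(1)[OF smooth_chartD(2)[OF sd(1)]] unfolding ldom_def lrep_def by (metis (mono_tags, lifting) mem_Collect_eq)
    moreover have "snd c z \<in> points A" "snd c w \<in> points A"
      using z w smooth_chartD(3)[OF sc(1)] by (auto simp: ldom_def)
    ultimately have "snd c z = snd c w" using inj_onD[OF injf] by blast
    then show "z = w" using inj_onD[OF smooth_chartD(2)[OF sc(1)]] z w by (simp add: ldom_def)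
  qed
  have subS: "?S \<subseteq> fst c" by (auto simp: ldom_def)
  have J1: "smooth_field ?S (Jrep A J c)"
    using smooth_field_Jrep[OF A sc(1)] smooth_on_subset[OF _ subS] subS unfolding smooth_field_def by blast
  note J2 = smooth_field_Jrep[OF B sd(1)]
  have lift1: "lifts_to_blowup i ?S (Jrep A J c)" for i by (rule lifts_to_blowup_Jrep[OF A blA subS])
  have lift2: "lifts_to_blowup i (fst d) (Jrep B J' d)" for i by (rule lifts_to_blowup_Jrep[OF B blB order_refl])
  have eq: "Jrep B J' d (?\<psi> z) (dlrep c d f z v) = dlrep c d f z (Jrep A J c z v)" if z: "z \<in> ?S" for z v
  proof -
    have "snd c z \<in> points A" using z smooth_chartD(3)[OF sc(1)] by (auto simp: ldom_def)
    then show ?thesis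
      using pseudoholomorphic_at_iff[OF A B sf sc(1) sd(1) z] f unfolding pseudoholomorphic_def by blast
  qed
  have d0: "v = 0" if "dlrep c d f 0 v = 0" for v
  proof -
    have "h (f (snd c 0)) = snd c 0" using hf smooth_chartD(3)[OF sc(1)] sc(2) by blast
    then have "?\<psi> 0 \<in> ldom d c h"
      using lrep_in_ldom(1)[where h=f and k=h and e=c, OF sd(1) S0] snd_in_cdom[OF sc(2)] by simp
    then have "linear (dlrep d c h (?\<psi> 0))"
      by (intro linear_frechet_derivative smooth_on_differentiable[OF smooth_map_charts(2)[OF B(1) A(1) h sd(1) sc(1)]])
    from linear_0[OF this] dlrep_left_inverse[OF A(1) B(1) sf h hf sc(1) sd(1) S0, of v] that show ?thesis by simp
  qed
  have "\<exists>K. \<forall>i. smooth_on (aff_base i -` ?S) (K i) \<and> (\<forall>u\<in>aff_base i -` ?S. K i u \<noteq> 0 \<and>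
      cline (K i u) = cline (if u $ i = 0 then dlrep c d f 0 (aff_dir i u) else ?\<psi> (aff_base i u)))"
    by (rule lift_direction(1)[OF fS(1) S0 fS(2) \<psi>0 inj\<psi> d0 smooth_chartD(1)[OF sd(1)] \<psi>U J1 lift1
      Jrep_Jrep[OF A sc(1,2)] J2 lift2 Jrep_Jrep[OF B sd(1,2)] eq])
  then obtain K where K: "\<forall>i. smooth_on (aff_base i -` ?S) (K i) \<and> (\<forall>u\<in>aff_base i -` ?S. K i u \<noteq> 0 \<and>
      cline (K i u) = cline (if u $ i = 0 then dlrep c d f 0 (aff_dir i u) else ?\<psi> (aff_base i u)))"
    by (elim exE)
  have "blowup_lift A B x y c d f (dlrep c d f 0) K"
  proof
    show "cline (dlrep c d f 0 (t *s v)) = cline (dlrep c d f 0 v)" if "t \<noteq> 0" for t v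
      by (rule lift_direction(2)[OF fS(1) S0 fS(2) \<psi>0 inj\<psi> _ smooth_chartD(1)[OF sd(1)] \<psi>U J1 lift1
            Jrep_Jrep[OF A sc(1,2)] J2 lift2 Jrep_Jrep[OF B sd(1,2)] _ that]) (erule d0, erule eq)
    show "dlrep c d f 0 v \<noteq> 0" if "v \<noteq> 0" for v using d0 that by blast
  qed (use A B cc dd sf fx injf K in \<open>simp_all\<close>)
  then show ?thesis by blast
qed

text \<open>Off the divisor the blow-down map is the identity in the charts
  \<open>out_chart y d b\<close> and \<open>b\<close>.\<close>

lemma differential_blow_down_inj:
  assumes B: "smooth_atlas B" and d: "chart_centred B y d" and sm: "smooth_map (blowup B y d) B (blow_down d)"
    and p: "p \<in> points B" "p \<noteq> y" and q: "q = bl_class d (Inl p)"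
    and v: "v \<in> tangent_space (blowup B y d) q" and w: "w \<in> tangent_space (blowup B y d) q"
    and eq: "differential (blowup B y d) B (blow_down d) q v = differential (blowup B y d) B (blow_down d) q w"
  shows "v = w"
proof -
  let ?Bl = "blowup B y d"
  have Bl: "smooth_atlas ?Bl" by (rule smooth_atlas_blowup[OF B d])
  have injd: "inj_on (snd d) (fst d)" using d by (auto simp: chart_centred_def smooth_chart_def)
  obtain b u where b: "b \<in> B" "smooth_chart B b" "u \<in> fst b" "snd b u = p" by (rule chart_point[OF B p(1)])
  let ?o = "out_chart y d b"
  have o: "?o \<in> ?Bl" using b(1) by (auto simp: blowup_eq)
  note so = atlas_chart[OF Bl o]
  have u: "u \<in> fst ?o" "snd ?o u = q" using b p q by auto
  have rep: "lrep ?o b (blow_down d) z = z" if "z \<in> fst ?o" for z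
    using that coord_snd[OF smooth_chartD(2)[OF b(2)]] by (simp add: lrep_def blow_down_class[OF injd])
  have "dlrep ?o b (blow_down d) u = frechet_derivative (\<lambda>z. z) (at u)"
    by (rule frechet_derivative_eq_on(1)[OF smooth_chartD(1)[OF so] u(1) rep])
  then have drep: "dlrep ?o b (blow_down d) u e = e" for e
    using frechet_derivative_at[OF has_derivative_ident[of "at u"]] by metis
  have dom: "u \<in> ldom ?o b (blow_down d)" using u b snd_in_cdom[OF b(3)] by (simp add: ldom_def blow_down_class[OF injd])
  obtain e e' where e: "v = dchart ?Bl ?o u e" "w = dchart ?Bl ?o u e'"
    using tangent_space_dchart[OF Bl so u(1)] v w u(2) by metis
  have "dchart B b u e = dchart B b u e'"
    using eq differential_dchart[OF Bl B sm so b(2) dom] unfolding e u(2) rep[OF u(1)] drep by simp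
  from dchart_inj[OF B b(2,3) this] show ?thesis using e by simp
qed

lemma (in blowup_lift) pseudoholomorphic_g:
  assumes JA: "almost_complex_structure A J" and JB: "almost_complex_structure B J'"
    and ph: "pseudoholomorphic A J B J' f"
    and blA: "almost_complex_blowup A J x c J1" and blB: "almost_complex_blowup B J' y d J2"
  shows "pseudoholomorphic (blowup A x c) J1 (blowup B y d) J2 g"
proof -
  let ?A = "blowup A x c" and ?B = "blowup B y d"
  note At = smooth_atlas_blowup[OF A c] and Bt = smooth_atlas_blowup[OF B d]
  have J1: "almost_complex_structure ?A J1" and J2: "almost_complex_structure ?B J2"
    and ph1: "pseudoholomorphic ?A J1 A J (blow_down c)" and ph2: "pseudoholomorphic ?B J2 B J' (blow_down d)"
    using blA blB by (auto simp: almost_complex_blowup_def)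
  have s1: "smooth_map ?A A (blow_down c)" and s2: "smooth_map ?B B (blow_down d)"
    using ph1 ph2 by (auto simp: pseudoholomorphic_def)
  have cs1: "smooth_map ?A B (\<lambda>q. f (blow_down c q))" by (rule smooth_map_compose[OF At A B s1 f])
  have cs2: "smooth_map ?A B (\<lambda>q. blow_down d (g q))" by (rule smooth_map_compose[OF At Bt B smooth_map_g s2])
  \<comment> \<open>Apply the differential of the second blow-down map to both sides and use that
    the lift covers \<open>f\<close>. Off the divisor this differential is injective and can be
    cancelled.\<close>
  have outside: "\<forall>v\<in>tangent_space ?A q. J2 (g q) (differential ?A ?B g q v) = differential ?A ?B g q (J1 q v)"
    if p: "p \<in> points A" "p \<noteq> x" and q: "q = bl_class c (Inl p)" for p q
  proof
    fix v assume v: "v \<in> tangent_space ?A q"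
    have qA: "q \<in> points ?A" unfolding q by (rule points_blowupI(1)[OF c p])
    note gq = g_points[OF qA]
    have pq: "blow_down c q \<in> points A" "blow_down d (g q) = f (blow_down c q)"
      using smooth_map_points[OF s1 qA] blow_down_g[OF qA] by auto
    note T1 = differential_in_tangent_space[OF At A s1 qA]
      and Tg = differential_in_tangent_space[OF At Bt smooth_map_g qA]
    have comm: "differential ?B B (blow_down d) (g q) (differential ?A ?B g q w)
        = differential A B f (blow_down c q) (differential ?A A (blow_down c) q w)"
      if w: "w \<in> tangent_space ?A q" for w
      using differential_compose[OF At Bt B smooth_map_g s2 cs2 qA w] differential_compose[OF At A B s1 f cs1 qA w]
        differential_cong[where f="\<lambda>q. f (blow_down c q)" and g="\<lambda>q. blow_down d (g q)", OF At B cs1 blow_down_g[symmetric] qA w]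
      by simp
    have Jv: "J1 q v \<in> tangent_space ?A q" by (rule J_in_tangent_space[OF At J1 qA v])
    have "differential ?B B (blow_down d) (g q) (J2 (g q) (differential ?A ?B g q v))
      = J' (blow_down d (g q)) (differential ?B B (blow_down d) (g q) (differential ?A ?B g q v))"
      using ph2 gq Tg[OF v] unfolding pseudoholomorphic_def by metis
    also have "\<dots> = J' (f (blow_down c q)) (differential A B f (blow_down c q) (differential ?A A (blow_down c) q v))"
      by (simp only: comm[OF v] pq(2))
    also have "\<dots> = differential A B f (blow_down c q) (J (blow_down c q) (differential ?A A (blow_down c) q v))"
      using ph pq(1) T1[OF v] unfolding pseudoholomorphic_def by metis
    also have "\<dots> = differential A B f (blow_down c q) (differential ?A A (blow_down c) q (J1 q v))"
      using ph1 qA v unfolding pseudoholomorphic_def by metis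
    also have "\<dots> = differential ?B B (blow_down d) (g q) (differential ?A ?B g q (J1 q v))"
      by (rule comm[OF Jv, symmetric])
    finally have eq: "differential ?B B (blow_down d) (g q) (J2 (g q) (differential ?A ?B g q v))
      = differential ?B B (blow_down d) (g q) (differential ?A ?B g q (J1 q v))" .
    have fp: "f p \<in> points B" "f p \<noteq> y" "g q = bl_class d (Inl (f p))"
      using smooth_map_points[OF f p(1)] f_eq_y[OF p(1)] p(2) g_Inl[OF p(2)] q by auto
    show "J2 (g q) (differential ?A ?B g q v) = differential ?A ?B g q (J1 q v)"
      by (rule differential_blow_down_inj[OF B d s2 fp J_in_tangent_space[OF Bt J2 gq Tg[OF v]] Tg[OF Jv] eq])
  qed
  have inside: "\<forall>v\<in>tangent_space ?A q. J2 (g q) (differential ?A ?B g q v) = differential ?A ?B g q (J1 q v)"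
    if v0: "v0 \<noteq> 0" and q: "q = bl_class c (Inr (0, cline v0))" for v0 q
  proof -
    obtain i u where u: "u $ i = 0" "u \<in> fst (aff_chart c i)" "q = snd (aff_chart c i) u"
      using Inr_0_in_aff_chart[OF injc charts(2) v0] q by auto
    let ?a = "aff_chart c i"
    note sa = atlas_chart[OF At aff_chart_in_blowup[of c i A x]]
    have "q \<in> points ?A" unfolding q by (rule points_blowupI(2)[OF c v0])
    then obtain b where b: "b \<in> ?B" "g q \<in> cdom b" using g_points pointsE by meson
    note sb = atlas_chart[OF Bt b(1)]
    let ?N = "ldom ?a b g"
    note gN = smooth_map_charts[OF At Bt smooth_map_g sa sb]
    have uN: "u \<in> ?N" using u b by (simp add: ldom_def)
    have Nb: "lrep ?a b g ` ?N \<subseteq> fst b" and Na: "?N \<subseteq> fst ?a"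
      using snd_coord[OF smooth_chartD(2)[OF sb]] by (auto simp: ldom_def lrep_def)
    note F1 = smooth_field_Jrep[OF At J1 sa] and F2 = smooth_field_Jrep[OF Bt J2 sb]
    have "Jrep ?B J2 b (lrep ?a b g u) (dlrep ?a b g u e) = dlrep ?a b g u (Jrep ?A J1 ?a u e)" for e
    proof -
      \<comment> \<open>The defect of the equation in coordinates: continuous on \<open>?N\<close>,
        and zero off the divisor.\<close>
      define \<phi> where "\<phi> w = Jrep ?B J2 b (lrep ?a b g w) (dlrep ?a b g w e) - dlrep ?a b g w (Jrep ?A J1 ?a w e)" for w
      have sm1: "smooth_on ?N (\<lambda>w. Jrep ?B J2 b (lrep ?a b g w) v)" for v
        using F2 by (intro smooth_on_compose[OF gN(1) smooth_chartD(1)[OF sb] _ gN(2) Nb]) (simp add: smooth_field_def)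
      have sm2: "smooth_on ?N (\<lambda>w. Jrep ?B J2 b (lrep ?a b g w) (dlrep ?a b g w e))"
        using F2 Nb by (intro smooth_on_linear_apply[where L="\<lambda>w. Jrep ?B J2 b (lrep ?a b g w)", OF gN(1) _ sm1
            smooth_on_frechet_derivative[OF gN(2)]]) (auto simp: smooth_field_def)
      have sm3: "smooth_on ?N (\<lambda>w. Jrep ?A J1 ?a w e)"
        using F1 smooth_on_subset[OF _ Na] unfolding smooth_field_def by blast
      have sm4: "smooth_on ?N (\<lambda>w. dlrep ?a b g w (Jrep ?A J1 ?a w e))"
        by (rule smooth_on_linear_apply[where L="\<lambda>w. dlrep ?a b g w", OF gN(1)
            linear_frechet_derivative[OF smooth_on_differentiable[OF gN(2)]] smooth_on_frechet_derivative[OF gN(2)] sm3])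
      have "smooth_on ?N \<phi>" unfolding \<phi>_def[abs_def] by (rule smooth_on_diff[OF gN(1) sm2 sm4])
      then have "isCont \<phi> u" using smooth_on_continuous gN(1) uN continuous_on_eq_continuous_at by blast
      \<comment> \<open>For \<open>r \<noteq> 0\<close> this path is off the divisor, so the defect
        at \<open>u\<close> is a limit of zeros.\<close>
      let ?l = "\<lambda>r::real. u + r *\<^sub>R unit i"
      have "isCont (\<lambda>r. \<phi> (?l r)) 0"
        by (rule isCont_o2[where f="?l" and g=\<phi>]) (use \<open>isCont \<phi> u\<close> in \<open>auto intro!: continuous_intros\<close>)
      then have lim: "((\<lambda>r. \<phi> (?l r)) \<longlongrightarrow> \<phi> u) (at 0)" by (simp add: isCont_def)
      have zero: "\<phi> w = 0" if w: "w \<in> ?N" "w $ i \<noteq> 0" for w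
      proof -
        have wa: "w \<in> fst ?a" using w Na by blast
        have px: "snd c (aff_base i w) \<noteq> x" "snd c (aff_base i w) \<in> points A"
          using snd_c_eq_x[of "aff_base i w"] wa w(2) smooth_chartD(3)[OF charts(1)] by (auto simp: aff_base_eq_0_iff)
        show ?thesis
          using outside[OF px(2,1) aff_chart_outside[OF injc wa w(2)]]
            pseudoholomorphic_at_iff[OF At J1 Bt J2 smooth_map_g sa sb w(1)] unfolding \<phi>_def by simp
      qed
      have "open (?l -` ?N)" by (intro open_vimage gN(1) continuous_intros)
      moreover have "0 \<in> ?l -` ?N" using uN by simp
      ultimately have "\<forall>\<^sub>F r in nhds 0. r \<in> ?l -` ?N" by (rule eventually_nhds_in_open)
      then have "\<forall>\<^sub>F r in at 0. \<phi> (?l r) = 0"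
        unfolding eventually_at_filter
      proof (eventually_elim, intro impI)
        fix r :: real assume "r \<in> ?l -` ?N" "r \<noteq> 0"
        then show "\<phi> (?l r) = 0" using u(1) by (intro zero) (auto simp: axis_def)
      qed
      then have "((\<lambda>r. \<phi> (?l r)) \<longlongrightarrow> 0) (at 0)" by (rule tendsto_eventually)
      with lim have "\<phi> u = 0" using tendsto_unique[OF trivial_limit_at] by blast
      then show ?thesis by (simp add: \<phi>_def)
    qed
    with pseudoholomorphic_at_iff[OF At J1 Bt J2 smooth_map_g sa sb uN] show ?thesis unfolding u(3) by blast
  qed
  have "\<forall>v\<in>tangent_space ?A q. J2 (g q) (differential ?A ?B g q v) = differential ?A ?B g q (J1 q v)"
    if q: "q \<in> points ?A" for q
    by (rule points_blowup_cases[OF c q]) (use outside inside in blast)+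
  then show ?thesis using smooth_map_g unfolding pseudoholomorphic_def by blast
qed

theorem theorem5p6:
  fixes X\<^sub>1 :: "('a, 'n::finite) atlas" and X\<^sub>2 :: "('b, 'n) atlas"
  assumes "almost_complex_manifold X\<^sub>1 J\<^sub>1"
    and "almost_complex_manifold X\<^sub>2 J\<^sub>2"
    and "pseudobiholomorphism X\<^sub>1 J\<^sub>1 X\<^sub>2 J\<^sub>2 f"
    and "p\<^sub>1 \<in> points X\<^sub>1" and "p\<^sub>2 \<in> points X\<^sub>2" and "f p\<^sub>1 = p\<^sub>2"
    and "almost_complex_blowup X\<^sub>1 J\<^sub>1 p\<^sub>1 \<phi>\<^sub>1 J\<^sub>1'"
    and "almost_complex_blowup X\<^sub>2 J\<^sub>2 p\<^sub>2 \<phi>\<^sub>2 J\<^sub>2'"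
  shows "\<exists>g. pseudobiholomorphism (blowup X\<^sub>1 p\<^sub>1 \<phi>\<^sub>1) J\<^sub>1' (blowup X\<^sub>2 p\<^sub>2 \<phi>\<^sub>2) J\<^sub>2' g \<and>
    (\<forall>q \<in> points (blowup X\<^sub>1 p\<^sub>1 \<phi>\<^sub>1). blow_down \<phi>\<^sub>2 (g q) = f (blow_down \<phi>\<^sub>1 q)) \<and>
    (\<forall>e \<in> tangent_space X\<^sub>1 p\<^sub>1. e \<noteq> (\<lambda>_. 0) \<longrightarrow>
      (\<forall>q \<in> exceptional_divisor X\<^sub>1 p\<^sub>1 \<phi>\<^sub>1.
        (q, Jline J\<^sub>1 p\<^sub>1 e) \<in> exc_ident X\<^sub>1 J\<^sub>1 p\<^sub>1 \<phi>\<^sub>1 \<longrightarrow>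
        g q \<in> exceptional_divisor X\<^sub>2 p\<^sub>2 \<phi>\<^sub>2 \<and>
        (g q, Jline J\<^sub>2 p\<^sub>2 (differential X\<^sub>1 X\<^sub>2 f p\<^sub>1 e)) \<in> exc_ident X\<^sub>2 J\<^sub>2 p\<^sub>2 \<phi>\<^sub>2))"
proof -
  have A: "smooth_atlas X\<^sub>1" "almost_complex_structure X\<^sub>1 J\<^sub>1" and B: "smooth_atlas X\<^sub>2" "almost_complex_structure X\<^sub>2 J\<^sub>2"
    using assms(1,2) by (auto simp: almost_complex_manifold_def smooth_manifold_def smooth_atlas_def)
  have f: "pseudoholomorphic X\<^sub>1 J\<^sub>1 X\<^sub>2 J\<^sub>2 f" and bij: "bij_betw f (points X\<^sub>1) (points X\<^sub>2)"
    and sf: "smooth_map X\<^sub>1 X\<^sub>2 f" and sh: "smooth_map X\<^sub>2 X\<^sub>1 (the_inv_into (points X\<^sub>1) f)"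
    using assms(3) by (auto simp: pseudobiholomorphism_def diffeomorphism_def)
  let ?h = "the_inv_into (points X\<^sub>1) f"
  have hf: "?h (f p) = p" if "p \<in> points X\<^sub>1" for p
    using bij that by (simp add: bij_betw_def the_inv_into_f_f)
  have fh: "f (?h p) = p" if "p \<in> points X\<^sub>2" for p
    using bij that by (simp add: bij_betw_def f_the_inv_into_f)
  have hp: "?h p\<^sub>2 = p\<^sub>1" using hf[OF assms(4)] assms(6) by simp
  have h: "pseudoholomorphic X\<^sub>2 J\<^sub>2 X\<^sub>1 J\<^sub>1 ?h"
    by (rule pseudoholomorphic_inverse[OF A B f sh hf fh])
  note bl1 = assms(7) and bl2 = assms(8)
  have cc: "chart_centred X\<^sub>1 p\<^sub>1 \<phi>\<^sub>1" and dd: "chart_centred X\<^sub>2 p\<^sub>2 \<phi>\<^sub>2"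
    using bl1 bl2 by (auto simp: almost_complex_blowup_def)
  let ?D = "dlrep \<phi>\<^sub>1 \<phi>\<^sub>2 f 0" and ?D' = "dlrep \<phi>\<^sub>2 \<phi>\<^sub>1 ?h 0"
  obtain K where "blowup_lift X\<^sub>1 X\<^sub>2 p\<^sub>1 p\<^sub>2 \<phi>\<^sub>1 \<phi>\<^sub>2 f ?D K"
    using ex_blowup_lift[OF A B f sh hf assms(6) bl1 bl2] by blast
  then interpret F: blowup_lift X\<^sub>1 X\<^sub>2 p\<^sub>1 p\<^sub>2 \<phi>\<^sub>1 \<phi>\<^sub>2 f ?D K .
  obtain K' where "blowup_lift X\<^sub>2 X\<^sub>1 p\<^sub>2 p\<^sub>1 \<phi>\<^sub>2 \<phi>\<^sub>1 ?h ?D' K'"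
    using ex_blowup_lift[OF B A h sf fh hp bl2 bl1] by blast
  then interpret H: blowup_lift X\<^sub>2 X\<^sub>1 p\<^sub>2 p\<^sub>1 \<phi>\<^sub>2 \<phi>\<^sub>1 ?h ?D' K' .
  let ?X = "blowup X\<^sub>1 p\<^sub>1 \<phi>\<^sub>1" and ?Y = "blowup X\<^sub>2 p\<^sub>2 \<phi>\<^sub>2"
  \<comment> \<open>The derivatives at the centres are inverse to each other, so the two lifts are
    mutually inverse on the exceptional divisors as well.\<close>
  have DD: "?D' (?D v) = v" "?D (?D' v) = v" for v
    using dlrep_left_inverse[OF A(1) B(1) sf sh hf F.charts(1,4) F.zero_ldom(1), of v]
      dlrep_left_inverse[OF B(1) A(1) sh sf fh H.charts(1,4) H.zero_ldom(1), of v]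
      F.zero_ldom(2) H.zero_ldom(2) by simp_all
  have HF: "H.g (F.g q) = q" if "q \<in> points ?X" for q
    by (cases rule: points_blowup_cases[OF cc that])
       (use F.f_eq_y hf DD F.D_nonzero in \<open>auto simp: F.g_Inl H.g_Inl F.g_Inr H.g_Inr\<close>)
  have FH: "F.g (H.g q) = q" if "q \<in> points ?Y" for q
    by (cases rule: points_blowup_cases[OF dd that])
       (use H.f_eq_y fh DD H.D_nonzero in \<open>auto simp: F.g_Inl H.g_Inl F.g_Inr H.g_Inr\<close>)
  have bijg: "bij_betw F.g (points ?X) (points ?Y)"
    by (rule bij_betw_byWitness[where f'=H.g]) (use HF FH F.g_points H.g_points in auto)
  have inv: "H.g q = the_inv_into (points ?X) F.g q" if "q \<in> points ?Y" for q
    using that bijg FH H.g_points by (intro the_inv_into_f_eq[symmetric]) (auto simp: bij_betw_def)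
  have "smooth_map ?Y ?X (the_inv_into (points ?X) F.g)"
    by (rule smooth_map_cong[OF smooth_atlas_blowup[OF B(1) dd] inv H.smooth_map_g])
  moreover have "pseudoholomorphic ?X J\<^sub>1' ?Y J\<^sub>2' F.g"
    by (rule F.pseudoholomorphic_g[OF A(2) B(2) f bl1 bl2])
  ultimately have 1: "pseudobiholomorphism ?X J\<^sub>1' ?Y J\<^sub>2' F.g"
    using bijg F.smooth_map_g by (simp add: pseudobiholomorphism_def diffeomorphism_def)
  have 2: "F.g q \<in> exceptional_divisor X\<^sub>2 p\<^sub>2 \<phi>\<^sub>2 \<and>
      (F.g q, Jline J\<^sub>2 p\<^sub>2 (differential X\<^sub>1 X\<^sub>2 f p\<^sub>1 e)) \<in> exc_ident X\<^sub>2 J\<^sub>2 p\<^sub>2 \<phi>\<^sub>2"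
    if e: "e \<in> tangent_space X\<^sub>1 p\<^sub>1" and q: "(q, Jline J\<^sub>1 p\<^sub>1 e) \<in> exc_ident X\<^sub>1 J\<^sub>1 p\<^sub>1 \<phi>\<^sub>1" for e q
  proof -
    obtain v where v: "v \<noteq> 0" "q = bl_class \<phi>\<^sub>1 (Inr (0, cline v))"
      "Jline J\<^sub>1 p\<^sub>1 e = Jline J\<^sub>1 p\<^sub>1 (dchart X\<^sub>1 \<phi>\<^sub>1 0 v)"
      using q by (auto simp: exc_ident_def)
    have gq: "F.g q = bl_class \<phi>\<^sub>2 (Inr (0, cline (?D v)))" using F.g_Inr[OF v(1)] v(2) by simp
    \<comment> \<open>\<open>e\<close> and \<open>dchart X\<^sub>1 \<phi>\<^sub>1 0 v\<close> are
      only known to span the same line, so the comparison is between the images of whole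
      lines.\<close>
    have Jline_differential: "Jline J\<^sub>2 p\<^sub>2 (differential X\<^sub>1 X\<^sub>2 f p\<^sub>1 w) = differential X\<^sub>1 X\<^sub>2 f p\<^sub>1 ` Jline J\<^sub>1 p\<^sub>1 w"
      if w: "w \<in> tangent_space X\<^sub>1 p\<^sub>1" for w
    proof -
      have Jw: "J\<^sub>1 p\<^sub>1 w \<in> tangent_space X\<^sub>1 p\<^sub>1" by (rule J_in_tangent_space[OF A assms(4) w])
      have lin: "differential X\<^sub>1 X\<^sub>2 f p\<^sub>1 (lincomb a w b (J\<^sub>1 p\<^sub>1 w))
          = lincomb a (differential X\<^sub>1 X\<^sub>2 f p\<^sub>1 w) b (differential X\<^sub>1 X\<^sub>2 f p\<^sub>1 (J\<^sub>1 p\<^sub>1 w))" for a b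
        by (rule differential_lincomb[OF A(1) B(1) sf assms(4) w Jw])
      have "J\<^sub>2 p\<^sub>2 (differential X\<^sub>1 X\<^sub>2 f p\<^sub>1 w) = differential X\<^sub>1 X\<^sub>2 f p\<^sub>1 (J\<^sub>1 p\<^sub>1 w)"
        using f w assms(4,6) unfolding pseudoholomorphic_def by metis
      then show ?thesis unfolding Jline_def by (auto simp: lin[symmetric])
    qed
    have dv: "dchart X\<^sub>1 \<phi>\<^sub>1 0 v \<in> tangent_space X\<^sub>1 p\<^sub>1"
      using dchart_in_tangent_space[OF A(1) F.charts(1,2), of v] F.charts(3) by simp
    have "differential X\<^sub>1 X\<^sub>2 f p\<^sub>1 (dchart X\<^sub>1 \<phi>\<^sub>1 0 v) = dchart X\<^sub>2 \<phi>\<^sub>2 0 (?D v)"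
      using differential_dchart[OF A(1) B(1) sf F.charts(1,4) F.zero_ldom(1), of v] F.zero_ldom(2) F.charts(3) by simp
    then have "Jline J\<^sub>2 p\<^sub>2 (differential X\<^sub>1 X\<^sub>2 f p\<^sub>1 e) = Jline J\<^sub>2 p\<^sub>2 (dchart X\<^sub>2 \<phi>\<^sub>2 0 (?D v))"
      using Jline_differential[OF e] Jline_differential[OF dv] v(3) by simp
    moreover have "F.g q \<in> exceptional_divisor X\<^sub>2 p\<^sub>2 \<phi>\<^sub>2"
      using points_blowupI(2)[OF dd F.D_nonzero[OF v(1)]] blow_down_class(2)[OF F.injd] F.charts(6)
      by (simp add: exceptional_divisor_def gq)
    ultimately show ?thesis using F.D_nonzero[OF v(1)] unfolding exc_ident_def gq by blast
  qed
  show ?thesis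
    by (intro exI[of _ F.g] conjI ballI impI 1 F.blow_down_g) (use 2 in blast)+
qed

end
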